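(* Let $(R,\mathfrak m,k)$ be a local ring and let $n\geq 0$ be an integer. Let $X$ be a non-zero direct summand of $\lambda\Omega^n k$. Then the following statements are equivalent: (i) $\operatorname{pd}_R(X)<\infty$. (ii) $\operatorname{pd}_R(X)=n$. (iii) $\operatorname{depth} R>n$.
   Context: All rings are commutative Noetherian local rings and all modules are finitely generated; $\operatorname{pd}$ denotes projective dimension. $\Omega^nM$ denotes the $n$-th syzygy of $M$ in its minimal free resolution ($\Omega^0M=M$, $\Omega=\Omega^1$). For an $R$-module $M$ with minimal free presentation $F_1\xrightarrow{f}F_0\to M\to 0$, the transpose $\operatorname{Tr}M$ is the cokernel of $f^*:\operatorname{Hom}_R(F_0,R)\to\operatorname{Hom}_R(F_1,R)$, and $\lambda M=\Omega\operatorname{Tr}M$; $\lambda 0=0$. *)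

theory Defs
  imports "HOL-Algebra.Module" "HOL-Algebra.QuotRing" "HOL-Algebra.Ring_Divisibility" "HOL-Library.Extended_Nat"
begin

locale noetherian_local_ring = cring R + noetherian_ring R + maximalideal \<mm> R
  for R (structure) and \<mm> +
  assumes maximal_unique: "maximalideal J R \<Longrightarrow> J = \<mm>"


section \<open>Modules and their homomorphisms\<close>

text \<open>The fields \<open>mult\<close> and \<open>one\<close> of a module record carry no meaning.\<close>

definition mod_hom ::
  "('a, 'r) ring_scheme \<Rightarrow> ('a, 'b, 'm) module_scheme \<Rightarrow> ('a, 'c, 'n) module_scheme \<Rightarrow> ('b \<Rightarrow> 'c) set"
  where "mod_hom R M N =
    {f. f \<in> carrier M \<rightarrow> carrier N \<and>
        (\<forall>x\<in>carrier M. \<forall>y\<in>carrier M. f (x \<oplus>\<^bsub>M\<^esub> y) = f x \<oplus>\<^bsub>N\<^esub> f y) \<and>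
        (\<forall>a\<in>carrier R. \<forall>x\<in>carrier M. f (a \<odot>\<^bsub>M\<^esub> x) = a \<odot>\<^bsub>N\<^esub> f x)}"

definition mod_iso ::
  "('a, 'r) ring_scheme \<Rightarrow> ('a, 'b, 'm) module_scheme \<Rightarrow> ('a, 'c, 'n) module_scheme \<Rightarrow> bool"
  where "mod_iso R M N \<longleftrightarrow>
    module R M \<and> module R N \<and> (\<exists>f\<in>mod_hom R M N. bij_betw f (carrier M) (carrier N))"

definition regular_module :: "('a, 'r) ring_scheme \<Rightarrow> ('a, 'a) module"
  where "regular_module R =
    \<lparr>carrier = carrier R, monoid.mult = (\<otimes>\<^bsub>R\<^esub>), monoid.one = \<one>\<^bsub>R\<^esub>,
     ring.zero = \<zero>\<^bsub>R\<^esub>, ring.add = (\<oplus>\<^bsub>R\<^esub>), smult = (\<otimes>\<^bsub>R\<^esub>)\<rparr>"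

definition free_mod :: "('a, 'r) ring_scheme \<Rightarrow> nat \<Rightarrow> ('a, nat \<Rightarrow> 'a) module"
  where "free_mod R n =
    \<lparr>carrier = {..<n} \<rightarrow>\<^sub>E carrier R, monoid.mult = undefined, monoid.one = undefined,
     ring.zero = (\<lambda>i\<in>{..<n}. \<zero>\<^bsub>R\<^esub>),
     ring.add = (\<lambda>u v. \<lambda>i\<in>{..<n}. u i \<oplus>\<^bsub>R\<^esub> v i),
     smult = (\<lambda>a v. \<lambda>i\<in>{..<n}. a \<otimes>\<^bsub>R\<^esub> v i)\<rparr>"

definition quot_mod :: "('a, 'b, 'm) module_scheme \<Rightarrow> 'b set \<Rightarrow> ('a, 'b set) module"
  where "quot_mod M N =
    \<lparr>carrier = a_rcosets\<^bsub>M\<^esub> N, monoid.mult = undefined, monoid.one = undefined,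
     ring.zero = N,
     ring.add = set_add M,
     smult = (\<lambda>a A. \<Union>x\<in>A. N +>\<^bsub>M\<^esub> (a \<odot>\<^bsub>M\<^esub> x))\<rparr>"

text \<open>\<open>Hom\<^sub>R(M, N)\<close>; homomorphisms are made extensional so that they are determined by
  their values on \<open>carrier M\<close>.\<close>

definition hom_mod ::
  "('a, 'r) ring_scheme \<Rightarrow> ('a, 'b, 'm) module_scheme \<Rightarrow> ('a, 'c, 'n) module_scheme
    \<Rightarrow> ('a, 'b \<Rightarrow> 'c) module"
  where "hom_mod R M N =
    \<lparr>carrier = mod_hom R M N \<inter> extensional (carrier M), monoid.mult = undefined, monoid.one = undefined,
     ring.zero = (\<lambda>x\<in>carrier M. \<zero>\<^bsub>N\<^esub>),
     ring.add = (\<lambda>f g. \<lambda>x\<in>carrier M. f x \<oplus>\<^bsub>N\<^esub> g x),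
     smult = (\<lambda>a f. \<lambda>x\<in>carrier M. a \<odot>\<^bsub>N\<^esub> f x)\<rparr>"

definition dual_mod :: "('a, 'r) ring_scheme \<Rightarrow> ('a, 'b, 'm) module_scheme \<Rightarrow> ('a, 'b \<Rightarrow> 'a) module"
  where "dual_mod R M = hom_mod R M (regular_module R)"

text \<open>The map \<open>f\<^sup>* : Hom\<^sub>R(N, R) \<rightarrow> Hom\<^sub>R(M, R)\<close> induced by \<open>f : M \<rightarrow> N\<close>.\<close>

definition dual_map :: "('a, 'b, 'm) module_scheme \<Rightarrow> ('b \<Rightarrow> 'c) \<Rightarrow> ('c \<Rightarrow> 'a) \<Rightarrow> ('b \<Rightarrow> 'a)"
  where "dual_map M f = (\<lambda>\<phi>. compose (carrier M) \<phi> f)"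

text \<open>The submodule \<open>I M\<close>, generated by the products.\<close>

definition ideal_mult :: "('a, 'r) ring_scheme \<Rightarrow> 'a set \<Rightarrow> ('a, 'b, 'm) module_scheme \<Rightarrow> 'b set"
  where "ideal_mult R I M =
    \<Inter>{N. submodule N R M \<and> (\<forall>a\<in>I. \<forall>x\<in>carrier M. a \<odot>\<^bsub>M\<^esub> x \<in> N)}"

text \<open>\<open>X\<close> is a direct summand of \<open>M\<close>, up to isomorphism: \<open>M\<close> is the internal direct sum
  of submodules \<open>U\<close> and \<open>V\<close> with \<open>X \<cong> U\<close>.\<close>

definition direct_summand ::
  "('a, 'r) ring_scheme \<Rightarrow> ('a, 'b, 'm) module_scheme \<Rightarrow> ('a, 'c, 'n) module_scheme \<Rightarrow> bool"
  where "direct_summand R X M \<longleftrightarrow>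
    module R M \<and>
    (\<exists>U V. submodule U R M \<and> submodule V R M \<and>
       U <+>\<^bsub>M\<^esub> V = carrier M \<and> U \<inter> V = {\<zero>\<^bsub>M\<^esub>} \<and>
       mod_iso R X (M\<lparr>carrier := U\<rparr>))"

definition residue_field_mod :: "('a, 'r) ring_scheme \<Rightarrow> 'a set \<Rightarrow> ('a, 'a set) module"
  where "residue_field_mod R \<mm> = quot_mod (regular_module R) \<mm>"


section \<open>Minimal free resolutions, syzygies and transposes\<close>

text \<open>The resolution
  \<open>\<cdots> \<rightarrow> R\<^bsup>b 2\<^esup> \<rightarrow> R\<^bsup>b 1\<^esup> \<rightarrow> R\<^bsup>b 0\<^esup> \<rightarrow> M \<rightarrow> 0\<close>
  with differentials \<open>d i : R\<^bsup>b (i + 1)\<^esup> \<rightarrow> R\<^bsup>b i\<^esup>\<close> and augmentation \<open>e\<close>.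
  Minimality says that the image of each \<open>d i\<close> lies in \<open>\<mm> R\<^bsup>b i\<^esup>\<close>.\<close>

definition min_free_resolution ::
  "('a, 'r) ring_scheme \<Rightarrow> 'a set \<Rightarrow> ('a, 'b, 'm) module_scheme
    \<Rightarrow> (nat \<Rightarrow> nat) \<Rightarrow> (nat \<Rightarrow> (nat \<Rightarrow> 'a) \<Rightarrow> (nat \<Rightarrow> 'a)) \<Rightarrow> ((nat \<Rightarrow> 'a) \<Rightarrow> 'b) \<Rightarrow> bool"
  where "min_free_resolution R \<mm> M b d e \<longleftrightarrow>
    (let F = (\<lambda>i. free_mod R (b i)) in
      module R M \<and>
      e \<in> mod_hom R (F 0) M \<and>
      (\<forall>i. d i \<in> mod_hom R (F (Suc i)) (F i)) \<and>
      e ` carrier (F 0) = carrier M \<and>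
      d 0 ` carrier (F 1) = a_kernel (F 0) M e \<and>
      (\<forall>i. d (Suc i) ` carrier (F (Suc (Suc i))) = a_kernel (F (Suc i)) (F i) (d i)) \<and>
      (\<forall>i. d i ` carrier (F (Suc i)) \<subseteq> ideal_mult R \<mm> (F i)))"

text \<open>\<open>N\<close> is (isomorphic to) the \<open>n\<close>-th syzygy \<open>\<Omega>\<^sup>n M\<close>. As minimal free resolutions are unique only
  up to isomorphism, syzygies, transposes and \<open>\<lambda>\<close> are treated as relations closed under
  isomorphism.\<close>

definition is_syzygy ::
  "('a, 'r) ring_scheme \<Rightarrow> 'a set \<Rightarrow> nat \<Rightarrow> ('a, 'b, 'm) module_scheme \<Rightarrow> ('a, 'c, 'n) module_scheme
    \<Rightarrow> bool"
  where "is_syzygy R \<mm> n M N \<longleftrightarrow>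
    n = 0 \<and> mod_iso R N M \<or>
    (\<exists>j b d e. n = Suc j \<and> min_free_resolution R \<mm> M b d e \<and>
      mod_iso R N ((free_mod R (b j))\<lparr>carrier := d j ` carrier (free_mod R (b (Suc j)))\<rparr>))"

text \<open>A presentation \<open>R\<^sup>q \<rightarrow> R\<^sup>p \<rightarrow> M \<rightarrow> 0\<close> with maps \<open>f\<close> and \<open>e\<close> that is the beginning of a
  minimal free resolution.\<close>

definition min_free_presentation ::
  "('a, 'r) ring_scheme \<Rightarrow> 'a set \<Rightarrow> ('a, 'b, 'm) module_scheme
    \<Rightarrow> nat \<Rightarrow> nat \<Rightarrow> ((nat \<Rightarrow> 'a) \<Rightarrow> (nat \<Rightarrow> 'a)) \<Rightarrow> ((nat \<Rightarrow> 'a) \<Rightarrow> 'b) \<Rightarrow> bool"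
  where "min_free_presentation R \<mm> M q p f e \<longleftrightarrow>
    (let F1 = free_mod R q; F0 = free_mod R p in
      module R M \<and>
      f \<in> mod_hom R F1 F0 \<and> e \<in> mod_hom R F0 M \<and>
      e ` carrier F0 = carrier M \<and>
      f ` carrier F1 = a_kernel F0 M e \<and>
      a_kernel F0 M e \<subseteq> ideal_mult R \<mm> F0 \<and>
      a_kernel F1 F0 f \<subseteq> ideal_mult R \<mm> F1)"

definition is_transpose ::
  "('a, 'r) ring_scheme \<Rightarrow> 'a set \<Rightarrow> ('a, 'b, 'm) module_scheme \<Rightarrow> ('a, 'c, 'n) module_scheme \<Rightarrow> bool"
  where "is_transpose R \<mm> M T \<longleftrightarrow>
    (\<exists>q p f e. min_free_presentation R \<mm> M q p f e \<and>
      (let F1 = free_mod R q; F0 = free_mod R p in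
        mod_iso R T
          (quot_mod (dual_mod R F1) (dual_map F1 f ` carrier (dual_mod R F0)))))"

text \<open>\<open>L\<close> is (isomorphic to) \<open>\<lambda> M = \<Omega> Tr M\<close>. The type chosen for \<open>T\<close> is the one of the
  concrete cokernel in the definition of the transpose.\<close>

definition is_lambda ::
  "('a, 'r) ring_scheme \<Rightarrow> 'a set \<Rightarrow> ('a, 'b, 'm) module_scheme \<Rightarrow> ('a, 'c, 'n) module_scheme \<Rightarrow> bool"
  where "is_lambda R \<mm> M L \<longleftrightarrow>
    (\<exists>T :: ('a, ((nat \<Rightarrow> 'a) \<Rightarrow> 'a) set) module.
      is_transpose R \<mm> M T \<and> is_syzygy R \<mm> 1 T L)"


section \<open>Projective dimension\<close>

definition fg_projective :: "('a, 'r) ring_scheme \<Rightarrow> ('a, 'b, 'm) module_scheme \<Rightarrow> bool"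
  where "fg_projective R P \<longleftrightarrow> (\<exists>n. direct_summand R P (free_mod R n))"

text \<open>An exact sequence \<open>0 \<rightarrow> P n \<rightarrow> \<cdots> \<rightarrow> P 0 \<rightarrow> M \<rightarrow> 0\<close>, continued by zero modules. Every finitely
  generated projective module is isomorphic to a submodule of some \<open>R\<^sup>m\<close>, so the carrier type
  \<open>nat \<Rightarrow> 'a\<close> is no restriction on the \<open>P i\<close>.\<close>

definition projective_resolution ::
  "('a, 'r) ring_scheme \<Rightarrow> ('a, 'b, 'm) module_scheme \<Rightarrow> nat
    \<Rightarrow> (nat \<Rightarrow> ('a, nat \<Rightarrow> 'a) module) \<Rightarrow> (nat \<Rightarrow> (nat \<Rightarrow> 'a) \<Rightarrow> (nat \<Rightarrow> 'a)) \<Rightarrow> ((nat \<Rightarrow> 'a) \<Rightarrow> 'b)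
    \<Rightarrow> bool"
  where "projective_resolution R M n P d e \<longleftrightarrow>
    module R M \<and>
    (\<forall>i. fg_projective R (P i)) \<and>
    (\<forall>i>n. carrier (P i) = {\<zero>\<^bsub>P i\<^esub>}) \<and>
    e \<in> mod_hom R (P 0) M \<and>
    (\<forall>i. d i \<in> mod_hom R (P (Suc i)) (P i)) \<and>
    e ` carrier (P 0) = carrier M \<and>
    d 0 ` carrier (P 1) = a_kernel (P 0) M e \<and>
    (\<forall>i. d (Suc i) ` carrier (P (Suc (Suc i))) = a_kernel (P (Suc i)) (P i) (d i))"

text \<open>For finitely generated \<open>M\<close> over a Noetherian ring. The infimum of the empty set is \<open>\<infinity>\<close>;
  the zero module gets the value \<open>0\<close>.\<close>

definition projdim :: "('a, 'r) ring_scheme \<Rightarrow> ('a, 'b, 'm) module_scheme \<Rightarrow> enat"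
  where "projdim R M = Inf (enat ` {n. \<exists>P d e. projective_resolution R M n P d e})"


section \<open>Depth\<close>

definition regular_sequence :: "('a, 'r) ring_scheme \<Rightarrow> 'a list \<Rightarrow> bool"
  where "regular_sequence R xs \<longleftrightarrow>
    set xs \<subseteq> carrier R \<and>
    (\<forall>i<length xs. let I = Idl\<^bsub>R\<^esub> (set (take i xs)); S = R Quot I in
       \<forall>y\<in>carrier S. (I +>\<^bsub>R\<^esub> (xs ! i)) \<otimes>\<^bsub>S\<^esub> y = \<zero>\<^bsub>S\<^esub> \<longrightarrow> y = \<zero>\<^bsub>S\<^esub>) \<and>
    Idl\<^bsub>R\<^esub> (set xs) \<noteq> carrier R"

definition local_depth :: "('a, 'r) ring_scheme \<Rightarrow> 'a set \<Rightarrow> enat"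
  where "local_depth R \<mm> = Sup {enat (length xs) | xs. regular_sequence R xs \<and> set xs \<subseteq> \<mm>}"

end

theory Submission
  imports Defs
begin

text \<open>Let \<open>F\<close> be a minimal free resolution of \<open>k\<close> with dual \<open>F\<^sup>*\<close>. Up to isomorphism, \<open>\<lambda>\<Omega>\<^sup>n k\<close> is the image
  of \<open>F\<^sup>*\<^sub>n \<rightarrow> F\<^sup>*\<^bsub>n+1\<^esub>\<close>; let \<open>X\<close> be a non-zero direct summand of it and \<open>G\<close> a minimal free resolution
  of \<open>X\<close>.

  If \<open>depth R > n\<close>, then \<open>Ext\<^sup>i(k, R) = 0\<close> for \<open>i \<le> n\<close>, so \<open>0 \<rightarrow> F\<^sup>*\<^sub>0 \<rightarrow> \<cdots> \<rightarrow> F\<^sup>*\<^sub>n\<close> resolves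
  \<open>\<lambda>\<Omega>\<^sup>n k\<close>. Lifting the inclusion and projection of the summand shows that \<open>G\<close> vanishes above \<open>n\<close>.
  Were \<open>G\<^sub>n = 0\<close>, then dualizing the lifted projection and using the exactness of \<open>F\<close> would
  give \<open>G\<^sub>j = 0\<close> for all \<open>j < n\<close>, successively from above. Hence \<open>pd X = n\<close>.

  Suppose that \<open>t = depth R \<le> n\<close> and that \<open>G\<close> has finite length \<open>p\<close>, and let \<open>x\<^sub>1, \<dots>, x\<^sub>t\<close> be a
  maximal regular sequence. Augment \<open>G\<close> by \<open>F\<^sup>*\<^bsub>n+1\<^esub>\<close>, which is a minimal resolution of \<open>F\<^sup>*\<^bsub>n+1\<^esub> / X\<close>. A
  socle element modulo the sequence forces \<open>p + 1 \<le> t\<close>. On the other hand, multiplication by an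
  element of the maximal ideal is null-homotopic on \<open>F\<close>, so on \<open>X\<close> it factors through the free
  module \<open>F\<^sup>*\<^sub>n\<close> and kills \<open>Ext\<^sup>j(X, -)\<close> for \<open>j \<ge> 1\<close>. Together with the regular sequence this
  gives \<open>Ext\<^sup>j(F\<^sup>*\<^bsub>n+1\<^esub> / X, R) = 0\<close> for \<open>1 \<le> j \<le> t\<close>, in particular for \<open>j = p + 1\<close>, so that the last map
  of \<open>G\<close> is split injective, contradicting minimality.\<close>

section \<open>Free modules and homomorphisms\<close>

text \<open>The obstacle in small depth is degree one. Let E be the quotient of the dual free module
  of index n+1 by X. The homotopy makes each x in \<mm> kill Ext^j(X, -) only for j >= 1, that is,
  Ext^j(E, -) for j >= 2. For Ext^1(E, R/(x_1, ..., x_i)) with i < t a separate argument is needed: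
  a cocycle is pulled back to a vector of F_n, and Tor_n(k, R/(x_1, ..., x_i)) = 0 is applied. This
  requires i < n, and here t <= n enters. From there one trades an element of the sequence for a
  degree until Ext^t(E, R) is reached. E is used instead of X because its top degree p + 1 is
  positive even when X is free. No Ext or Tor module is formed. Vanishing over R/I is phrased as: a
  vector that is a cycle up to coordinates in I is a boundary up to coordinates in I. So all maps
  stay between modules R^m, and R^m is its own dual through the dot product.\<close>

lemma carrier_free_mod: "carrier (free_mod R n) = {..<n} \<rightarrow>\<^sub>E carrier R"
  by (simp add: free_mod_def)

lemma free_mod_eqI:
  assumes "u \<in> carrier (free_mod R n)" "v \<in> carrier (free_mod R n)"
    and "\<And>i. i < n \<Longrightarrow> u i = v i"
  shows "u = v"
  using assms unfolding carrier_free_mod by (auto intro: PiE_ext)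

lemma free_mod_coord [simp, intro]:
  "v \<in> carrier (free_mod R n) \<Longrightarrow> i < n \<Longrightarrow> v i \<in> carrier R"
  unfolding carrier_free_mod by auto

lemma free_mod_add_coord [simp]: "i < n \<Longrightarrow> (u \<oplus>\<^bsub>free_mod R n\<^esub> v) i = u i \<oplus>\<^bsub>R\<^esub> v i"
  by (simp add: free_mod_def)

lemma free_mod_smult_coord [simp]: "i < n \<Longrightarrow> (a \<odot>\<^bsub>free_mod R n\<^esub> v) i = a \<otimes>\<^bsub>R\<^esub> v i"
  by (simp add: free_mod_def)

lemma free_mod_zero_coord [simp]: "i < n \<Longrightarrow> \<zero>\<^bsub>free_mod R n\<^esub> i = \<zero>\<^bsub>R\<^esub>"
  by (simp add: free_mod_def)

lemma (in cring) free_mod_closed: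
  "u \<in> carrier (free_mod R n) \<Longrightarrow> v \<in> carrier (free_mod R n) \<Longrightarrow> u \<oplus>\<^bsub>free_mod R n\<^esub> v \<in> carrier (free_mod R n)"
  "\<zero>\<^bsub>free_mod R n\<^esub> \<in> carrier (free_mod R n)"
  "a \<in> carrier R \<Longrightarrow> v \<in> carrier (free_mod R n) \<Longrightarrow> a \<odot>\<^bsub>free_mod R n\<^esub> v \<in> carrier (free_mod R n)"
  by (auto simp: free_mod_def PiE_mem)

lemma (in cring) module_free_mod: "module R (free_mod R n)"
proof (rule moduleI)
  show "abelian_group (free_mod R n)"
  proof (rule abelian_groupI)
    fix x assume x: "x \<in> carrier (free_mod R n)"
    define y where "y = (\<lambda>i\<in>{..<n}. \<ominus> (x i))"
    have y: "y \<in> carrier (free_mod R n)"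
      using x by (auto simp: y_def carrier_free_mod)
    moreover have "y \<oplus>\<^bsub>free_mod R n\<^esub> x = \<zero>\<^bsub>free_mod R n\<^esub>"
      using x y by (intro free_mod_eqI[of _ R n]) (auto simp: free_mod_closed y_def l_neg)
    ultimately show "\<exists>y\<in>carrier (free_mod R n). y \<oplus>\<^bsub>free_mod R n\<^esub> x = \<zero>\<^bsub>free_mod R n\<^esub>"
      by blast
  next
    fix x y z
    assume "x \<in> carrier (free_mod R n)" "y \<in> carrier (free_mod R n)" "z \<in> carrier (free_mod R n)"
    then show "x \<oplus>\<^bsub>free_mod R n\<^esub> y \<oplus>\<^bsub>free_mod R n\<^esub> z = x \<oplus>\<^bsub>free_mod R n\<^esub> (y \<oplus>\<^bsub>free_mod R n\<^esub> z)"
      by (intro free_mod_eqI[of _ R n]) (simp_all add: free_mod_closed a_assoc)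
  next
    fix x y
    assume "x \<in> carrier (free_mod R n)" "y \<in> carrier (free_mod R n)"
    then show "x \<oplus>\<^bsub>free_mod R n\<^esub> y = y \<oplus>\<^bsub>free_mod R n\<^esub> x"
      by (intro free_mod_eqI[of _ R n]) (simp_all add: free_mod_closed a_comm)
  next
    fix x
    assume "x \<in> carrier (free_mod R n)"
    then show "\<zero>\<^bsub>free_mod R n\<^esub> \<oplus>\<^bsub>free_mod R n\<^esub> x = x"
      by (intro free_mod_eqI[of _ R n]) (simp_all add: free_mod_closed)
  qed (simp_all add: free_mod_closed)
next
  fix a b x assume "a \<in> carrier R" "b \<in> carrier R" "x \<in> carrier (free_mod R n)"
  then show "(a \<oplus> b) \<odot>\<^bsub>free_mod R n\<^esub> x = a \<odot>\<^bsub>free_mod R n\<^esub> x \<oplus>\<^bsub>free_mod R n\<^esub> b \<odot>\<^bsub>free_mod R n\<^esub> x"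
    and "(a \<otimes> b) \<odot>\<^bsub>free_mod R n\<^esub> x = a \<odot>\<^bsub>free_mod R n\<^esub> (b \<odot>\<^bsub>free_mod R n\<^esub> x)"
    by (auto intro!: free_mod_eqI[of _ R n] simp: free_mod_closed l_distr m_assoc)
next
  fix a x y assume "a \<in> carrier R" "x \<in> carrier (free_mod R n)" "y \<in> carrier (free_mod R n)"
  then show "a \<odot>\<^bsub>free_mod R n\<^esub> (x \<oplus>\<^bsub>free_mod R n\<^esub> y) = a \<odot>\<^bsub>free_mod R n\<^esub> x \<oplus>\<^bsub>free_mod R n\<^esub> a \<odot>\<^bsub>free_mod R n\<^esub> y"
    by (auto intro!: free_mod_eqI[of _ R n] simp: free_mod_closed r_distr)
next
  fix x assume "x \<in> carrier (free_mod R n)"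
  then show "\<one> \<odot>\<^bsub>free_mod R n\<^esub> x = x"
    by (auto intro!: free_mod_eqI[of _ R n] simp: free_mod_closed)
qed (simp_all add: free_mod_closed is_cring)

sublocale cring \<subseteq> V: module R "free_mod R n" for n
  by (rule module_free_mod)

lemma (in cring) free_mod_neg_coord [simp]:
  assumes "v \<in> carrier (free_mod R n)" "i < n"
  shows "(\<ominus>\<^bsub>free_mod R n\<^esub> v) i = \<ominus> (v i)"
proof -
  have "(v \<oplus>\<^bsub>free_mod R n\<^esub> (\<ominus>\<^bsub>free_mod R n\<^esub> v)) i = \<zero>"
    using assms by (simp add: V.r_neg)
  then show ?thesis
    using assms by (metis V.a_inv_closed a_comm free_mod_add_coord free_mod_coord minus_equality)
qed

lemma (in cring) free_mod_finsum_coord: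
  assumes "i < n" "f \<in> A \<rightarrow> carrier (free_mod R n)"
  shows "finsum (free_mod R n) f A i = (\<Oplus>k\<in>A. f k i)"
  using assms(2)
proof (induction A rule: infinite_finite_induct)
  case (insert x F)
  then have "f \<in> F \<rightarrow> carrier (free_mod R n)" "(\<lambda>k. f k i) \<in> F \<rightarrow> carrier R"
    using assms(1) by auto
  with insert assms(1) show ?case
    by (simp add: V.finsum_insert)
qed (use assms(1) in \<open>simp_all add: V.M.finsum_infinite V.M.finsum_empty\<close>)

lemma module_regular: "cring R \<Longrightarrow> module R (regular_module R)"
proof -
  assume "cring R"
  then interpret cring R .
  show ?thesis
  proof (rule moduleI)
    show "abelian_group (regular_module R)"
      by (rule abelian_groupI)
        (auto simp: regular_module_def a_ac intro: l_neg)
  qed (auto simp: regular_module_def is_cring l_distr r_distr m_assoc)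
qed

subsection \<open>Homomorphisms\<close>

lemma mod_homI:
  assumes "\<And>x. x \<in> carrier M \<Longrightarrow> f x \<in> carrier N"
    and "\<And>x y. x \<in> carrier M \<Longrightarrow> y \<in> carrier M \<Longrightarrow> f (x \<oplus>\<^bsub>M\<^esub> y) = f x \<oplus>\<^bsub>N\<^esub> f y"
    and "\<And>a x. a \<in> carrier R \<Longrightarrow> x \<in> carrier M \<Longrightarrow> f (a \<odot>\<^bsub>M\<^esub> x) = a \<odot>\<^bsub>N\<^esub> f x"
  shows "f \<in> mod_hom R M N"
  using assms unfolding mod_hom_def by auto

lemma mod_hom_closed: "f \<in> mod_hom R M N \<Longrightarrow> x \<in> carrier M \<Longrightarrow> f x \<in> carrier N"
  unfolding mod_hom_def by auto

lemma mod_hom_add: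
  "f \<in> mod_hom R M N \<Longrightarrow> x \<in> carrier M \<Longrightarrow> y \<in> carrier M \<Longrightarrow> f (x \<oplus>\<^bsub>M\<^esub> y) = f x \<oplus>\<^bsub>N\<^esub> f y"
  unfolding mod_hom_def by auto

lemma mod_hom_smult:
  "f \<in> mod_hom R M N \<Longrightarrow> a \<in> carrier R \<Longrightarrow> x \<in> carrier M \<Longrightarrow> f (a \<odot>\<^bsub>M\<^esub> x) = a \<odot>\<^bsub>N\<^esub> f x"
  unfolding mod_hom_def by auto

lemma mod_hom_zero:
  assumes "f \<in> mod_hom R M N" "module R M" "module R N"
  shows "f \<zero>\<^bsub>M\<^esub> = \<zero>\<^bsub>N\<^esub>"
proof -
  interpret M: module R M by fact
  interpret N: module R N by fact
  have "f (\<zero>\<^bsub>R\<^esub> \<odot>\<^bsub>M\<^esub> \<zero>\<^bsub>M\<^esub>) = \<zero>\<^bsub>R\<^esub> \<odot>\<^bsub>N\<^esub> f \<zero>\<^bsub>M\<^esub>"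
    using assms(1) by (intro mod_hom_smult) auto
  then show ?thesis
    using mod_hom_closed[OF assms(1), of "\<zero>\<^bsub>M\<^esub>"] by simp
qed

lemma mod_hom_neg:
  assumes "f \<in> mod_hom R M N" "module R M" "module R N" "x \<in> carrier M"
  shows "f (\<ominus>\<^bsub>M\<^esub> x) = \<ominus>\<^bsub>N\<^esub> f x"
proof -
  interpret M: module R M by fact
  interpret N: module R N by fact
  have "f ((\<ominus>\<^bsub>R\<^esub> \<one>\<^bsub>R\<^esub>) \<odot>\<^bsub>M\<^esub> x) = (\<ominus>\<^bsub>R\<^esub> \<one>\<^bsub>R\<^esub>) \<odot>\<^bsub>N\<^esub> f x"
    using assms by (intro mod_hom_smult) auto
  then show ?thesis
    using mod_hom_closed[OF assms(1), of x] assms(4) by (simp add: M.smult_l_minus N.smult_l_minus)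
qed

lemma mod_hom_diff:
  assumes "f \<in> mod_hom R M N" "module R M" "module R N" "x \<in> carrier M" "y \<in> carrier M"
  shows "f (x \<ominus>\<^bsub>M\<^esub> y) = f x \<ominus>\<^bsub>N\<^esub> f y"
proof -
  interpret M: module R M by fact
  show ?thesis
    using assms by (simp add: a_minus_def mod_hom_add mod_hom_neg)
qed

lemma mod_hom_finsum:
  assumes "f \<in> mod_hom R M N" "module R M" "module R N" "g \<in> A \<rightarrow> carrier M"
  shows "f (finsum M g A) = finsum N (\<lambda>i. f (g i)) A"
proof -
  interpret M: module R M by fact
  interpret N: module R N by fact
  show ?thesis using assms(4)
  proof (induction A rule: infinite_finite_induct)
    case (insert x F)
    then have "(\<lambda>i. f (g i)) \<in> F \<rightarrow> carrier N" "g \<in> F \<rightarrow> carrier M" "g x \<in> carrier M"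
      using mod_hom_closed[OF assms(1)] by auto
    with insert show ?case
      using mod_hom_closed[OF assms(1)] by (simp add: mod_hom_add[OF assms(1)])
  qed (use mod_hom_zero[OF assms(1-3)] in simp_all)
qed

lemma mod_hom_comp:
  "f \<in> mod_hom R M N \<Longrightarrow> g \<in> mod_hom R N P \<Longrightarrow> (\<lambda>x. g (f x)) \<in> mod_hom R M P"
  by (intro mod_homI) (simp_all add: mod_hom_closed mod_hom_add mod_hom_smult)

lemma mod_hom_id: "(\<lambda>x. x) \<in> mod_hom R M M"
  unfolding mod_hom_def by auto

lemma mod_hom_const_zero:
  assumes "module R N"
  shows "(\<lambda>x. \<zero>\<^bsub>N\<^esub>) \<in> mod_hom R M N"
proof -
  interpret N: module R N by fact
  show ?thesis by (rule mod_homI) auto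
qed

lemma mod_hom_scale:
  assumes "f \<in> mod_hom R M N" "a \<in> carrier R" "module R N"
  shows "(\<lambda>x. a \<odot>\<^bsub>N\<^esub> f x) \<in> mod_hom R M N"
proof -
  interpret N: module R N by fact
  show ?thesis
    using assms
    by (intro mod_homI)
      (simp_all add: mod_hom_closed mod_hom_add mod_hom_smult N.smult_r_distr
        N.smult_assoc1[symmetric] N.m_comm)
qed

lemma mod_hom_minus:
  assumes "f \<in> mod_hom R M N" "g \<in> mod_hom R M N" "module R N"
  shows "(\<lambda>x. f x \<ominus>\<^bsub>N\<^esub> g x) \<in> mod_hom R M N"
proof -
  interpret N: module R N by fact
  show ?thesis
    using assms
    by (intro mod_homI)
      (simp_all add: mod_hom_closed mod_hom_add mod_hom_smult N.smult_r_distr N.smult_r_minus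
        a_minus_def N.minus_add N.a_ac)
qed

lemma mod_hom_image_submodule:
  assumes "f \<in> mod_hom R M N" "module R M" "module R N" "submodule H R M"
  shows "submodule (f ` H) R N"
proof -
  interpret M: module R M by fact
  interpret N: module R N by fact
  note H = M.submoduleE[OF assms(4)]
  have sub: "\<And>x. x \<in> H \<Longrightarrow> x \<in> carrier M" using H(1) by auto
  have z: "\<zero>\<^bsub>M\<^esub> \<in> H" using submodule.axioms(1)[OF assms(4)] subgroup.one_closed by fastforce
  show ?thesis
  proof (rule N.submoduleI)
    show "\<zero>\<^bsub>N\<^esub> \<in> f ` H" using mod_hom_zero[OF assms(1-3)] z by force
  next
    fix a assume "a \<in> f ` H"
    then show "\<ominus>\<^bsub>N\<^esub> a \<in> f ` H"
      using mod_hom_neg[OF assms(1-3)] H(3) sub by (metis (no_types, lifting) imageE imageI)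
  next
    fix a b assume "a \<in> f ` H" "b \<in> f ` H"
    then show "a \<oplus>\<^bsub>N\<^esub> b \<in> f ` H"
      using mod_hom_add[OF assms(1)] H(5) sub by (smt (verit, best) imageE imageI)
  next
    fix a x assume "a \<in> carrier R" "x \<in> f ` H"
    then show "a \<odot>\<^bsub>N\<^esub> x \<in> f ` H"
      using mod_hom_smult[OF assms(1)] H(4) sub by (smt (verit, best) imageE imageI)
  qed (use mod_hom_closed[OF assms(1)] sub in auto)
qed

lemma submodule_kernel:
  assumes "f \<in> mod_hom R M N" "module R M" "module R N"
  shows "submodule (a_kernel M N f) R M"
proof -
  interpret M: module R M by fact
  interpret N: module R N by fact
  show ?thesis
    using assms
    by (intro M.submoduleI)
      (auto simp: a_kernel_def' mod_hom_zero mod_hom_neg mod_hom_add mod_hom_smult)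
qed

text \<open>Syzygies and summands are given as a module whose carrier is cut down to a subset, so
  the inverse of an embedding is a map out of such a restricted copy of \<open>N\<close>.\<close>

lemma mod_hom_inverse:
  assumes "module R M" "i \<in> mod_hom R M N" "inj_on i (carrier M)"
  obtains k where "k \<in> mod_hom R (N\<lparr>carrier := i ` carrier M\<rparr>) M"
    "\<And>x. x \<in> carrier M \<Longrightarrow> k (i x) = x"
proof -
  interpret M: module R M by fact
  define k where "k = the_inv_into (carrier M) i"
  have k: "k (i x) = x" if "x \<in> carrier M" for x
    using that assms(3) unfolding k_def by (simp add: the_inv_into_f_f)
  have "k \<in> mod_hom R (N\<lparr>carrier := i ` carrier M\<rparr>) M"
    by (rule mod_homI) (auto simp: k mod_hom_add[OF assms(2), symmetric] mod_hom_smult[OF assms(2), symmetric])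
  with k show ?thesis using that by blast
qed

subsection \<open>Unit vectors, linear combinations, dot products and transposes\<close>

definition unit_vec :: "('a, 'r) ring_scheme \<Rightarrow> nat \<Rightarrow> nat \<Rightarrow> nat \<Rightarrow> 'a" where
  "unit_vec R n l = (\<lambda>i\<in>{..<n}. if i = l then \<one>\<^bsub>R\<^esub> else \<zero>\<^bsub>R\<^esub>)"

definition lin_comb ::
  "('a, 'b, 'm) module_scheme \<Rightarrow> nat \<Rightarrow> (nat \<Rightarrow> 'b) \<Rightarrow> (nat \<Rightarrow> 'a) \<Rightarrow> 'b" where
  "lin_comb M n s v = (\<Oplus>\<^bsub>M\<^esub>i\<in>{..<n}. v i \<odot>\<^bsub>M\<^esub> s i)"

definition dot :: "('a, 'r) ring_scheme \<Rightarrow> nat \<Rightarrow> (nat \<Rightarrow> 'a) \<Rightarrow> (nat \<Rightarrow> 'a) \<Rightarrow> 'a" where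
  "dot R n u v = (\<Oplus>\<^bsub>R\<^esub>i\<in>{..<n}. u i \<otimes>\<^bsub>R\<^esub> v i)"

text \<open>The dual map f^* read through the identification of R^n with its dual by the dot
  product. Only when the actual cokernel of the transpose is treated do functions in a Hom module
  return.\<close>

definition transpose_map ::
  "('a, 'r) ring_scheme \<Rightarrow> nat \<Rightarrow> nat \<Rightarrow> ((nat \<Rightarrow> 'a) \<Rightarrow> (nat \<Rightarrow> 'a)) \<Rightarrow> (nat \<Rightarrow> 'a) \<Rightarrow> (nat \<Rightarrow> 'a)" where
  "transpose_map R m n f w = (\<lambda>i\<in>{..<m}. dot R n w (f (unit_vec R m i)))"

context cring
begin

abbreviation V :: "nat \<Rightarrow> ('a, nat \<Rightarrow> 'a) module" where "V \<equiv> free_mod R"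
abbreviation vecs :: "nat \<Rightarrow> (nat \<Rightarrow> 'a) set" where "vecs n \<equiv> carrier (free_mod R n)"
abbreviation lin :: "nat \<Rightarrow> nat \<Rightarrow> ((nat \<Rightarrow> 'a) \<Rightarrow> (nat \<Rightarrow> 'a)) set"
  where "lin m n \<equiv> mod_hom R (free_mod R m) (free_mod R n)"

lemma unit_vec_closed [simp, intro]: "unit_vec R n l \<in> vecs n"
  by (auto simp: unit_vec_def carrier_free_mod)

lemma unit_vec_coord: "i < n \<Longrightarrow> unit_vec R n l i = (if i = l then \<one> else \<zero>)"
  by (simp add: unit_vec_def)

lemma free_mod_expand:
  assumes "v \<in> vecs n"
  shows "lin_comb (V n) n (unit_vec R n) v = v"
proof (rule free_mod_eqI[of _ R n])
  have c: "(\<lambda>i. v i \<odot>\<^bsub>V n\<^esub> unit_vec R n i) \<in> {..<n} \<rightarrow> vecs n"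
    using assms by auto
  show "lin_comb (V n) n (unit_vec R n) v \<in> vecs n"
    unfolding lin_comb_def using c by (rule V.M.finsum_closed)
  fix i assume i: "i < n"
  have "lin_comb (V n) n (unit_vec R n) v i
      = (\<Oplus>k\<in>{..<n}. (v k \<odot>\<^bsub>V n\<^esub> unit_vec R n k) i)"
    unfolding lin_comb_def using i c by (rule free_mod_finsum_coord)
  also have "\<dots> = (\<Oplus>k\<in>{..<n}. if i = k then v k else \<zero>)"
    using i assms by (intro finsum_cong') (auto simp: unit_vec_coord)
  also have "\<dots> = v i"
    using i assms by (intro finsum_singleton) auto
  finally show "lin_comb (V n) n (unit_vec R n) v i = v i" .
qed (rule assms)

lemma lin_comb_hom:
  assumes "module R M" "\<And>i. i < n \<Longrightarrow> s i \<in> carrier M"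
  shows "lin_comb M n s \<in> mod_hom R (V n) M"
proof -
  interpret M: module R M by fact
  have c: "(\<lambda>i. v i \<odot>\<^bsub>M\<^esub> s i) \<in> {..<n} \<rightarrow> carrier M" if "v \<in> vecs n" for v
    using that assms by auto
  show ?thesis
  proof (rule mod_homI)
    fix v assume "v \<in> vecs n"
    then show "lin_comb M n s v \<in> carrier M"
      unfolding lin_comb_def using c by (intro M.finsum_closed)
  next
    fix u v assume uv: "u \<in> vecs n" "v \<in> vecs n"
    have "lin_comb M n s (u \<oplus>\<^bsub>V n\<^esub> v)
        = (\<Oplus>\<^bsub>M\<^esub>i\<in>{..<n}. u i \<odot>\<^bsub>M\<^esub> s i \<oplus>\<^bsub>M\<^esub> v i \<odot>\<^bsub>M\<^esub> s i)"
      unfolding lin_comb_def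
      using uv assms(2) by (intro M.finsum_cong') (auto simp: M.smult_l_distr)
    then show "lin_comb M n s (u \<oplus>\<^bsub>V n\<^esub> v) = lin_comb M n s u \<oplus>\<^bsub>M\<^esub> lin_comb M n s v"
      unfolding lin_comb_def using M.finsum_addf[OF c c] uv by simp
  next
    fix a v assume av: "a \<in> carrier R" "v \<in> vecs n"
    have "lin_comb M n s (a \<odot>\<^bsub>V n\<^esub> v) = (\<Oplus>\<^bsub>M\<^esub>i\<in>{..<n}. a \<odot>\<^bsub>M\<^esub> (v i \<odot>\<^bsub>M\<^esub> s i))"
      unfolding lin_comb_def
      using av assms(2) by (intro M.finsum_cong') (auto simp: M.smult_assoc1)
    then show "lin_comb M n s (a \<odot>\<^bsub>V n\<^esub> v) = a \<odot>\<^bsub>M\<^esub> lin_comb M n s v"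
      unfolding lin_comb_def using M.finsum_smult_ldistr[OF _ av(1) c] av by simp
  qed
qed

lemma hom_eq_lin_comb:
  assumes "module R M" "f \<in> mod_hom R (V n) M" "v \<in> vecs n"
  shows "f v = lin_comb M n (\<lambda>i. f (unit_vec R n i)) v"
proof -
  interpret M: module R M by fact
  have "f v = f (\<Oplus>\<^bsub>V n\<^esub>i\<in>{..<n}. v i \<odot>\<^bsub>V n\<^esub> unit_vec R n i)"
    using free_mod_expand[OF assms(3)] by (simp add: lin_comb_def)
  also have "\<dots> = (\<Oplus>\<^bsub>M\<^esub>i\<in>{..<n}. f (v i \<odot>\<^bsub>V n\<^esub> unit_vec R n i))"
    using assms by (intro mod_hom_finsum[OF assms(2) module_free_mod]) auto
  also have "\<dots> = lin_comb M n (\<lambda>i. f (unit_vec R n i)) v"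
    unfolding lin_comb_def
    using assms(3) mod_hom_closed[OF assms(2)]
    by (intro M.finsum_cong') (auto simp: mod_hom_smult[OF assms(2)])
  finally show ?thesis .
qed

lemma hom_free_eqI:
  assumes "module R M" "f \<in> mod_hom R (V n) M" "g \<in> mod_hom R (V n) M"
    and "\<And>i. i < n \<Longrightarrow> f (unit_vec R n i) = g (unit_vec R n i)"
    and "v \<in> vecs n"
  shows "f v = g v"
proof -
  interpret M: module R M by fact
  show ?thesis
    unfolding hom_eq_lin_comb[OF assms(1,2,5)] hom_eq_lin_comb[OF assms(1,3,5)] lin_comb_def
    using assms(4,5) mod_hom_closed[OF assms(3)] by (intro M.finsum_cong') auto
qed

lemma lin_comb_unit_vec:
  assumes "module R M" "\<And>i. i < n \<Longrightarrow> s i \<in> carrier M" "l < n"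
  shows "lin_comb M n s (unit_vec R n l) = s l"
proof -
  interpret M: module R M by fact
  have "lin_comb M n s (unit_vec R n l) = (\<Oplus>\<^bsub>M\<^esub>i\<in>{..<n}. if l = i then s i else \<zero>\<^bsub>M\<^esub>)"
    unfolding lin_comb_def using assms(2) by (intro M.finsum_cong') (auto simp: unit_vec_coord)
  also have "\<dots> = s l"
    using assms by (intro M.add.finprod_singleton) auto
  finally show ?thesis .
qed

text \<open>The ring and its regular module share carrier, addition and zero, so linearity of the
  dot product is inherited from \<open>lin_comb_hom\<close>.\<close>

lemma dot_eq_lin_comb: "dot R n u v = lin_comb (regular_module R) n v u"
  by (simp add: dot_def lin_comb_def finsum_def regular_module_def finprod_def)

lemma dot_comm:
  assumes "u \<in> vecs n" "v \<in> vecs n"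
  shows "dot R n u v = dot R n v u"
  unfolding dot_def using assms by (intro finsum_cong') (auto simp: m_comm)

lemma dot_hom:
  assumes "w \<in> vecs n"
  shows "dot R n w \<in> mod_hom R (V n) (regular_module R)"
proof -
  have h: "lin_comb (regular_module R) n w \<in> mod_hom R (V n) (regular_module R)"
    using assms by (intro lin_comb_hom module_regular is_cring) (auto simp: regular_module_def)
  have e: "dot R n w v = lin_comb (regular_module R) n w v" if "v \<in> vecs n" for v
    using dot_comm[OF assms that] by (simp add: dot_eq_lin_comb)
  show ?thesis
    by (rule mod_homI)
      (simp_all add: e mod_hom_closed[OF h] mod_hom_add[OF h] mod_hom_smult[OF h])
qed

lemma regular_module_simps [simp]:
  "carrier (regular_module R) = carrier R" "add (regular_module R) = add R"
  "zero (regular_module R) = zero R" "smult (regular_module R) = mult R"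
  by (simp_all add: regular_module_def)

lemma dot_closed [simp, intro]:
  "u \<in> vecs n \<Longrightarrow> v \<in> vecs n \<Longrightarrow> dot R n u v \<in> carrier R"
  using mod_hom_closed[OF dot_hom] by force

lemma dot_add:
  "w \<in> vecs n \<Longrightarrow> u \<in> vecs n \<Longrightarrow> v \<in> vecs n \<Longrightarrow>
    dot R n w (u \<oplus>\<^bsub>V n\<^esub> v) = dot R n w u \<oplus> dot R n w v"
  using mod_hom_add[OF dot_hom] by force

lemma dot_smult:
  "w \<in> vecs n \<Longrightarrow> a \<in> carrier R \<Longrightarrow> v \<in> vecs n \<Longrightarrow>
    dot R n w (a \<odot>\<^bsub>V n\<^esub> v) = a \<otimes> dot R n w v"
  using mod_hom_smult[OF dot_hom] by force

lemma dot_add_left: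
  "w \<in> vecs n \<Longrightarrow> u \<in> vecs n \<Longrightarrow> v \<in> vecs n \<Longrightarrow>
    dot R n (u \<oplus>\<^bsub>V n\<^esub> v) w = dot R n u w \<oplus> dot R n v w"
  by (simp add: dot_comm[of _ n w] dot_add)

lemma dot_smult_left:
  "w \<in> vecs n \<Longrightarrow> a \<in> carrier R \<Longrightarrow> v \<in> vecs n \<Longrightarrow>
    dot R n (a \<odot>\<^bsub>V n\<^esub> v) w = a \<otimes> dot R n v w"
  by (simp add: dot_comm[of _ n w] dot_smult)

lemma dot_unit_vec [simp]:
  assumes "w \<in> vecs n" "l < n"
  shows "dot R n w (unit_vec R n l) = w l"
proof -
  have "dot R n w (unit_vec R n l) = (\<Oplus>i\<in>{..<n}. if l = i then w i else \<zero>)"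
    unfolding dot_def using assms by (intro finsum_cong') (auto simp: unit_vec_coord)
  also have "\<dots> = w l"
    using assms by (intro finsum_singleton) auto
  finally show ?thesis .
qed

lemma transpose_closed [simp, intro]:
  assumes "f \<in> lin m n" "w \<in> vecs n"
  shows "transpose_map R m n f w \<in> vecs m"
  using assms mod_hom_closed[OF assms(1) unit_vec_closed]
  by (auto simp: transpose_map_def carrier_free_mod[of R m])

text \<open>Both sides are linear in \<open>u\<close> and agree on unit vectors. With
  \<open>free_mod_eq_dotI\<close>, the nondegeneracy of the dot product, this adjunction carries all
  later duality arguments.\<close>

lemma dot_transpose:
  assumes "f \<in> lin m n" "w \<in> vecs n"
    and "u \<in> vecs m"
  shows "dot R m (transpose_map R m n f w) u = dot R n w (f u)"
proof (rule hom_free_eqI[where f = "dot R m (transpose_map R m n f w)" and g = "\<lambda>u. dot R n w (f u)"])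
  show "(\<lambda>u. dot R n w (f u)) \<in> mod_hom R (V m) (regular_module R)"
    by (rule mod_hom_comp[OF assms(1) dot_hom[OF assms(2)]])
  show "dot R m (transpose_map R m n f w) \<in> mod_hom R (V m) (regular_module R)"
    using assms by (intro dot_hom) auto
  fix i assume "i < m"
  then show "dot R m (transpose_map R m n f w) (unit_vec R m i) = dot R n w (f (unit_vec R m i))"
    using assms by simp (simp add: transpose_map_def)
qed (use assms module_regular is_cring in auto)

lemma dot_zero:
  "w \<in> vecs m \<Longrightarrow> dot R m w \<zero>\<^bsub>V m\<^esub> = \<zero>"
  using mod_hom_zero[OF dot_hom module_free_mod module_regular[OF is_cring]] by simp

lemma dot_diff:
  assumes "w \<in> vecs m" "u \<in> vecs m" "v \<in> vecs m"
  shows "dot R m w (u \<ominus>\<^bsub>V m\<^esub> v) = dot R m w u \<ominus> dot R m w v"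
proof -
  have "dot R m w (\<ominus>\<^bsub>V m\<^esub> v) \<oplus> dot R m w v = dot R m w (\<ominus>\<^bsub>V m\<^esub> v \<oplus>\<^bsub>V m\<^esub> v)"
    using assms by (simp add: dot_add)
  also have "\<dots> = \<zero>" using assms by (simp add: V.l_neg dot_zero)
  finally have "\<ominus> dot R m w v = dot R m w (\<ominus>\<^bsub>V m\<^esub> v)"
    using assms by (intro minus_equality) auto
  then show ?thesis using assms by (simp add: a_minus_def dot_add)
qed

lemma free_mod_eq_dotI:
  assumes "u \<in> vecs n" "v \<in> vecs n"
    and "\<And>w. w \<in> vecs n \<Longrightarrow> dot R n u w = dot R n v w"
  shows "u = v"
  using assms(1,2) by (rule free_mod_eqI) (metis assms dot_unit_vec unit_vec_closed)

lemma transpose_hom: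
  assumes f: "f \<in> lin m n"
  shows "transpose_map R m n f \<in> lin n m"
proof (rule mod_homI)
  fix u v assume "u \<in> vecs n" "v \<in> vecs n"
  then show "transpose_map R m n f (u \<oplus>\<^bsub>V n\<^esub> v) = transpose_map R m n f u \<oplus>\<^bsub>V m\<^esub> transpose_map R m n f v"
    using f by (intro free_mod_eq_dotI[of _ m]) (auto simp: dot_transpose dot_add_left mod_hom_closed)
next
  fix a v assume "a \<in> carrier R" "v \<in> vecs n"
  then show "transpose_map R m n f (a \<odot>\<^bsub>V n\<^esub> v) = a \<odot>\<^bsub>V m\<^esub> transpose_map R m n f v"
    using f by (intro free_mod_eq_dotI[of _ m]) (auto simp: dot_transpose dot_smult_left mod_hom_closed)
qed (use f in auto)

end

section \<open>Zero divisors, regular sequences and depth\<close>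

text \<open>Zorn's lemma applies because over a Noetherian ring a nonempty chain of ideals contains
  its own union.\<close>

lemma (in noetherian_ring) maximal_ideal_inE:
  assumes "J \<in> C" "\<And>I. I \<in> C \<Longrightarrow> ideal I R"
  obtains M where "M \<in> C" "\<And>I. I \<in> C \<Longrightarrow> M \<subseteq> I \<Longrightarrow> I = M"
proof -
  have "\<exists>M\<in>C. \<forall>I\<in>C. M \<subseteq> I \<longrightarrow> I = M"
  proof (rule subset_Zorn_nonempty)
    fix D assume D: "D \<noteq> {}" "subset.chain C D"
    then have sub: "D \<subseteq> C"
      unfolding subset.chain_def by blast
    then have "subset.chain {I. ideal I R} D"
      using D(2) assms(2) by (auto simp: subset.chain_def)
    then have "\<Union>D \<in> D"
      using ideal_chain_is_trivial[OF D(1)] by blast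
    with sub show "\<Union>D \<in> C" by blast
  qed (use assms(1) in auto)
  then show ?thesis using that by blast
qed

text \<open>If \<open>x\<close> is not a unit, an ideal maximal among those that contain
  \<open>x\<close> and miss 1 is a maximal ideal, hence equal to \<mm>.\<close>

lemma (in noetherian_local_ring) unit_if_notin_maximal:
  assumes "x \<in> carrier R" "x \<notin> \<mm>"
  obtains u where "u \<in> carrier R" "u \<otimes> x = \<one>"
proof (cases "\<one> \<in> PIdl x")
  case True
  then show ?thesis
    using that unfolding cgenideal_def by auto
next
  case False
  define C where "C = {J. ideal J R \<and> x \<in> J \<and> \<one> \<notin> J}"
  have "PIdl x \<in> C"
    using assms(1) False cgenideal_ideal cgenideal_self by (auto simp: C_def)
  then obtain M where M: "M \<in> C" "\<And>J. J \<in> C \<Longrightarrow> M \<subseteq> J \<Longrightarrow> J = M"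
    by (rule maximal_ideal_inE) (auto simp: C_def)
  have "maximalideal M R"
  proof (rule maximalidealI)
    show "ideal M R" "carrier R \<noteq> M"
      using M(1) by (auto simp: C_def)
    fix J assume J: "ideal J R" "M \<subseteq> J" "J \<subseteq> carrier R"
    show "J = M \<or> J = carrier R"
    proof (cases "\<one> \<in> J")
      case True
      then show ?thesis using ideal.one_imp_carrier[OF J(1)] by simp
    next
      case False
      then show ?thesis using J M by (auto simp: C_def)
    qed
  qed
  then show ?thesis
    using maximal_unique M(1) assms(2) by (auto simp: C_def)
qed

subsection \<open>Prime avoidance for associated primes\<close>

text \<open>Starting from an element of \<open>J\<close> outside \<open>P\<close>, multiply by one
  element of each \<open>Q\<close> outside \<open>P\<close>; primeness keeps the product outside
  \<open>P\<close>.\<close>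

lemma (in cring) element_outside_prime:
  assumes "finite \<Q>" "\<And>Q. Q \<in> \<Q> \<Longrightarrow> ideal Q R" "\<And>Q. Q \<in> \<Q> \<Longrightarrow> \<not> Q \<subseteq> P"
    and prime: "\<And>a b. a \<in> carrier R \<Longrightarrow> b \<in> carrier R \<Longrightarrow> a \<otimes> b \<in> P \<Longrightarrow> a \<in> P \<or> b \<in> P"
    and J: "ideal J R" "\<not> J \<subseteq> P"
  shows "\<exists>c\<in>J. c \<notin> P \<and> (\<forall>Q\<in>\<Q>. c \<in> Q)"
  using assms(1-3)
proof (induction \<Q> rule: finite_induct)
  case (insert Q \<Q>)
  then obtain c q where c: "c \<in> J" "c \<notin> P" "\<forall>Q\<in>\<Q>. c \<in> Q" and q: "q \<in> Q" "q \<notin> P"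
    by (metis insertCI subsetI)
  have carr: "c \<in> carrier R" "q \<in> carrier R"
    using ideal.Icarr[OF J(1)] ideal.Icarr[of Q R] c q insert.prems by auto
  have "c \<otimes> q \<in> J" "c \<otimes> q \<in> Q" "\<forall>Q\<in>\<Q>. c \<otimes> q \<in> Q"
    using c q carr insert.prems J(1) by (auto intro: ideal.I_l_closed ideal.I_r_closed)
  moreover have "c \<otimes> q \<notin> P"
    using prime[OF carr] c q by blast
  ultimately show ?case by auto
qed (use J in auto)

text \<open>If the element \<open>x\<close> that avoids the earlier ideals falls into the new ideal
  \<open>P\<close>, add some \<open>c\<close> in \<open>J\<close> that lies in all earlier ideals
  but not in \<open>P\<close>. Incomparability supplies this \<open>c\<close>.\<close>

lemma (in cring) prime_avoidance:
  assumes "finite \<Q>" "\<And>Q. Q \<in> \<Q> \<Longrightarrow> ideal Q R"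
    and prime: "\<And>Q a b. Q \<in> \<Q> \<Longrightarrow> a \<in> carrier R \<Longrightarrow> b \<in> carrier R \<Longrightarrow> a \<otimes> b \<in> Q \<Longrightarrow> a \<in> Q \<or> b \<in> Q"
    and incomparable: "\<And>Q P. Q \<in> \<Q> \<Longrightarrow> P \<in> \<Q> \<Longrightarrow> Q \<subseteq> P \<Longrightarrow> Q = P"
    and J: "ideal J R" "\<And>Q. Q \<in> \<Q> \<Longrightarrow> \<not> J \<subseteq> Q"
  shows "\<exists>x\<in>J. \<forall>Q\<in>\<Q>. x \<notin> Q"
  using assms(1-4) J(2)
proof (induction \<Q> rule: finite_induct)
  case empty
  then show ?case using additive_subgroup.zero_closed[OF ideal.axioms(1)[OF J(1)]] by auto
next
  case (insert P \<Q>)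
  have "\<exists>x\<in>J. \<forall>Q\<in>\<Q>. x \<notin> Q"
  proof (rule insert.IH)
    show "ideal Q R" "\<not> J \<subseteq> Q" if "Q \<in> \<Q>" for Q
      using that insert.prems(1,4) by simp_all
    show "a \<in> Q \<or> b \<in> Q" if "Q \<in> \<Q>" "a \<in> carrier R" "b \<in> carrier R" "a \<otimes> b \<in> Q" for Q a b
      using that insert.prems(2)[of Q a b] by simp
    show "Q = Q'" if "Q \<in> \<Q>" "Q' \<in> \<Q>" "Q \<subseteq> Q'" for Q Q'
      using that insert.prems(3)[of Q Q'] by simp
  qed
  then obtain x where x: "x \<in> J" "\<forall>Q\<in>\<Q>. x \<notin> Q"
    by blast
  show ?case
  proof (cases "x \<in> P")
    case True
    have "\<not> Q \<subseteq> P" if "Q \<in> \<Q>" for Q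
      using insert.prems(3)[of Q P] that insert.hyps(2) by auto
    then have "\<exists>c\<in>J. c \<notin> P \<and> (\<forall>Q\<in>\<Q>. c \<in> Q)"
      using insert.hyps(1) insert.prems(1,4) insert.prems(2)[of P] J(1)
      by (intro element_outside_prime) auto
    then obtain c where c: "c \<in> J" "c \<notin> P" "\<forall>Q\<in>\<Q>. c \<in> Q"
      by blast
    have carr: "x \<in> carrier R" "c \<in> carrier R"
      using ideal.Icarr[OF J(1)] x c by auto
    have cancel: "b \<in> Q" if "ideal Q R" "a \<in> Q" "b \<in> carrier R" "a \<oplus> b \<in> Q" for Q a b
    proof -
      interpret Q: ideal Q R by fact
      have "\<ominus> a \<oplus> (a \<oplus> b) \<in> Q" using that by simp
      then show ?thesis using that Q.Icarr by (simp add: r_neg1)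
    qed
    have "x \<oplus> c \<in> J"
      using x c J(1) by (simp add: additive_subgroup.a_closed ideal.axioms(1))
    moreover have "x \<oplus> c \<notin> P"
      using cancel[of P x c] insert.prems(1) True c carr by auto
    moreover have "x \<oplus> c \<notin> Q" if "Q \<in> \<Q>" for Q
      using cancel[of Q c x] insert.prems(1) that x c carr by (auto simp: a_comm)
    ultimately show ?thesis by blast
  qed (use x in auto)
qed

locale noetherian_cring = cring + noetherian_ring

sublocale noetherian_local_ring \<subseteq> noetherian_cring ..

text \<open>The maximal annihilators of nonzero elements of R/I are prime, finite in number, and
  cover the zero divisors of R/I. Prime avoidance puts \<open>J\<close> inside one of them, which is
  the annihilator of a single class.\<close>

lemma (in noetherian_cring) common_annihilator_if_zero_divisors:
  assumes I: "ideal I R" and J: "ideal J R"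
    and zd: "\<And>x. x \<in> J \<Longrightarrow> \<exists>z\<in>carrier R - I. x \<otimes> z \<in> I"
  shows "\<exists>z\<in>carrier R - I. \<forall>x\<in>J. x \<otimes> z \<in> I"
proof -
  interpret I: ideal I R by fact
  define ann where "ann z = {x \<in> carrier R. x \<otimes> z \<in> I}" for z
  have ann_ideal: "ideal (ann z) R" if z: "z \<in> carrier R" for z
  proof (rule idealI[OF ring_axioms])
    show "subgroup (ann z) (add_monoid R)"
    proof (rule add.subgroupI)
      show "ann z \<noteq> {}" using z by (auto simp: ann_def intro!: exI[of _ \<zero>])
      fix x assume "x \<in> ann z"
      then have "x \<in> carrier R" "\<ominus> (x \<otimes> z) \<in> I" by (auto simp: ann_def)
      then show "\<ominus> x \<in> ann z" using z by (simp add: ann_def l_minus)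
    next
      fix x y assume "x \<in> ann z" "y \<in> ann z"
      then have "x \<in> carrier R" "y \<in> carrier R" "x \<otimes> z \<oplus> y \<otimes> z \<in> I" by (auto simp: ann_def)
      then show "x \<oplus> y \<in> ann z" using z by (simp add: ann_def l_distr)
    qed (auto simp: ann_def)
    fix a x assume "a \<in> ann z" and x: "x \<in> carrier R"
    then have "a \<in> carrier R" "x \<otimes> (a \<otimes> z) \<in> I" by (auto simp: ann_def I.I_l_closed)
    then show "x \<otimes> a \<in> ann z" and "a \<otimes> x \<in> ann z"
      using x z by (simp_all add: ann_def m_assoc m_lcomm)
  qed
  define \<A> where "\<A> = ann ` (carrier R - I)"
  define \<P> where "\<P> = {P \<in> \<A>. \<forall>Q\<in>\<A>. P \<subseteq> Q \<longrightarrow> Q = P}"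
  have \<A>_ideal: "ideal A R" if "A \<in> \<A>" for A
    using that ann_ideal by (auto simp: \<A>_def)
  have above: "\<exists>P\<in>\<P>. A \<subseteq> P" if A: "A \<in> \<A>" for A
  proof -
    have "A \<in> {B \<in> \<A>. A \<subseteq> B}" using A by simp
    then obtain P where P: "P \<in> {B \<in> \<A>. A \<subseteq> B}" "\<And>Q. Q \<in> {B \<in> \<A>. A \<subseteq> B} \<Longrightarrow> P \<subseteq> Q \<Longrightarrow> Q = P"
      by (rule maximal_ideal_inE) (auto intro: \<A>_ideal)
    then have "P \<in> \<P>" by (auto simp: \<P>_def)
    with P show ?thesis by blast
  qed
  have prime: "a \<in> P \<or> b \<in> P"
    if P: "P \<in> \<P>" and ab: "a \<in> carrier R" "b \<in> carrier R" "a \<otimes> b \<in> P" for P a b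
  proof (rule disjCI)
    assume b: "b \<notin> P"
    obtain z where z: "z \<in> carrier R" "z \<notin> I" "P = ann z"
      using P by (auto simp: \<P>_def \<A>_def)
    have bz: "b \<otimes> z \<in> carrier R - I"
      using b z ab by (auto simp: ann_def)
    have "ann z \<subseteq> ann (b \<otimes> z)"
    proof
      fix x assume "x \<in> ann z"
      then have x: "x \<in> carrier R" "b \<otimes> (x \<otimes> z) \<in> I"
        using ab by (auto simp: ann_def I.I_l_closed)
      then show "x \<in> ann (b \<otimes> z)"
        using ab z by (simp add: ann_def m_lcomm)
    qed
    then have "ann (b \<otimes> z) = P"
      using P z bz by (auto simp: \<P>_def \<A>_def)
    moreover have "a \<in> ann (b \<otimes> z)"
      using ab z by (auto simp: ann_def m_assoc)
    ultimately show "a \<in> P" by simp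
  qed
  have incomparable: "Q = P" if "Q \<in> \<P>" "P \<in> \<P>" "Q \<subseteq> P" for P Q
    using that by (auto simp: \<P>_def)
  have \<P>_ideal: "ideal P R" if "P \<in> \<P>" for P
    using that \<A>_ideal by (auto simp: \<P>_def)
  have proper: "\<one> \<notin> P" if "P \<in> \<P>" for P
    using that by (auto simp: \<P>_def \<A>_def ann_def)
  \<comment> \<open>The elements \<open>z\<close> whose annihilators are in \<open>\<P>\<close>
    generate an ideal \<open>K\<close> that finitely many of them, \<open>Z0\<close>, already
    generate. If P = \<open>ann z\<close> were not among the annihilators of \<open>Z0\<close>, some
    \<open>c\<close> outside P would kill all of \<open>Z0\<close> modulo \<open>I\<close>, hence
    all of \<open>K\<close>, hence \<open>z\<close>, and so would lie in P.\<close>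
  have "finite \<P>"
  proof -
    define Z where "Z = {z \<in> carrier R - I. ann z \<in> \<P>}"
    define C where "C = {Idl Z0 | Z0. finite Z0 \<and> Z0 \<subseteq> Z}"
    have ZR: "Z \<subseteq> carrier R" by (auto simp: Z_def)
    have "Idl {} \<in> C" unfolding C_def by blast
    moreover have "ideal K R" if "K \<in> C" for K
      using that ZR by (auto simp: C_def intro!: genideal_ideal)
    ultimately obtain K where K: "K \<in> C" "\<And>K'. K' \<in> C \<Longrightarrow> K \<subseteq> K' \<Longrightarrow> K' = K"
      by (elim maximal_ideal_inE[of "Idl {}" C]) auto
    then obtain Z0 where Z0: "finite Z0" "Z0 \<subseteq> Z" "K = Idl Z0" by (auto simp: C_def)
    have Z0R: "Z0 \<subseteq> carrier R" using Z0 ZR by auto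
    have gen: "z \<in> K" if z: "z \<in> Z" for z
    proof -
      have zR: "insert z Z0 \<subseteq> carrier R" using z ZR Z0R by auto
      have "Idl (insert z Z0) \<in> C"
        using z Z0 by (auto simp: C_def)
      moreover have "K \<subseteq> Idl (insert z Z0)"
        unfolding Z0(3) by (rule subset_Idl_subset[OF zR]) auto
      ultimately have "Idl (insert z Z0) = K" by (rule K(2))
      then show ?thesis using genideal_self[OF zR] by auto
    qed
    have "P \<in> ann ` Z0" if P: "P \<in> \<P>" for P
    proof (rule ccontr)
      assume notin: "P \<notin> ann ` Z0"
      obtain z where z: "z \<in> carrier R" "z \<notin> I" "P = ann z"
        using P by (auto simp: \<P>_def \<A>_def)
      have "\<not> Q \<subseteq> P" if "Q \<in> ann ` Z0" for Q
      proof
        assume "Q \<subseteq> P"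
        moreover have "Q \<in> \<P>" using that Z0 by (auto simp: Z_def)
        ultimately have "Q = P" using incomparable P by blast
        then show False using notin that by simp
      qed
      then have "\<exists>c\<in>carrier R. c \<notin> P \<and> (\<forall>Q\<in>ann ` Z0. c \<in> Q)"
        using Z0(1) Z0R ann_ideal prime[OF P] oneideal proper[OF P]
        by (intro element_outside_prime) auto
      then obtain c where c: "c \<in> carrier R" "c \<notin> P" "\<forall>Q\<in>ann ` Z0. c \<in> Q"
        by blast
      define K' where "K' = {v \<in> carrier R. c \<otimes> v \<in> I}"
      have "ideal K' R"
        using ann_ideal[OF c(1)] c(1) by (simp add: K'_def ann_def m_comm cong: conj_cong)
      moreover have "Z0 \<subseteq> K'"
        using c Z0R by (auto simp: K'_def ann_def)
      ultimately have "K \<subseteq> K'"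
        unfolding Z0(3) by (rule genideal_minimal)
      moreover have "z \<in> K" using gen z P by (auto simp: Z_def)
      ultimately show False
        using c z by (auto simp: K'_def ann_def)
    qed
    then have "\<P> \<subseteq> ann ` Z0" by blast
    then show ?thesis using Z0(1) finite_surj by blast
  qed
  have "\<exists>P\<in>\<P>. J \<subseteq> P"
  proof (rule ccontr)
    assume "\<not> (\<exists>P\<in>\<P>. J \<subseteq> P)"
    then obtain x where x: "x \<in> J" "\<forall>P\<in>\<P>. x \<notin> P"
      using prime_avoidance[OF \<open>finite \<P>\<close> \<P>_ideal prime incomparable J] by blast
    obtain z where z: "z \<in> carrier R - I" "x \<otimes> z \<in> I"
      using zd x by blast
    then have "x \<in> ann z" "ann z \<in> \<A>"
      using ideal.Icarr[OF J x(1)] by (auto simp: ann_def \<A>_def)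
    then show False using above x by blast
  qed
  then obtain P where "P \<in> \<P>" "J \<subseteq> P" by blast
  then show ?thesis by (auto simp: \<P>_def \<A>_def ann_def)
qed

subsection \<open>Regular sequences\<close>

context cring
begin

text \<open>Classes modulo an ideal are replaced by membership in it, which is the form taken by all
  later congruences.\<close>

lemma regular_sequence_iff:
  "regular_sequence R xs \<longleftrightarrow> set xs \<subseteq> carrier R \<and>
    (\<forall>i<length xs. \<forall>z\<in>carrier R. xs ! i \<otimes> z \<in> Idl (set (take i xs)) \<longrightarrow> z \<in> Idl (set (take i xs))) \<and>
    Idl (set xs) \<noteq> carrier R"
proof -
  have "(\<forall>y\<in>carrier (R Quot I). (I +> x) \<otimes>\<^bsub>R Quot I\<^esub> y = \<zero>\<^bsub>R Quot I\<^esub> \<longrightarrow> y = \<zero>\<^bsub>R Quot I\<^esub>) \<longleftrightarrow>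
      (\<forall>z\<in>carrier R. x \<otimes> z \<in> I \<longrightarrow> z \<in> I)" if I: "ideal I R" and x: "x \<in> carrier R" for I x
  proof -
    interpret I: ideal I R by fact
    have *: "I +> z = I \<longleftrightarrow> z \<in> I" if "z \<in> carrier R" for z
      using that I.rcos_const_imp_mem a_rcos_zero[OF I] by blast
    have "carrier (R Quot I) = (\<lambda>z. I +> z) ` carrier R"
      by (auto simp: FactRing_def A_RCOSETS_def')
    moreover have "(I +> x) \<otimes>\<^bsub>R Quot I\<^esub> (I +> z) = I +> (x \<otimes> z)" if "z \<in> carrier R" for z
      using that x by (simp add: FactRing_def I.rcoset_mult_add)
    moreover have "\<zero>\<^bsub>R Quot I\<^esub> = I" by (simp add: FactRing_def)
    ultimately show ?thesis using * x by auto
  qed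
  moreover have "ideal (Idl (set (take i xs))) R" if "set xs \<subseteq> carrier R" for i
    using that by (intro genideal_ideal) (meson order_trans set_take_subset)
  ultimately show ?thesis
    unfolding regular_sequence_def Let_def by (intro conj_cong all_cong refl) (simp add: subset_iff)
qed

lemma Idl_empty: "Idl {} = {\<zero>}"
proof
  show "Idl {} \<subseteq> {\<zero>}"
    by (rule genideal_minimal) (auto intro: zeroideal)
  show "{\<zero>} \<subseteq> Idl {}"
    using additive_subgroup.zero_closed[OF ideal.axioms(1)[OF genideal_ideal[of "{}"]]] by simp
qed

lemma Idl_insert_decompose:
  assumes "x \<in> carrier R" "A \<subseteq> carrier R" "u \<in> Idl (insert x A)"
  obtains c w where "c \<in> carrier R" "w \<in> Idl A" "u = x \<otimes> c \<oplus> w"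
proof -
  have A: "ideal (Idl A) R" using assms by (intro genideal_ideal)
  have id: "ideal (PIdl x <+> Idl A) R"
    using assms(1) A by (intro add_ideals cgenideal_ideal)
  have x: "x \<in> PIdl x" using assms(1) by (rule cgenideal_self)
  have z: "\<zero> \<in> PIdl x" "\<zero> \<in> Idl A"
    using cgenideal_ideal[OF assms(1)] A
    by (auto intro: additive_subgroup.zero_closed ideal.axioms)
  have "insert x A \<subseteq> PIdl x <+> Idl A"
  proof
    fix y assume y: "y \<in> insert x A"
    then have "y \<in> carrier R" using assms by auto
    then have "y = y \<oplus> \<zero>" "y = \<zero> \<oplus> y" by auto
    then show "y \<in> PIdl x <+> Idl A"
      using y x z genideal_self[OF assms(2)] unfolding set_add_def' by blast
  qed
  then have "Idl (insert x A) \<subseteq> PIdl x <+> Idl A"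
    by (rule genideal_minimal[OF id])
  then obtain p w where "p \<in> PIdl x" "w \<in> Idl A" "u = p \<oplus> w"
    using assms(3) unfolding set_add_def' by blast
  then show ?thesis
    using that assms(1) unfolding cgenideal_def by (auto simp: m_comm)
qed

end

section \<open>Depth: long regular sequences and socle elements\<close>

context noetherian_local_ring
begin

lemma Idl_le_maximal: "A \<subseteq> \<mm> \<Longrightarrow> Idl A \<subseteq> \<mm>"
  by (rule genideal_minimal[OF is_ideal])

lemma one_notin_maximal: "\<one> \<notin> \<mm>"
  using I_notcarr one_imp_carrier by blast

lemma local_depth_greaterE:
  assumes "enat n < local_depth R \<mm>"
  obtains xs where "regular_sequence R xs" "set xs \<subseteq> \<mm>" "n < length xs"
  using assms unfolding local_depth_def less_Sup_iff by auto

text \<open>Lengths of regular sequences in \<mm> are bounded, so a longest one exists. No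
  \<open>x\<close> in \<mm> can be appended; since the ideal would stay proper, every such
  \<open>x\<close> must be a zero divisor modulo the sequence. A common annihilator then gives
  \<open>y\<close>, a socle element of the quotient ring.\<close>

lemma local_depth_leE:
  assumes "\<not> enat n < local_depth R \<mm>"
  obtains xs y where "regular_sequence R xs" "set xs \<subseteq> \<mm>" "length xs \<le> n"
    "y \<in> carrier R" "y \<notin> Idl (set xs)" "\<And>x. x \<in> \<mm> \<Longrightarrow> x \<otimes> y \<in> Idl (set xs)"
proof -
  define P where "P xs \<longleftrightarrow> regular_sequence R xs \<and> set xs \<subseteq> \<mm>" for xs
  have le: "length xs \<le> n" if "P xs" for xs
  proof -
    have "enat (length xs) \<le> local_depth R \<mm>"
      unfolding local_depth_def using that by (intro Sup_upper) (auto simp: P_def)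
    then show ?thesis
      using assms by (metis enat_ord_simps(1) le_less_linear order_trans)
  qed
  have "\<one> \<noteq> \<zero>"
    using one_notin_maximal by auto
  then have "{\<zero>} \<noteq> carrier R"
    using one_closed by (metis singletonD)
  then have "P []"
    by (simp add: P_def regular_sequence_iff Idl_empty)
  then have "\<exists>xs. P xs \<and> (\<forall>ys. P ys \<longrightarrow> length ys \<le> length xs)"
    using le by (intro ex_has_greatest_nat[of P "[]" length "Suc n"]) (auto simp: less_Suc_eq_le)
  then obtain xs where xs: "P xs" "\<And>ys. P ys \<Longrightarrow> length ys \<le> length xs"
    by auto
  have carr: "set xs \<subseteq> carrier R" using xs(1) by (auto simp: P_def regular_sequence_iff)
  have id: "ideal (Idl (set xs)) R" using carr by (rule genideal_ideal)
  have "\<exists>z\<in>carrier R - Idl (set xs). x \<otimes> z \<in> Idl (set xs)" if x: "x \<in> \<mm>" for x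
  proof (rule ccontr)
    assume "\<not> ?thesis"
    then have "regular_sequence R (xs @ [x])"
      using xs(1) x carr Icarr Idl_le_maximal[of "set (xs @ [x])"] one_notin_maximal one_closed
      by (auto simp: P_def regular_sequence_iff nth_append less_Suc_eq)
    then have "P (xs @ [x])" using xs(1) x by (auto simp: P_def)
    then show False using xs(2) by fastforce
  qed
  then obtain y where "y \<in> carrier R - Idl (set xs)" "\<forall>x\<in>\<mm>. x \<otimes> y \<in> Idl (set xs)"
    using common_annihilator_if_zero_divisors[OF id is_ideal] by blast
  then show ?thesis
    using that xs(1) le by (auto simp: P_def)
qed

end

section \<open>Vectors with coordinates in an ideal\<close>

text \<open>The submodule I R^n in coordinates. It serves for minimality, with I = \<mm>, and for
  congruences modulo part of a regular sequence, where it replaces base change to R/I.\<close>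

definition ideal_vecs :: "('a, 'r) ring_scheme \<Rightarrow> 'a set \<Rightarrow> nat \<Rightarrow> (nat \<Rightarrow> 'a) set" where
  "ideal_vecs R I n = {v \<in> carrier (free_mod R n). \<forall>i<n. v i \<in> I}"

lemma ideal_vecs_carrier: "v \<in> ideal_vecs R I n \<Longrightarrow> v \<in> carrier (free_mod R n)"
  by (simp add: ideal_vecs_def)

lemma (in ideal) ideal_finsum:
  assumes "\<And>i. i \<in> A \<Longrightarrow> f i \<in> I"
  shows "finsum R f A \<in> I"
  using assms
proof (induction A rule: infinite_finite_induct)
  case (insert x F)
  then have "f \<in> F \<rightarrow> carrier R" "f x \<in> carrier R"
    using Icarr by auto
  with insert show ?case by (simp add: finsum_insert)
qed simp_all

context cring
begin

lemma dot_in_ideal: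
  assumes "ideal I R" "v \<in> ideal_vecs R I n" "w \<in> vecs n"
  shows "dot R n w v \<in> I"
  unfolding dot_def using assms
  by (intro ideal.ideal_finsum[OF assms(1)] ideal.I_l_closed[OF assms(1)]) (auto simp: ideal_vecs_def)

lemma ideal_vecs_dotI:
  assumes "v \<in> vecs n"
    and "\<And>w. w \<in> vecs n \<Longrightarrow> dot R n v w \<in> I"
  shows "v \<in> ideal_vecs R I n"
  using assms by (auto simp: ideal_vecs_def) (metis assms dot_unit_vec unit_vec_closed)

lemma hom_ideal_vecs:
  assumes "ideal I R" "f \<in> lin m n" "v \<in> ideal_vecs R I m"
  shows "f v \<in> ideal_vecs R I n"
proof (rule ideal_vecs_dotI)
  have v: "v \<in> vecs m" using assms(3) by (rule ideal_vecs_carrier)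
  then show fv: "f v \<in> vecs n" by (rule mod_hom_closed[OF assms(2)])
  fix w assume w: "w \<in> vecs n"
  have "dot R n (f v) w = dot R m (transpose_map R m n f w) v"
    by (simp only: dot_comm[OF fv w] dot_transpose[OF assms(2) w v])
  then show "dot R n (f v) w \<in> I"
    using assms w by (simp add: dot_in_ideal)
qed

lemma submodule_ideal_vecs:
  assumes "ideal I R"
  shows "submodule (ideal_vecs R I n) R (V n)"
proof -
  interpret I: ideal I R by fact
  show ?thesis
    by (rule V.submoduleI) (auto simp: ideal_vecs_def I.I_l_closed)
qed

lemma ideal_vecs_smult:
  "ideal I R \<Longrightarrow> a \<in> I \<Longrightarrow> v \<in> vecs n \<Longrightarrow> a \<odot>\<^bsub>V n\<^esub> v \<in> ideal_vecs R I n"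
  by (auto simp: ideal_vecs_def ideal.I_r_closed ideal.Icarr)

lemma ideal_mult_free_mod_subset:
  assumes "ideal I R"
  shows "ideal_mult R I (V n) \<subseteq> ideal_vecs R I n"
  unfolding ideal_mult_def
  using submodule_ideal_vecs[OF assms] ideal_vecs_smult[OF assms] by blast

lemma ideal_vecs_add:
  "ideal I R \<Longrightarrow> u \<in> ideal_vecs R I n \<Longrightarrow> v \<in> ideal_vecs R I n \<Longrightarrow> u \<oplus>\<^bsub>V n\<^esub> v \<in> ideal_vecs R I n"
  using V.submoduleE(5)[OF submodule_ideal_vecs] .

lemma ideal_vecs_neg:
  "ideal I R \<Longrightarrow> v \<in> ideal_vecs R I n \<Longrightarrow> \<ominus>\<^bsub>V n\<^esub> v \<in> ideal_vecs R I n"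
  using V.submoduleE(3)[OF submodule_ideal_vecs] .

lemma ideal_vecs_zero: "ideal_vecs R {\<zero>} n = {\<zero>\<^bsub>V n\<^esub>}"
  by (auto simp: ideal_vecs_def intro!: free_mod_eqI[of _ R n])

end

section \<open>Minimal free resolutions of submodules of free modules\<close>

definition fin_gen :: "('a, 'r) ring_scheme \<Rightarrow> ('a, 'b, 'm) module_scheme \<Rightarrow> 'b set \<Rightarrow> bool" where
  "fin_gen R M K \<longleftrightarrow>
    (\<exists>S. finite S \<and> S \<subseteq> K \<and> (\<forall>N. submodule N R M \<longrightarrow> S \<subseteq> N \<longrightarrow> K \<subseteq> N))"

lemma submodule_zero:
  assumes "submodule H R M" shows "\<zero>\<^bsub>M\<^esub> \<in> H"
  using subgroup.one_closed[OF submodule.axioms(1)[OF assms]] by simp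

lemma submodule_preimage:
  assumes "f \<in> mod_hom R M N" "module R M" "module R N" "submodule H R N"
  shows "submodule {x \<in> carrier M. f x \<in> H} R M"
proof -
  interpret M: module R M by fact
  interpret N: module R N by fact
  note H = N.submoduleE[OF assms(4)]
  show ?thesis
    using assms H submodule_zero[OF assms(4)]
    by (intro M.submoduleI) (simp_all add: mod_hom_zero mod_hom_neg mod_hom_add mod_hom_smult subset_iff)
qed

lemma submodule_inter:
  assumes "module R M" "submodule H R M" "submodule K R M"
  shows "submodule (H \<inter> K) R M"
proof -
  interpret M: module R M by fact
  note H = M.submoduleE[OF assms(2)] and K = M.submoduleE[OF assms(3)]
  show ?thesis
    using H K submodule_zero[OF assms(2)] submodule_zero[OF assms(3)]
    by (intro M.submoduleI) auto
qed

lemma (in cring) submodule_regular_ideal: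
  assumes "submodule J R (regular_module R)"
  shows "ideal J R"
proof -
  interpret M: module R "regular_module R" by (rule module_regular[OF is_cring])
  note J = M.submoduleE[OF assms]
  have inv: "\<ominus> x \<in> J" if "x \<in> J" for x
  proof -
    have "(\<ominus> \<one>) \<odot>\<^bsub>regular_module R\<^esub> x \<in> J" using J(4)[OF _ that] by blast
    then show ?thesis using that J(1) by (auto simp: l_minus subset_iff)
  qed
  show ?thesis
  proof (rule idealI[OF ring_axioms])
    show "subgroup J (add_monoid R)"
      using J(1,2,5) inv by (intro add.subgroupI) auto
    fix a x assume "a \<in> J" "x \<in> carrier R"
    moreover from this have "x \<otimes> a = a \<otimes> x" using J(1) by (auto intro: m_comm)
    ultimately show "x \<otimes> a \<in> J" "a \<otimes> x \<in> J"
      using J(4)[of x a] by simp_all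
  qed
qed

text \<open>Induction on the rank. The last coordinates of \<open>K\<close> form a finitely
  generated ideal, and the vectors of \<open>K\<close> with last coordinate zero form a submodule of
  R^n; lifts of generators of both generate \<open>K\<close>.\<close>

lemma (in noetherian_cring) submodule_free_mod_fin_gen:
  "submodule K R (V n) \<Longrightarrow> fin_gen R (V n) K"
proof (induction n arbitrary: K)
  case 0
  have "vecs 0 = {\<zero>\<^bsub>V 0\<^esub>}"
    by (auto intro: free_mod_eqI[of _ R 0])
  then have "K \<subseteq> {\<zero>\<^bsub>V 0\<^esub>}"
    using V.submoduleE(1)[OF 0] by simp
  then show ?case
    using submodule_zero unfolding fin_gen_def by (intro exI[of _ "{}"]) blast
next
  case (Suc n)
  let ?V = "V n" and ?W = "V (Suc n)"
  define \<iota> where "\<iota> v = v(n := \<zero>)" for v :: "nat \<Rightarrow> 'a"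
  have \<iota>: "\<iota> \<in> mod_hom R ?V ?W"
  proof -
    have cl: "\<iota> v \<in> carrier ?W" if "v \<in> carrier ?V" for v
      using that by (auto simp: \<iota>_def carrier_free_mod PiE_iff extensional_def)
    have "\<iota> v i = (if i = n then \<zero> else v i)" for v i
      by (simp add: \<iota>_def)
    then show ?thesis
      by (intro mod_homI cl free_mod_eqI[of _ R "Suc n"]) (auto simp: cl less_Suc_eq)
  qed
  have coord: "(\<lambda>v. v n) \<in> mod_hom R ?W (regular_module R)"
    by (rule mod_homI) auto
  have last_ideal: "ideal ((\<lambda>v. v n) ` N) R" if "submodule N R ?W" for N
    using mod_hom_image_submodule[OF coord module_free_mod module_regular[OF is_cring] that]
    by (rule submodule_regular_ideal)
  define pre where "pre N = {v \<in> carrier ?V. \<iota> v \<in> N}" for N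
  have pre: "submodule (pre N) R ?V" if "submodule N R ?W" for N
    unfolding pre_def by (rule submodule_preimage[OF \<iota> module_free_mod module_free_mod that])
  obtain S0 where S0: "finite S0" "S0 \<subseteq> pre K"
      "\<And>N. submodule N R ?V \<Longrightarrow> S0 \<subseteq> N \<Longrightarrow> pre K \<subseteq> N"
    using Suc.IH[OF pre[OF Suc.prems]] unfolding fin_gen_def by auto
  obtain A where A: "A \<subseteq> carrier R" "finite A" "(\<lambda>v. v n) ` K = Idl A"
    using finetely_gen[OF last_ideal[OF Suc.prems]] by auto
  have "\<exists>v\<in>K. v n = a" if "a \<in> A" for a
  proof -
    have "a \<in> (\<lambda>v. v n) ` K"
      using that genideal_self[OF A(1)] unfolding A(3) by blast
    then show ?thesis by auto
  qed
  then obtain g where g: "\<And>a. a \<in> A \<Longrightarrow> g a \<in> K \<and> g a n = a"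
    by metis
  note K = V.submoduleE[OF Suc.prems]
  show ?case unfolding fin_gen_def
  proof (intro exI[of _ "\<iota> ` S0 \<union> g ` A"] conjI allI impI subsetI)
    show "finite (\<iota> ` S0 \<union> g ` A)" using S0 A by simp
    show "x \<in> K" if "x \<in> \<iota> ` S0 \<union> g ` A" for x
      using that S0(2) g by (auto simp: pre_def)
    fix N v assume N: "submodule N R ?W" and sub: "\<iota> ` S0 \<union> g ` A \<subseteq> N" and v: "v \<in> K"
    note NE = V.submoduleE[OF N]
    \<comment> \<open>Choosing \<open>u\<close> in \<open>N\<close> and \<open>K\<close> at once
      keeps the difference \<open>v\<close> - \<open>u\<close> inside \<open>K\<close>, where
      \<open>pre K\<close> controls vectors with vanishing last coordinate.\<close>
    have "submodule (N \<inter> K) R ?W" using N Suc.prems by (intro submodule_inter module_free_mod)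
    moreover have "A \<subseteq> (\<lambda>v. v n) ` (N \<inter> K)"
    proof
      fix a assume "a \<in> A"
      then have "a = g a n" "g a \<in> N \<inter> K" using g sub by auto
      then show "a \<in> (\<lambda>v. v n) ` (N \<inter> K)" by (rule image_eqI)
    qed
    ultimately have "Idl A \<subseteq> (\<lambda>v. v n) ` (N \<inter> K)"
      by (intro genideal_minimal last_ideal)
    moreover have "v n \<in> Idl A" using v unfolding A(3)[symmetric] by (rule imageI)
    ultimately obtain u where u: "u \<in> N" "u \<in> K" "u n = v n"
      by (auto simp: image_iff subset_iff)
    have uv: "u \<in> carrier ?W" "v \<in> carrier ?W" using u v K(1) by auto
    define w where "w = v \<ominus>\<^bsub>?W\<^esub> u"
    have w: "w \<in> K" "w \<in> carrier ?W"
      using u v uv K(3,5) by (auto simp: w_def a_minus_def)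
    have "w n = \<zero>" using uv u(3) by (simp add: w_def a_minus_def r_neg)
    then have "w = \<iota> (restrict w {..<n})"
      using w(2) by (auto simp: \<iota>_def fun_eq_iff carrier_free_mod PiE_iff extensional_def)
    moreover have "restrict w {..<n} \<in> carrier ?V"
      using w(2) by (auto simp: carrier_free_mod)
    ultimately have "restrict w {..<n} \<in> pre K" using w(1) by (simp add: pre_def)
    moreover have "pre K \<subseteq> pre N"
      using S0(2) sub by (intro S0(3) pre N) (auto simp: pre_def)
    ultimately have "w \<in> N" using \<open>w = \<iota> _\<close> by (auto simp: pre_def)
    then have "w \<oplus>\<^bsub>?W\<^esub> u \<in> N" using u NE(5) by blast
    then show "v \<in> N" using uv by (simp add: w_def a_minus_def V.a_assoc V.l_neg)
  qed
qed

text \<open>Take a generating set of least cardinality. A relation with a coefficient outside \<mm>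
  could be solved for the corresponding generator, and that generator could be dropped.\<close>

lemma (in noetherian_local_ring) exists_minimal_cover:
  assumes K: "submodule K R (V n)"
  shows "\<exists>c \<phi>. \<phi> \<in> lin c n \<and> \<phi> ` vecs c = K \<and>
    a_kernel (V c) (V n) \<phi> \<subseteq> ideal_vecs R \<mm> c"
proof -
  let ?V = "V n"
  define gen where "gen S \<longleftrightarrow> finite S \<and> S \<subseteq> K \<and> (\<forall>N. submodule N R ?V \<longrightarrow> S \<subseteq> N \<longrightarrow> K \<subseteq> N)" for S
  have "\<exists>S. gen S"
    using submodule_free_mod_fin_gen[OF K] by (simp add: fin_gen_def gen_def)
  then obtain S where S: "gen S" "\<And>T. gen T \<Longrightarrow> card S \<le> card T"
    using ex_has_least_nat[of gen _ card] by metis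
  define c where "c = card S"
  obtain s where "bij_betw s {0..<c} S"
    using ex_bij_betw_nat_finite[of S] S(1) by (auto simp: gen_def c_def)
  then have s: "bij_betw s {..<c} S" by (simp add: atLeast0LessThan)
  note KE = V.submoduleE[OF K]
  have sK: "s i \<in> K" "s i \<in> carrier ?V" if "i < c" for i
    using that s S(1) KE(1) by (auto simp: gen_def bij_betw_def)
  define \<phi> where "\<phi> = lin_comb ?V c s"
  have \<phi>: "\<phi> \<in> mod_hom R (V c) ?V"
    unfolding \<phi>_def by (intro lin_comb_hom module_free_mod sK)
  have fin_in: "(\<Oplus>\<^bsub>?V\<^esub>i\<in>B. v i \<odot>\<^bsub>?V\<^esub> s i) \<in> N"
    if "submodule N R ?V" "B \<subseteq> {..<c}" "\<And>i. i \<in> B \<Longrightarrow> s i \<in> N" "v \<in> vecs c" for N B v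
  proof -
    note NE = V.submoduleE[OF that(1)]
    have "finite B" using that(2) by (rule finite_subset) simp
    then show ?thesis using that(2,3)
    proof (induction B rule: finite_induct)
      case empty
      then show ?case using submodule_zero[OF that(1)] by simp
    next
      case (insert x B)
      have "(\<lambda>i. v i \<odot>\<^bsub>?V\<^esub> s i) \<in> B \<rightarrow> carrier ?V" "v x \<in> carrier R" "s x \<in> carrier ?V"
        using insert.prems that(4) sK by auto
      then show ?case
        using insert NE(4,5) by simp
    qed
  qed
  have img: "\<phi> ` vecs c = K"
  proof
    show "\<phi> ` vecs c \<subseteq> K"
      using fin_in[OF K, of "{..<c}"] sK by (auto simp: \<phi>_def lin_comb_def)
    have "S \<subseteq> \<phi> ` vecs c"
    proof
      fix x assume "x \<in> S"
      then obtain l where l: "l < c" "s l = x" using s by (auto simp: bij_betw_def)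
      then have "\<phi> (unit_vec R c l) = x"
        unfolding \<phi>_def using sK by (simp add: lin_comb_unit_vec module_free_mod)
      then show "x \<in> \<phi> ` vecs c" by force
    qed
    moreover have "submodule (\<phi> ` vecs c) R ?V"
      by (rule mod_hom_image_submodule[OF \<phi> module_free_mod module_free_mod V.carrier_is_submodule])
    ultimately show "K \<subseteq> \<phi> ` vecs c" using S(1) by (auto simp: gen_def)
  qed
  have "v l \<in> \<mm>" if v: "v \<in> vecs c" "\<phi> v = \<zero>\<^bsub>?V\<^esub>" and l: "l < c" for v l
  proof (rule ccontr)
    assume "v l \<notin> \<mm>"
    then obtain u where u: "u \<in> carrier R" "u \<otimes> v l = \<one>"
      using unit_if_notin_maximal[of "v l"] v l by auto
    have "gen (S - {s l})" unfolding gen_def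
    proof (intro conjI allI impI)
      fix N assume N: "submodule N R ?V" "S - {s l} \<subseteq> N"
      note NE = V.submoduleE[OF N(1)]
      have mem: "s i \<in> N" if "i \<in> {..<c} - {l}" for i
      proof -
        have "s i \<in> S" "s i \<noteq> s l"
          using that l bij_betwE[OF s] inj_on_eq_iff[OF bij_betw_imp_inj_on[OF s], of i l] by auto
        then show ?thesis using N(2) by blast
      qed
      let ?r = "\<Oplus>\<^bsub>?V\<^esub>i\<in>{..<c} - {l}. v i \<odot>\<^bsub>?V\<^esub> s i"
      have r: "?r \<in> N" by (rule fin_in[OF N(1) _ mem v(1)]) auto
      then have rV: "?r \<in> carrier ?V" using subsetD[OF NE(1)] by simp
      have "insert l ({..<c} - {l}) = {..<c}" using l by auto
      then have "\<phi> v = finsum ?V (\<lambda>i. v i \<odot>\<^bsub>?V\<^esub> s i) (insert l ({..<c} - {l}))"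
        by (simp add: \<phi>_def lin_comb_def)
      also have "\<dots> = v l \<odot>\<^bsub>?V\<^esub> s l \<oplus>\<^bsub>?V\<^esub> ?r"
        using v l sK by (intro V.M.finsum_insert) auto
      finally have "v l \<odot>\<^bsub>?V\<^esub> s l = \<ominus>\<^bsub>?V\<^esub> ?r"
        using v l sK rV by (simp add: V.M.minus_equality V.M.add.m_comm)
      then have "v l \<odot>\<^bsub>?V\<^esub> s l \<in> N" using r NE(3) by simp
      then have "u \<odot>\<^bsub>?V\<^esub> (v l \<odot>\<^bsub>?V\<^esub> s l) \<in> N" by (rule NE(4)[OF u(1)])
      then have "s l \<in> N" using u v l sK by (simp add: V.smult_assoc1[symmetric])
      then have "S \<subseteq> N" using N(2) by auto
      then show "K \<subseteq> N" using S(1) N(1) by (auto simp: gen_def)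
    qed (use S(1) in \<open>auto simp: gen_def\<close>)
    then have "card S \<le> card (S - {s l})" by (rule S(2))
    moreover have "s l \<in> S" "finite S" using s l S(1) by (auto simp: bij_betw_def gen_def)
    ultimately show False by (metis card_Diff1_less not_le)
  qed
  then have "a_kernel (V c) ?V \<phi> \<subseteq> ideal_vecs R \<mm> c"
    by (auto simp: a_kernel_def' ideal_vecs_def)
  with \<phi> img show ?thesis by blast
qed

text \<open>Dependent choice over states that carry the two ranks along with the map, since the type
  of a map does not show them. Minimality starts at \<open>q 1\<close>: nothing forces
  \<open>K\<close> itself into \<mm> R^n.\<close>

lemma (in noetherian_local_ring) exists_minimal_resolution:
  assumes K: "submodule K R (V n)"
  obtains c q where "c 0 = n"
    "\<And>j. q j \<in> lin (c (Suc j)) (c j)"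
    "q 0 ` vecs (c 1) = K"
    "\<And>j. q (Suc j) ` vecs (c (Suc (Suc j)))
        = a_kernel (V (c (Suc j))) (V (c j)) (q j)"
    "\<And>j. q (Suc j) ` vecs (c (Suc (Suc j))) \<subseteq> ideal_vecs R \<mm> (c (Suc j))"
proof -
  define P where "P j s \<longleftrightarrow> (case s of (a, b, \<phi>) \<Rightarrow>
      \<phi> \<in> lin b a \<and>
      a_kernel (V b) (V a) \<phi> \<subseteq> ideal_vecs R \<mm> b \<and>
      (j = (0::nat) \<longrightarrow> a = n \<and> \<phi> ` vecs b = K))"
    for j and s :: "nat \<times> nat \<times> ((nat \<Rightarrow> 'a) \<Rightarrow> (nat \<Rightarrow> 'a))"
  define Q where "Q j s s' \<longleftrightarrow> (case (s, s') of ((a, b, \<phi>), (a', b', \<phi>')) \<Rightarrow>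
      a' = b \<and> \<phi>' ` vecs b' = a_kernel (V b) (V a) \<phi>)"
    for j :: nat and s s' :: "nat \<times> nat \<times> ((nat \<Rightarrow> 'a) \<Rightarrow> (nat \<Rightarrow> 'a))"
  have "\<exists>f. \<forall>j. P j (f j) \<and> Q j (f j) (f (Suc j))"
  proof (rule dependent_nat_choice)
    show "\<exists>s. P 0 s"
      using exists_minimal_cover[OF K] by (auto simp: P_def)
    fix s j assume "P j s"
    moreover obtain a b \<phi> where s: "s = (a, b, \<phi>)" by (cases s)
    ultimately have "\<phi> \<in> lin b a"
      by (simp add: P_def)
    then have "submodule (a_kernel (V b) (V a) \<phi>) R (V b)"
      by (intro submodule_kernel module_free_mod)
    from exists_minimal_cover[OF this] show "\<exists>s'. P (Suc j) s' \<and> Q j s s'"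
      by (auto simp: P_def Q_def s)
  qed
  then obtain f where f: "\<And>j. P j (f j)" "\<And>j. Q j (f j) (f (Suc j))" by blast
  define c where "c j = fst (f j)" for j
  define q where "q j = snd (snd (f j))" for j
  have c: "c (Suc j) = fst (snd (f j))" for j
    using f(2)[of j] by (auto simp: Q_def c_def split: prod.splits)
  show ?thesis
  proof (rule that[of c q])
    show "c 0 = n" "q 0 ` vecs (c 1) = K"
      using f(1)[of 0] c[of 0] by (auto simp: P_def c_def q_def split: prod.splits)
    show "q j \<in> lin (c (Suc j)) (c j)" for j
      using f(1)[of j] by (auto simp: P_def c) (auto simp: c_def q_def split: prod.splits)
    show ex: "q (Suc j) ` vecs (c (Suc (Suc j)))
        = a_kernel (V (c (Suc j))) (V (c j)) (q j)" for j
      using f(2)[of j] c[of "Suc j"] c[of j] by (auto simp: Q_def c_def q_def split: prod.splits)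
    show "q (Suc j) ` vecs (c (Suc (Suc j))) \<subseteq> ideal_vecs R \<mm> (c (Suc j))" for j
      using f(1)[of j] unfolding ex c[of j] by (auto simp: P_def c_def q_def split: prod.splits)
  qed
qed

section \<open>Projective modules, comparison maps and homotopies\<close>

text \<open>The projection \<open>p\<close> along \<open>W\<close> is well defined because
  \<open>U\<close> and \<open>W\<close> meet only in zero. The pair of inclusion and retraction is
  the form in which summands are used from here on.\<close>

lemma direct_summand_retract:
  assumes "direct_summand R X M"
  obtains i r where "module R X" "module R M" "i \<in> mod_hom R X M" "r \<in> mod_hom R M X"
    "\<And>x. x \<in> carrier X \<Longrightarrow> r (i x) = x"
proof -
  from assms obtain U W i where M: "module R M" and U: "submodule U R M" and W: "submodule W R M"
    and sum: "U <+>\<^bsub>M\<^esub> W = carrier M" and int: "U \<inter> W = {\<zero>\<^bsub>M\<^esub>}"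
    and X: "module R X" and i: "i \<in> mod_hom R X (M\<lparr>carrier := U\<rparr>)" and bij: "bij_betw i (carrier X) U"
    unfolding direct_summand_def mod_iso_def by auto
  interpret M: module R M by fact
  interpret X: module R X by fact
  note UE = M.submoduleE[OF U] and WE = M.submoduleE[OF W]
  have i': "i \<in> mod_hom R X M"
    using i UE(1) unfolding mod_hom_def by auto
  define p where "p v = (THE u. u \<in> U \<and> (\<exists>w\<in>W. v = u \<oplus>\<^bsub>M\<^esub> w))" for v
  have unique: "u = u'"
    if "u \<in> U" "w \<in> W" "u' \<in> U" "w' \<in> W" "u \<oplus>\<^bsub>M\<^esub> w = u' \<oplus>\<^bsub>M\<^esub> w'" for u w u' w'
  proof -
    have c: "u \<in> carrier M" "w \<in> carrier M" "u' \<in> carrier M" "w' \<in> carrier M"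
      using that UE(1) WE(1) by auto
    have "\<ominus>\<^bsub>M\<^esub> u' \<oplus>\<^bsub>M\<^esub> (u \<oplus>\<^bsub>M\<^esub> w) \<oplus>\<^bsub>M\<^esub> \<ominus>\<^bsub>M\<^esub> w = \<ominus>\<^bsub>M\<^esub> u' \<oplus>\<^bsub>M\<^esub> (u' \<oplus>\<^bsub>M\<^esub> w') \<oplus>\<^bsub>M\<^esub> \<ominus>\<^bsub>M\<^esub> w"
      using that(5) by simp
    moreover have "\<ominus>\<^bsub>M\<^esub> u' \<oplus>\<^bsub>M\<^esub> (u \<oplus>\<^bsub>M\<^esub> w) \<oplus>\<^bsub>M\<^esub> \<ominus>\<^bsub>M\<^esub> w = \<ominus>\<^bsub>M\<^esub> u' \<oplus>\<^bsub>M\<^esub> u"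
      using c by (simp add: M.M.a_assoc M.M.r_neg)
    moreover have "\<ominus>\<^bsub>M\<^esub> u' \<oplus>\<^bsub>M\<^esub> (u' \<oplus>\<^bsub>M\<^esub> w') \<oplus>\<^bsub>M\<^esub> \<ominus>\<^bsub>M\<^esub> w = w' \<oplus>\<^bsub>M\<^esub> \<ominus>\<^bsub>M\<^esub> w"
      using c by (simp add: M.M.r_neg1)
    ultimately have e: "\<ominus>\<^bsub>M\<^esub> u' \<oplus>\<^bsub>M\<^esub> u = w' \<oplus>\<^bsub>M\<^esub> \<ominus>\<^bsub>M\<^esub> w" by simp
    have "\<ominus>\<^bsub>M\<^esub> u' \<oplus>\<^bsub>M\<^esub> u \<in> U \<inter> W"
      using that UE(3,5) WE(3,5) by (simp, simp add: e)
    then have "\<ominus>\<^bsub>M\<^esub> u' \<oplus>\<^bsub>M\<^esub> u = \<zero>\<^bsub>M\<^esub>" using int by simp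
    then show ?thesis using c by (metis M.M.a_inv_closed M.M.minus_equality M.M.minus_minus M.M.add.m_comm)
  qed
  have pI: "p (u \<oplus>\<^bsub>M\<^esub> w) = u" if "u \<in> U" "w \<in> W" for u w
    unfolding p_def using that unique by (intro the_equality) auto
  have decomp: "\<exists>u\<in>U. \<exists>w\<in>W. v = u \<oplus>\<^bsub>M\<^esub> w" if "v \<in> carrier M" for v
    using that unfolding sum[symmetric] set_add_def' by blast
  have p: "p \<in> mod_hom R M (M\<lparr>carrier := U\<rparr>)"
  proof (rule mod_homI)
    fix v assume "v \<in> carrier M"
    then show "p v \<in> carrier (M\<lparr>carrier := U\<rparr>)" using decomp pI by force
  next
    fix v v' assume "v \<in> carrier M" "v' \<in> carrier M"
    then obtain u w u' w' where uw: "u \<in> U" "w \<in> W" "v = u \<oplus>\<^bsub>M\<^esub> w" "u' \<in> U" "w' \<in> W" "v' = u' \<oplus>\<^bsub>M\<^esub> w'"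
      using decomp by meson
    then have "u \<in> carrier M" "w \<in> carrier M" "u' \<in> carrier M" "w' \<in> carrier M"
      using UE(1) WE(1) by auto
    then have "v \<oplus>\<^bsub>M\<^esub> v' = (u \<oplus>\<^bsub>M\<^esub> u') \<oplus>\<^bsub>M\<^esub> (w \<oplus>\<^bsub>M\<^esub> w')"
      by (simp add: uw M.M.a_ac)
    then show "p (v \<oplus>\<^bsub>M\<^esub> v') = p v \<oplus>\<^bsub>M\<lparr>carrier := U\<rparr>\<^esub> p v'"
      using uw UE(5) WE(5) by (simp add: pI)
  next
    fix a v assume a: "a \<in> carrier R" and "v \<in> carrier M"
    then obtain u w where uw: "u \<in> U" "w \<in> W" "v = u \<oplus>\<^bsub>M\<^esub> w"
      using decomp by meson
    then have "u \<in> carrier M" "w \<in> carrier M"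
      using UE(1) WE(1) by auto
    then have "a \<odot>\<^bsub>M\<^esub> v = a \<odot>\<^bsub>M\<^esub> u \<oplus>\<^bsub>M\<^esub> a \<odot>\<^bsub>M\<^esub> w"
      by (simp add: uw a M.smult_r_distr)
    then show "p (a \<odot>\<^bsub>M\<^esub> v) = a \<odot>\<^bsub>M\<lparr>carrier := U\<rparr>\<^esub> p v"
      using uw UE(4) WE(4) a by (simp add: pI)
  qed
  have iU: "i ` carrier X = U" using bij by (simp add: bij_betw_def)
  obtain j where j: "j \<in> mod_hom R (M\<lparr>carrier := U\<rparr>) X" and ji: "\<And>x. x \<in> carrier X \<Longrightarrow> j (i x) = x"
    using mod_hom_inverse[OF X i' bij_betw_imp_inj_on[OF bij]] unfolding iU by blast
  have "(\<lambda>x. j (p x)) \<in> mod_hom R M X"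
    using p j by (rule mod_hom_comp)
  moreover have "j (p (i x)) = x" if "x \<in> carrier X" for x
  proof -
    have "i x \<in> U" using bij that by (auto dest: bij_betwE)
    moreover from this have "p (i x \<oplus>\<^bsub>M\<^esub> \<zero>\<^bsub>M\<^esub>) = i x"
      using submodule_zero[OF W] by (intro pI) auto
    ultimately show ?thesis using ji[OF that] UE(1) by auto
  qed
  ultimately show ?thesis using that[OF X M i'] by blast
qed

lemma direct_summand_self:
  assumes "module R M"
  shows "direct_summand R M M"
proof -
  interpret M: module R M by fact
  have "module R (M\<lparr>carrier := carrier M\<rparr>)"
    using submodule.submodule_is_module[OF M.carrier_is_submodule assms] .
  moreover have sum: "carrier M <+>\<^bsub>M\<^esub> {\<zero>\<^bsub>M\<^esub>} = carrier M"
    unfolding set_add_def' by force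
  moreover have zero_sub: "submodule {\<zero>\<^bsub>M\<^esub>} R M"
    by (rule M.submoduleI) auto
  moreover have "(\<lambda>x. x) \<in> mod_hom R M (M\<lparr>carrier := carrier M\<rparr>)"
    by (rule mod_homI) auto
  moreover have "bij_betw (\<lambda>x. x) (carrier M) (carrier (M\<lparr>carrier := carrier M\<rparr>))"
    by (simp add: bij_betw_def)
  ultimately have "mod_iso R M (M\<lparr>carrier := carrier M\<rparr>)"
    unfolding mod_iso_def using assms by blast
  moreover have "carrier M \<inter> {\<zero>\<^bsub>M\<^esub>} = {\<zero>\<^bsub>M\<^esub>}" by auto
  ultimately show ?thesis
    unfolding direct_summand_def using assms M.carrier_is_submodule sum zero_sub by blast
qed

lemma (in cring) fg_projective_free_mod: "fg_projective R (V n)"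
  unfolding fg_projective_def using direct_summand_self[OF module_free_mod] by blast

lemma fg_projective_module: "fg_projective R P \<Longrightarrow> module R P"
  unfolding fg_projective_def direct_summand_def mod_iso_def by auto

lemma (in cring) free_mod_lift:
  assumes "module R A" "module R B" "f \<in> mod_hom R (V n) B" "g \<in> mod_hom R A B"
    and "\<And>x. x \<in> vecs n \<Longrightarrow> f x \<in> g ` carrier A"
  obtains h where "h \<in> mod_hom R (V n) A" "\<And>x. x \<in> vecs n \<Longrightarrow> g (h x) = f x"
proof -
  have "\<exists>a\<in>carrier A. g a = f (unit_vec R n i)" for i
    using assms(5)[of "unit_vec R n i"] by auto
  then obtain s where s: "\<And>i. s i \<in> carrier A" "\<And>i. g (s i) = f (unit_vec R n i)"
    by metis
  have h: "lin_comb A n s \<in> mod_hom R (V n) A"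
    using assms(1) s by (intro lin_comb_hom)
  moreover have "g (lin_comb A n s x) = f x" if "x \<in> vecs n" for x
    by (rule hom_free_eqI[OF assms(2) mod_hom_comp[OF h assms(4)] assms(3) _ that])
      (simp add: lin_comb_unit_vec[OF assms(1)] s)
  ultimately show ?thesis by (rule that)
qed

text \<open>Needed because the resolutions in \<open>projdim\<close> consist of projective modules;
  the lift is made on a free module that has \<open>P\<close> as a retract.\<close>

lemma fg_projective_lift:
  assumes "fg_projective R P" "module R A" "module R B" "f \<in> mod_hom R P B" "g \<in> mod_hom R A B"
    and "\<And>x. x \<in> carrier P \<Longrightarrow> f x \<in> g ` carrier A"
  obtains h where "h \<in> mod_hom R P A" "\<And>x. x \<in> carrier P \<Longrightarrow> g (h x) = f x"
proof -
  obtain n where "direct_summand R P (free_mod R n)"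
    using assms(1) by (auto simp: fg_projective_def)
  then obtain i r where ir: "i \<in> mod_hom R P (free_mod R n)" "r \<in> mod_hom R (free_mod R n) P"
      "\<And>x. x \<in> carrier P \<Longrightarrow> r (i x) = x"
    by (rule direct_summand_retract) blast
  interpret cring R using assms(2) by (simp add: module_def)
  obtain h where h: "h \<in> mod_hom R (free_mod R n) A"
      "\<And>x. x \<in> carrier (free_mod R n) \<Longrightarrow> g (h x) = f (r x)"
    by (rule free_mod_lift[OF assms(2,3) mod_hom_comp[OF ir(2) assms(4)] assms(5)])
      (use assms(6) mod_hom_closed[OF ir(2)] in auto)
  show ?thesis
    using that[OF mod_hom_comp[OF ir(1) h(1)]] h(2) mod_hom_closed[OF ir(1)] ir(3) by simp
qed

text \<open>The comparison theorem without augmentations: the map in degree 0 is given and only has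
  to send boundaries to boundaries. This lets the same lemma lift inclusions, projections and
  identities of different augmented modules.\<close>

lemma comparison_map:
  fixes R (structure)
  assumes "\<And>j. fg_projective R (M j)" "\<And>j. module R (N j)"
    and dM: "\<And>j. dM j \<in> mod_hom R (M (Suc j)) (M j)"
      "\<And>j x. x \<in> carrier (M (Suc (Suc j))) \<Longrightarrow> dM j (dM (Suc j) x) = \<zero>\<^bsub>M j\<^esub>"
    and dN: "\<And>j. dN j \<in> mod_hom R (N (Suc j)) (N j)"
    and exact: "\<And>j y. y \<in> carrier (N (Suc j)) \<Longrightarrow> dN j y = \<zero>\<^bsub>N j\<^esub> \<Longrightarrow>
      y \<in> dN (Suc j) ` carrier (N (Suc (Suc j)))"
    and f0: "f0 \<in> mod_hom R (M 0) (N 0)"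
      "\<And>x. x \<in> carrier (M 1) \<Longrightarrow> f0 (dM 0 x) \<in> dN 0 ` carrier (N 1)"
  obtains f where "f 0 = f0" "\<And>j. f j \<in> mod_hom R (M j) (N j)"
    "\<And>j x. x \<in> carrier (M (Suc j)) \<Longrightarrow> dN j (f (Suc j) x) = f j (dM j x)"
proof -
  note modM = fg_projective_module[OF assms(1)]
  define P where "P j f \<longleftrightarrow> f \<in> mod_hom R (M j) (N j) \<and> (j = 0 \<longrightarrow> f = f0) \<and>
      (\<forall>x\<in>carrier (M (Suc j)). f (dM j x) \<in> dN j ` carrier (N (Suc j)))" for j f
  define Q where "Q j f f' \<longleftrightarrow> (\<forall>x\<in>carrier (M (Suc j)). dN j (f' x) = f (dM j x))" for j f f'
  have "\<exists>f. \<forall>j. P j (f j) \<and> Q j (f j) (f (Suc j))"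
  proof (rule dependent_nat_choice)
    show "\<exists>f. P 0 f" using f0 by (auto simp: P_def)
    fix f j assume Pf: "P j f"
    have f: "f \<in> mod_hom R (M j) (N j)" using Pf by (simp add: P_def)
    obtain f' where f': "f' \<in> mod_hom R (M (Suc j)) (N (Suc j))"
        "\<And>x. x \<in> carrier (M (Suc j)) \<Longrightarrow> dN j (f' x) = f (dM j x)"
      by (rule fg_projective_lift[OF assms(1) assms(2) assms(2) mod_hom_comp[OF dM(1) f] dN])
        (use Pf in \<open>auto simp: P_def\<close>)
    have "f' (dM (Suc j) x) \<in> dN (Suc j) ` carrier (N (Suc (Suc j)))"
      if x: "x \<in> carrier (M (Suc (Suc j)))" for x
      using mod_hom_closed[OF dM(1) x] mod_hom_closed[OF f'(1)] mod_hom_zero[OF f modM assms(2)]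
      by (intro exact) (simp_all add: f'(2) dM(2)[OF x])
    then show "\<exists>f'. P (Suc j) f' \<and> Q j f f'"
      using f' by (intro exI[of _ f']) (auto simp: P_def Q_def)
  qed
  then obtain f where f: "\<And>j. P j (f j)" "\<And>j. Q j (f j) (f (Suc j))" by blast
  show ?thesis
    using f by (intro that[of f]) (auto simp: P_def Q_def)
qed

text \<open>The bound \<open>J\<close> limits the exactness hypothesis, since the complex built from
  a presentation of the n-th syzygy of k is known to be exact only up to position n.\<close>

lemma null_homotopy:
  fixes R (structure)
  assumes "\<And>j. fg_projective R (M j)" "\<And>j. module R (N j)"
    and dM: "\<And>j. dM j \<in> mod_hom R (M (Suc j)) (M j)"
      "\<And>j x. x \<in> carrier (M (Suc (Suc j))) \<Longrightarrow> dM j (dM (Suc j) x) = \<zero>\<^bsub>M j\<^esub>"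
    and dN: "\<And>j. dN j \<in> mod_hom R (N (Suc j)) (N j)"
    and exact: "\<And>j y. j < J \<Longrightarrow> y \<in> carrier (N (Suc j)) \<Longrightarrow> dN j y = \<zero>\<^bsub>N j\<^esub> \<Longrightarrow>
      y \<in> dN (Suc j) ` carrier (N (Suc (Suc j)))"
    and f: "\<And>j. f j \<in> mod_hom R (M j) (N j)"
      "\<And>j x. x \<in> carrier (M (Suc j)) \<Longrightarrow> dN j (f (Suc j) x) = f j (dM j x)"
    and f0: "\<And>x. x \<in> carrier (M 0) \<Longrightarrow> f 0 x \<in> dN 0 ` carrier (N 1)"
  obtains \<sigma> where "\<And>j. j \<le> J \<Longrightarrow> \<sigma> j \<in> mod_hom R (M j) (N (Suc j))"
    "\<And>x. x \<in> carrier (M 0) \<Longrightarrow> f 0 x = dN 0 (\<sigma> 0 x)"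
    "\<And>j x. j < J \<Longrightarrow> x \<in> carrier (M (Suc j)) \<Longrightarrow>
      f (Suc j) x = dN (Suc j) (\<sigma> (Suc j) x) \<oplus>\<^bsub>N (Suc j)\<^esub> \<sigma> j (dM j x)"
proof -
  note modM = fg_projective_module[OF assms(1)]
  define P where "P j s \<longleftrightarrow> (j \<le> J \<longrightarrow> s \<in> mod_hom R (M j) (N (Suc j)) \<and>
      (j = 0 \<longrightarrow> (\<forall>x\<in>carrier (M 0). f 0 x = dN 0 (s x))) \<and>
      (\<forall>x\<in>carrier (M (Suc j)). dN j (s (dM j x)) = f j (dM j x)))" for j s
  define Q where "Q j s s' \<longleftrightarrow> (j < J \<longrightarrow> (\<forall>x\<in>carrier (M (Suc j)).
      f (Suc j) x = dN (Suc j) (s' x) \<oplus>\<^bsub>N (Suc j)\<^esub> s (dM j x)))" for j s s'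
  have "\<exists>s. \<forall>j. P j (s j) \<and> Q j (s j) (s (Suc j))"
  proof (rule dependent_nat_choice)
    obtain s where s: "s \<in> mod_hom R (M 0) (N 1)" "\<And>x. x \<in> carrier (M 0) \<Longrightarrow> dN 0 (s x) = f 0 x"
      by (rule fg_projective_lift[OF assms(1) assms(2) assms(2) f(1) dN[of 0]])
        (use f0 in auto)
    then show "\<exists>s. P 0 s"
      using mod_hom_closed[OF dM(1)[of 0]] by (intro exI[of _ s]) (auto simp: P_def)
    fix s j assume Ps: "P j s"
    show "\<exists>s'. P (Suc j) s' \<and> Q j s s'"
    proof (cases "j < J")
      case False
      then show ?thesis by (auto simp: P_def Q_def)
    next
      case True
      interpret N1: module R "N (Suc j)" by (rule assms(2))
      interpret N0: module R "N j" by (rule assms(2))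
      have s: "s \<in> mod_hom R (M j) (N (Suc j))"
          "\<And>x. x \<in> carrier (M (Suc j)) \<Longrightarrow> dN j (s (dM j x)) = f j (dM j x)"
        using Ps True by (auto simp: P_def)
      define g where "g x = f (Suc j) x \<ominus>\<^bsub>N (Suc j)\<^esub> s (dM j x)" for x
      have g: "g \<in> mod_hom R (M (Suc j)) (N (Suc j))"
        unfolding g_def by (intro mod_hom_minus f(1) mod_hom_comp[OF dM(1) s(1)] assms(2))
      have cl: "f (Suc j) x \<in> carrier (N (Suc j))" "s (dM j x) \<in> carrier (N (Suc j))"
          "dM j x \<in> carrier (M j)" "f j (dM j x) \<in> carrier (N j)"
        if "x \<in> carrier (M (Suc j))" for x
        using that by (auto intro: mod_hom_closed[OF f(1)] mod_hom_closed[OF s(1)] mod_hom_closed[OF dM(1)])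
      have "dN j (g x) = \<zero>\<^bsub>N j\<^esub>" if x: "x \<in> carrier (M (Suc j))" for x
      proof -
        have "dN j (g x) = f j (dM j x) \<ominus>\<^bsub>N j\<^esub> f j (dM j x)"
          unfolding g_def mod_hom_diff[OF dN assms(2) assms(2) cl(1,2)[OF x]]
          by (simp only: f(2)[OF x] s(2)[OF x])
        then show ?thesis using cl(4)[OF x] by (simp add: a_minus_def N0.M.r_neg)
      qed
      then have im: "g x \<in> dN (Suc j) ` carrier (N (Suc (Suc j)))" if "x \<in> carrier (M (Suc j))" for x
        using exact[OF True] mod_hom_closed[OF g that] that by blast
      obtain s' where s': "s' \<in> mod_hom R (M (Suc j)) (N (Suc (Suc j)))"
          "\<And>x. x \<in> carrier (M (Suc j)) \<Longrightarrow> dN (Suc j) (s' x) = g x"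
        using fg_projective_lift[OF assms(1) assms(2) assms(2) g dN im] by metis
      have "dN (Suc j) (s' (dM (Suc j) x)) = f (Suc j) (dM (Suc j) x)"
        if x: "x \<in> carrier (M (Suc (Suc j)))" for x
        using mod_hom_closed[OF dM(1) x] mod_hom_zero[OF s(1) modM assms(2)] cl(1)
        by (simp add: s'(2) g_def dM(2)[OF x] a_minus_def)
      moreover have "f (Suc j) x = dN (Suc j) (s' x) \<oplus>\<^bsub>N (Suc j)\<^esub> s (dM j x)"
        if x: "x \<in> carrier (M (Suc j))" for x
        using cl[OF x] by (simp add: s'(2)[OF x] g_def a_minus_def N1.M.a_assoc N1.M.l_neg)
      ultimately show ?thesis
        using s' by (intro exI[of _ s']) (auto simp: P_def Q_def)
    qed
  qed
  then obtain s where s: "\<And>j. P j (s j)" "\<And>j. Q j (s j) (s (Suc j))" by blast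
  show ?thesis
    using s(1) s(1)[of 0] s(2) by (intro that[of s]) (auto simp: P_def Q_def)
qed

section \<open>Exactness modulo a regular sequence\<close>

context cring
begin

lemma ideal_vecs_mono: "I \<subseteq> J \<Longrightarrow> v \<in> ideal_vecs R I n \<Longrightarrow> v \<in> ideal_vecs R J n"
  by (auto simp: ideal_vecs_def)

lemma ideal_vecs_insert_decompose:
  assumes "x \<in> carrier R" "A \<subseteq> carrier R" "v \<in> ideal_vecs R (Idl (insert x A)) n"
  obtains c w where "c \<in> vecs n" "w \<in> ideal_vecs R (Idl A) n"
    "v = x \<odot>\<^bsub>V n\<^esub> c \<oplus>\<^bsub>V n\<^esub> w"
proof -
  have "\<exists>c w. c \<in> carrier R \<and> w \<in> Idl A \<and> v i = x \<otimes> c \<oplus> w" if "i < n" for i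
    using that assms(3) Idl_insert_decompose[OF assms(1,2), of "v i"]
    by (metis (no_types, lifting) ideal_vecs_def mem_Collect_eq)
  then obtain c w where cw: "\<And>i. i < n \<Longrightarrow> c i \<in> carrier R \<and> w i \<in> Idl A \<and> v i = x \<otimes> c i \<oplus> w i"
    by metis
  have A: "ideal (Idl A) R" using assms(2) by (rule genideal_ideal)
  have c: "restrict c {..<n} \<in> vecs n"
    using cw by (auto simp: carrier_free_mod)
  have w: "restrict w {..<n} \<in> ideal_vecs R (Idl A) n"
    using cw ideal.Icarr[OF A] by (auto simp: ideal_vecs_def carrier_free_mod)
  have "v = x \<odot>\<^bsub>V n\<^esub> restrict c {..<n} \<oplus>\<^bsub>V n\<^esub> restrict w {..<n}"
    using cw c ideal_vecs_carrier[OF w] ideal_vecs_carrier[OF assms(3)] assms(1)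
    by (intro free_mod_eqI[of _ R n]) auto
  with c w show ?thesis by (rule that)
qed

lemma ideal_vecs_cancel:
  assumes "\<And>z. z \<in> carrier R \<Longrightarrow> x \<otimes> z \<in> I \<Longrightarrow> z \<in> I"
    and "v \<in> vecs n" "x \<odot>\<^bsub>V n\<^esub> v \<in> ideal_vecs R I n"
  shows "v \<in> ideal_vecs R I n"
  using assms by (auto simp: ideal_vecs_def)

end

lemma set_take_Suc: "i < length xs \<Longrightarrow> set (take (Suc i) xs) = insert (xs ! i) (set (take i xs))"
  by (simp add: take_Suc_conv_app_nth)

section \<open>Complexes modulo an initial segment of a regular sequence\<close>

locale regular_seq = cring +
  fixes xs :: "'a list"
  assumes regular: "regular_sequence R xs"
begin

definition seq_ideal :: "nat \<Rightarrow> 'a set" where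
  "seq_ideal i = Idl (set (take i xs))"

lemma seq_carrier: "set xs \<subseteq> carrier R" "set (take i xs) \<subseteq> carrier R"
  using regular set_take_subset[of i xs] by (auto simp: regular_sequence_iff)

lemma seq_nth_carrier: "i < length xs \<Longrightarrow> xs ! i \<in> carrier R"
  using seq_carrier(1) nth_mem by blast

lemma seq_ideal_ideal: "ideal (seq_ideal i) R"
  unfolding seq_ideal_def by (rule genideal_ideal[OF seq_carrier(2)])

lemma seq_ideal_0: "seq_ideal 0 = {\<zero>}"
  by (simp add: seq_ideal_def Idl_empty)

lemma seq_ideal_Suc: "i < length xs \<Longrightarrow> seq_ideal (Suc i) = Idl (insert (xs ! i) (set (take i xs)))"
  by (simp add: seq_ideal_def set_take_Suc)

lemma seq_ideal_le_Suc: "i < length xs \<Longrightarrow> seq_ideal i \<subseteq> seq_ideal (Suc i)"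
  unfolding seq_ideal_def
  using seq_carrier(2)[of "Suc i"] by (intro subset_Idl_subset) (auto simp: set_take_Suc)

lemma seq_nth_mem: "i < length xs \<Longrightarrow> xs ! i \<in> seq_ideal (Suc i)"
  unfolding seq_ideal_def
  using genideal_self[OF seq_carrier(2)[of "Suc i"]] by (auto simp: set_take_Suc)

lemma seq_cancel:
  "i < length xs \<Longrightarrow> z \<in> carrier R \<Longrightarrow> xs ! i \<otimes> z \<in> seq_ideal i \<Longrightarrow> z \<in> seq_ideal i"
  using regular by (auto simp: regular_sequence_iff seq_ideal_def)

lemma seq_ideal_vecs_decompose:
  assumes "i < length xs" "v \<in> ideal_vecs R (seq_ideal (Suc i)) n"
  obtains c w where "c \<in> vecs n" "w \<in> ideal_vecs R (seq_ideal i) n"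
    "v = (xs ! i) \<odot>\<^bsub>V n\<^esub> c \<oplus>\<^bsub>V n\<^esub> w"
  using ideal_vecs_insert_decompose[OF seq_nth_carrier[OF assms(1)] seq_carrier(2)[of i]] assms that
  unfolding seq_ideal_Suc[OF assms(1)] by (auto simp: seq_ideal_def)

text \<open>For a resolution of \<open>M\<close> by free modules this says \<open>Tor\<^sub>j(M, R/(x\<^sub>1, \<dots>, x\<^sub>i)) = 0\<close> for \<open>j > i\<close>;
  the index \<open>j\<close> below is shifted by one.\<close>

lemma exact_mod_regular_sequence:
  assumes q: "\<And>j. q j \<in> lin (a (Suc j)) (a j)"
    and qq: "\<And>j v. v \<in> vecs (a (Suc (Suc j))) \<Longrightarrow> q j (q (Suc j) v) = \<zero>\<^bsub>V (a j)\<^esub>"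
    and exact: "\<And>j v. j < J \<Longrightarrow> v \<in> vecs (a (Suc j)) \<Longrightarrow>
      q j v = \<zero>\<^bsub>V (a j)\<^esub> \<Longrightarrow> v \<in> q (Suc j) ` vecs (a (Suc (Suc j)))"
  shows "i \<le> length xs \<Longrightarrow> i \<le> j \<Longrightarrow> j < J \<Longrightarrow> v \<in> vecs (a (Suc j)) \<Longrightarrow>
    q j v \<in> ideal_vecs R (seq_ideal i) (a j) \<Longrightarrow>
    \<exists>w\<in>vecs (a (Suc (Suc j))). \<exists>u\<in>ideal_vecs R (seq_ideal i) (a (Suc j)).
      v = q (Suc j) w \<oplus>\<^bsub>V (a (Suc j))\<^esub> u"
proof (induction i arbitrary: j v)
  case 0
  then have "q j v = \<zero>\<^bsub>V (a j)\<^esub>"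
    by (simp add: seq_ideal_0 ideal_vecs_zero)
  then obtain w where "w \<in> vecs (a (Suc (Suc j)))" "v = q (Suc j) w"
    using exact 0 by blast
  then show ?case
    using 0(4) by (intro bexI[of _ w] bexI[of _ "\<zero>\<^bsub>V (a (Suc j))\<^esub>"])
      (auto simp: seq_ideal_0 ideal_vecs_zero)
next
  case (Suc i)
  \<comment> \<open>Each element of the sequence costs one degree: the induction hypothesis is
    applied to \<open>c\<close> in degree \<open>j'\<close> and then to \<open>v'\<close> in degree
    \<open>j\<close>.\<close>
  then obtain j' where j': "j = Suc j'" by (cases j) auto
  have i: "i < length xs" using Suc.prems(1) by simp
  define x where "x = xs ! i"
  have x: "x \<in> carrier R" using i by (simp add: x_def seq_nth_carrier)
  have canc: "z \<in> seq_ideal i" if "z \<in> carrier R" "x \<otimes> z \<in> seq_ideal i" for z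
    using that unfolding x_def by (rule seq_cancel[OF i])
  have q': "q j' \<in> lin (a j) (a j')"
    using q[of j'] by (simp add: j')
  note id = seq_ideal_ideal[of i]
  note cl = mod_hom_closed[OF q] ideal_vecs_carrier
  obtain c w where c: "c \<in> vecs (a j)" and w: "w \<in> ideal_vecs R (seq_ideal i) (a j)"
    and qv: "q j v = x \<odot>\<^bsub>V (a j)\<^esub> c \<oplus>\<^bsub>V (a j)\<^esub> w"
    using seq_ideal_vecs_decompose[OF i Suc.prems(5)] unfolding x_def by metis
  \<comment> \<open>Applying \<open>q j'\<close> to \<open>qv\<close> makes \<open>x\<close> times
    \<open>q j' c\<close> vanish modulo the first \<open>i\<close> elements. Cancelling
    \<open>x\<close> makes \<open>c\<close> a cycle, so it is a boundary \<open>q j w1\<close> up to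
    \<open>u1\<close>, and \<open>v\<close> - \<open>x\<close> \<open>w1\<close> is a cycle modulo
    the first \<open>i\<close> elements alone.\<close>
  have "x \<odot>\<^bsub>V (a j')\<^esub> q j' c \<oplus>\<^bsub>V (a j')\<^esub> q j' w = q j' (q j v)"
    using c ideal_vecs_carrier[OF w] x by (simp add: qv mod_hom_add[OF q'] mod_hom_smult[OF q'])
  also have "\<dots> = \<zero>\<^bsub>V (a j')\<^esub>"
    using Suc.prems(4) qq by (simp add: j')
  finally have "x \<odot>\<^bsub>V (a j')\<^esub> q j' c = \<ominus>\<^bsub>V (a j')\<^esub> q j' w"
    using c ideal_vecs_carrier[OF w] x
    by (intro V.M.minus_equality[symmetric]) (auto simp: mod_hom_closed[OF q'])
  moreover have "\<ominus>\<^bsub>V (a j')\<^esub> q j' w \<in> ideal_vecs R (seq_ideal i) (a j')"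
    using w by (intro ideal_vecs_neg id hom_ideal_vecs[OF id q'])
  ultimately have "q j' c \<in> ideal_vecs R (seq_ideal i) (a j')"
    using ideal_vecs_cancel[OF canc mod_hom_closed[OF q' c]] by simp
  then obtain w1 u1 where w1: "w1 \<in> vecs (a (Suc j))"
    and u1: "u1 \<in> ideal_vecs R (seq_ideal i) (a j)" and c_eq: "c = q j w1 \<oplus>\<^bsub>V (a j)\<^esub> u1"
    using Suc.IH[of j' c] Suc.prems c by (auto simp: j')
  define v' where "v' = v \<ominus>\<^bsub>V (a (Suc j))\<^esub> x \<odot>\<^bsub>V (a (Suc j))\<^esub> w1"
  have v': "v' \<in> vecs (a (Suc j))"
    using Suc.prems(4) w1 x by (simp add: v'_def)
  have car: "q j w1 \<in> vecs (a j)" "u1 \<in> vecs (a j)"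
      "w \<in> vecs (a j)"
    using w1 u1 w by (auto simp: cl)
  have "q j v' = q j v \<ominus>\<^bsub>V (a j)\<^esub> x \<odot>\<^bsub>V (a j)\<^esub> q j w1"
    unfolding v'_def using Suc.prems(4) w1 x
    by (simp add: mod_hom_diff[OF q module_free_mod module_free_mod] mod_hom_smult[OF q])
  also have "\<dots> = w \<oplus>\<^bsub>V (a j)\<^esub> x \<odot>\<^bsub>V (a j)\<^esub> u1"
    unfolding qv c_eq a_minus_def using car x
    by (intro free_mod_eqI[of _ R "a j"]) (simp_all add: r_distr a_ac r_neg1 r_neg)
  finally have "q j v' \<in> ideal_vecs R (seq_ideal i) (a j)"
    using w u1 x V.submoduleE(4)[OF submodule_ideal_vecs[OF id]] by (simp add: ideal_vecs_add[OF id])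
  then obtain w2 u2 where w2: "w2 \<in> vecs (a (Suc (Suc j)))"
    and u2: "u2 \<in> ideal_vecs R (seq_ideal i) (a (Suc j))"
    and v'_eq: "v' = q (Suc j) w2 \<oplus>\<^bsub>V (a (Suc j))\<^esub> u2"
    using Suc.IH[of j v'] Suc.prems v' by auto
  have "v = v' \<oplus>\<^bsub>V (a (Suc j))\<^esub> x \<odot>\<^bsub>V (a (Suc j))\<^esub> w1"
    unfolding v'_def a_minus_def using Suc.prems(4) w1 x by (simp add: V.a_assoc V.l_neg)
  also have "\<dots> = q (Suc j) w2 \<oplus>\<^bsub>V (a (Suc j))\<^esub>
      (u2 \<oplus>\<^bsub>V (a (Suc j))\<^esub> x \<odot>\<^bsub>V (a (Suc j))\<^esub> w1)"
    unfolding v'_eq using w1 x w2 u2 by (intro V.a_assoc) (auto simp: cl)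
  finally have "v = q (Suc j) w2 \<oplus>\<^bsub>V (a (Suc j))\<^esub>
      (u2 \<oplus>\<^bsub>V (a (Suc j))\<^esub> x \<odot>\<^bsub>V (a (Suc j))\<^esub> w1)" .
  moreover have "u2 \<oplus>\<^bsub>V (a (Suc j))\<^esub> x \<odot>\<^bsub>V (a (Suc j))\<^esub> w1
      \<in> ideal_vecs R (seq_ideal (Suc i)) (a (Suc j))"
    using u2 w1 seq_nth_mem[OF i] seq_ideal_le_Suc[OF i]
    by (intro ideal_vecs_add seq_ideal_ideal ideal_vecs_smult) (auto simp: x_def intro: ideal_vecs_mono)
  ultimately show ?case using w2 by blast
qed

text \<open>An inductive long exact sequence argument: once every element of the maximal ideal kills the
  cohomology modulo \<open>(x\<^sub>1, \<dots>, x\<^sub>i)\<close>, vanishing in degree \<open>j\<close> modulo \<open>(x\<^sub>1, \<dots>, x\<^bsub>i+1\<^esub>)\<close> yields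
  vanishing in degree \<open>j + 1\<close> modulo \<open>(x\<^sub>1, \<dots>, x\<^sub>i)\<close>.\<close>

lemma coexact_mod_regular_sequence:
  assumes \<delta>: "\<And>j. \<delta> j \<in> lin (a j) (a (Suc j))"
    and \<delta>\<delta>: "\<And>j v. v \<in> vecs (a j) \<Longrightarrow> \<delta> (Suc j) (\<delta> j v) = \<zero>\<^bsub>V (a (Suc (Suc j)))\<^esub>"
    and base: "\<And>i \<psi>. i < length xs \<Longrightarrow> \<psi> \<in> vecs (a 1) \<Longrightarrow>
      \<delta> 1 \<psi> \<in> ideal_vecs R (seq_ideal i) (a 2) \<Longrightarrow>
      \<exists>\<theta>\<in>vecs (a 0). \<exists>u\<in>ideal_vecs R (seq_ideal i) (a 1). \<psi> = \<delta> 0 \<theta> \<oplus>\<^bsub>V (a 1)\<^esub> u"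
    and mult: "\<And>i j x \<psi>. j < J \<Longrightarrow> x \<in> set xs \<Longrightarrow> \<psi> \<in> vecs (a (Suc (Suc j))) \<Longrightarrow>
      \<delta> (Suc (Suc j)) \<psi> \<in> ideal_vecs R (seq_ideal i) (a (Suc (Suc (Suc j)))) \<Longrightarrow>
      \<exists>\<theta>\<in>vecs (a (Suc j)). \<exists>u\<in>ideal_vecs R (seq_ideal i) (a (Suc (Suc j))).
        x \<odot>\<^bsub>V (a (Suc (Suc j)))\<^esub> \<psi> = \<delta> (Suc j) \<theta> \<oplus>\<^bsub>V (a (Suc (Suc j)))\<^esub> u"
  shows "i + j < length xs \<Longrightarrow> j \<le> J \<Longrightarrow> \<psi> \<in> vecs (a (Suc j)) \<Longrightarrow>
    \<delta> (Suc j) \<psi> \<in> ideal_vecs R (seq_ideal i) (a (Suc (Suc j))) \<Longrightarrow>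
    \<exists>\<theta>\<in>vecs (a j). \<exists>u\<in>ideal_vecs R (seq_ideal i) (a (Suc j)).
      \<psi> = \<delta> j \<theta> \<oplus>\<^bsub>V (a (Suc j))\<^esub> u"
proof (induction j arbitrary: i \<psi>)
  case 0
  then show ?case using base[of i \<psi>] by (simp add: numeral_2_eq_2)
next
  case (Suc j)
  let ?U = "V (a j)" and ?V = "V (a (Suc j))" and ?W = "V (a (Suc (Suc j)))"
  have i: "i < length xs" using Suc.prems(1) by simp
  define x where "x = xs ! i"
  have x: "x \<in> carrier R" "x \<in> set xs" using i by (simp_all add: x_def seq_nth_carrier)
  have canc: "z \<in> seq_ideal i" if "z \<in> carrier R" "x \<otimes> z \<in> seq_ideal i" for z
    using that unfolding x_def by (rule seq_cancel[OF i])
  note id = seq_ideal_ideal[of i] and id' = seq_ideal_ideal[of "Suc i"]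
  note cl = mod_hom_closed[OF \<delta>] ideal_vecs_carrier
  have \<psi>: "\<psi> \<in> carrier ?W" using Suc.prems by simp
  obtain \<theta> u where \<theta>: "\<theta> \<in> carrier ?V" and u: "u \<in> ideal_vecs R (seq_ideal i) (a (Suc (Suc j)))"
    and x\<psi>: "x \<odot>\<^bsub>?W\<^esub> \<psi> = \<delta> (Suc j) \<theta> \<oplus>\<^bsub>?W\<^esub> u"
    using mult[of j x \<psi> i] Suc.prems x by auto
  have uW: "u \<in> carrier ?W" using u by (rule ideal_vecs_carrier)
  have d\<theta>W: "\<delta> (Suc j) \<theta> \<in> carrier ?W" using \<theta> by (rule cl)
  \<comment> \<open>Modulo \<open>x\<close> as well, \<open>\<theta>\<close> is a cocycle one degree
    lower. This is the connecting map of multiplication by \<open>x\<close>, and the induction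
    hypothesis applies with \<open>i\<close> + 1 in place of \<open>i\<close>.\<close>
  have "\<delta> (Suc j) \<theta> = x \<odot>\<^bsub>?W\<^esub> \<psi> \<oplus>\<^bsub>?W\<^esub> \<ominus>\<^bsub>?W\<^esub> u"
    unfolding x\<psi> using uW d\<theta>W by (simp add: V.a_assoc V.r_neg)
  also have "\<dots> \<in> ideal_vecs R (seq_ideal (Suc i)) (a (Suc (Suc j)))"
    using \<psi> u seq_nth_mem[OF i] ideal_vecs_mono[OF seq_ideal_le_Suc[OF i]]
    by (intro ideal_vecs_add ideal_vecs_smult ideal_vecs_neg id') (auto simp: x_def)
  finally obtain \<eta> z where \<eta>: "\<eta> \<in> carrier ?U" and z: "z \<in> ideal_vecs R (seq_ideal (Suc i)) (a (Suc j))"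
    and \<theta>_eq: "\<theta> = \<delta> j \<eta> \<oplus>\<^bsub>?V\<^esub> z"
    using Suc.IH[of "Suc i" \<theta>] Suc.prems \<theta> by auto
  obtain \<zeta> w where \<zeta>: "\<zeta> \<in> carrier ?V" and w: "w \<in> ideal_vecs R (seq_ideal i) (a (Suc j))"
    and z_eq: "z = x \<odot>\<^bsub>?V\<^esub> \<zeta> \<oplus>\<^bsub>?V\<^esub> w"
    using seq_ideal_vecs_decompose[OF i z] unfolding x_def by metis
  have car: "\<delta> (Suc j) \<zeta> \<in> carrier ?W" "\<delta> (Suc j) w \<in> carrier ?W" "w \<in> carrier ?V" "\<delta> j \<eta> \<in> carrier ?V"
    using \<zeta> w \<eta> by (auto simp: cl)
  have d\<theta>: "\<delta> (Suc j) \<theta> = x \<odot>\<^bsub>?W\<^esub> \<delta> (Suc j) \<zeta> \<oplus>\<^bsub>?W\<^esub> \<delta> (Suc j) w"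
    unfolding \<theta>_eq z_eq using \<zeta> x car \<eta> by (simp add: mod_hom_add[OF \<delta>] mod_hom_smult[OF \<delta>] \<delta>\<delta>)
  \<comment> \<open>Since \<open>x\<close> times \<open>\<psi>\<close> and \<open>x\<close> times
    \<open>\<delta> (Suc j) \<zeta>\<close> agree modulo the first \<open>i\<close> elements,
    \<open>x\<close> can be cancelled from their difference.\<close>
  define \<psi>' where "\<psi>' = \<psi> \<ominus>\<^bsub>?W\<^esub> \<delta> (Suc j) \<zeta>"
  have \<psi>': "\<psi>' \<in> carrier ?W" using \<psi> car by (simp add: \<psi>'_def)
  have "x \<odot>\<^bsub>?W\<^esub> \<psi>' = x \<odot>\<^bsub>?W\<^esub> \<psi> \<ominus>\<^bsub>?W\<^esub> x \<odot>\<^bsub>?W\<^esub> \<delta> (Suc j) \<zeta>"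
    unfolding \<psi>'_def a_minus_def using \<psi> car x by (simp add: V.smult_r_distr V.smult_r_minus)
  also have "\<dots> = \<delta> (Suc j) w \<oplus>\<^bsub>?W\<^esub> u"
    unfolding x\<psi> d\<theta> a_minus_def using \<psi> car x uW
    by (intro free_mod_eqI[of _ R "a (Suc (Suc j))"]) (simp_all add: a_ac r_neg1 r_neg)
  finally have "x \<odot>\<^bsub>?W\<^esub> \<psi>' \<in> ideal_vecs R (seq_ideal i) (a (Suc (Suc j)))"
    using w u by (simp add: ideal_vecs_add[OF id] hom_ideal_vecs[OF id \<delta>])
  then have "\<psi>' \<in> ideal_vecs R (seq_ideal i) (a (Suc (Suc j)))"
    using ideal_vecs_cancel[OF canc \<psi>'] by simp
  moreover have "\<psi> = \<delta> (Suc j) \<zeta> \<oplus>\<^bsub>?W\<^esub> \<psi>'"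
    unfolding \<psi>'_def a_minus_def using \<psi> car by (simp add: V.M.a_ac V.r_neg V.M.r_neg1 V.M.r_neg2)
  ultimately show ?case using \<zeta> by blast
qed

end

section \<open>Minimal resolutions\<close>

lemma (in noetherian_local_ring) zero_rank_if_in_maximal:
  assumes "\<And>v. v \<in> vecs n \<Longrightarrow> v \<in> ideal_vecs R \<mm> n"
  shows "n = 0"
proof (rule ccontr)
  assume "n \<noteq> 0"
  then have "unit_vec R n 0 0 \<in> \<mm>"
    using assms[of "unit_vec R n 0"] by (simp add: ideal_vecs_def)
  then show False
    using \<open>n \<noteq> 0\<close> one_notin_maximal by (simp add: unit_vec_coord)
qed

lemma (in cring) carrier_free_mod_0: "v \<in> vecs 0 \<Longrightarrow> v = \<zero>\<^bsub>V 0\<^esub>"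
  by (rule free_mod_eqI[of _ R 0]) auto

text \<open>The modules of the resolution have the ranks \<open>c 1, c 2, \<dots>\<close>; the map \<open>q 0\<close> is the augmentation
  onto the resolved submodule of the free module of rank \<open>c 0\<close>.\<close>

locale minimal_resolution = noetherian_local_ring R \<mm> for R (structure) and \<mm> +
  fixes c :: "nat \<Rightarrow> nat" and q :: "nat \<Rightarrow> (nat \<Rightarrow> 'a) \<Rightarrow> (nat \<Rightarrow> 'a)"
  assumes q_hom: "q j \<in> lin (c (Suc j)) (c j)"
    and q_exact: "q (Suc j) ` vecs (c (Suc (Suc j)))
      = a_kernel (V (c (Suc j))) (V (c j)) (q j)"
    and q_minimal_Suc: "v \<in> vecs (c (Suc (Suc j))) \<Longrightarrow>
      q (Suc j) v \<in> ideal_vecs R \<mm> (c (Suc j))"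
begin

lemma q_closed: "v \<in> vecs (c (Suc j)) \<Longrightarrow> q j v \<in> vecs (c j)"
  by (rule mod_hom_closed[OF q_hom])

lemma q_q: "v \<in> vecs (c (Suc (Suc j))) \<Longrightarrow> q j (q (Suc j) v) = \<zero>\<^bsub>V (c j)\<^esub>"
  using q_exact[of j] by (auto simp: a_kernel_def')

lemma q_kernel: "v \<in> vecs (c (Suc j)) \<Longrightarrow> q j v = \<zero>\<^bsub>V (c j)\<^esub> \<Longrightarrow>
    v \<in> q (Suc j) ` vecs (c (Suc (Suc j)))"
  unfolding q_exact by (auto simp: a_kernel_def')

text \<open>Such an endomorphism is homotopic to the identity, and a homotopy contributes only terms with
  coordinates in the maximal ideal.\<close>

lemma endomorphism_congruent_id:
  assumes f: "\<And>j. f j \<in> lin (c (Suc j)) (c (Suc j))"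
    and chain: "\<And>j x. x \<in> vecs (c (Suc (Suc j))) \<Longrightarrow>
      q (Suc j) (f (Suc j) x) = f j (q (Suc j) x)"
    and f0: "\<And>x. x \<in> vecs (c 1) \<Longrightarrow> q 0 (f 0 x) = q 0 x"
    and x: "x \<in> vecs (c (Suc j))"
  shows "f j x \<ominus>\<^bsub>V (c (Suc j))\<^esub> x \<in> ideal_vecs R \<mm> (c (Suc j))"
proof -
  define g where "g j x = f j x \<ominus>\<^bsub>V (c (Suc j))\<^esub> x" for j x
  have fc: "f j x \<in> vecs (c (Suc j))" if "x \<in> vecs (c (Suc j))" for j x
    using that by (rule mod_hom_closed[OF f])
  obtain \<sigma> where \<sigma>: "\<And>i. i \<le> j \<Longrightarrow> \<sigma> i \<in> lin (c (Suc i)) (c (Suc (Suc i)))"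
    "\<And>x. x \<in> vecs (c (Suc 0)) \<Longrightarrow> g 0 x = q (Suc 0) (\<sigma> 0 x)"
    "\<And>i x. i < j \<Longrightarrow> x \<in> vecs (c (Suc (Suc i))) \<Longrightarrow>
      g (Suc i) x = q (Suc (Suc i)) (\<sigma> (Suc i) x) \<oplus>\<^bsub>V (c (Suc (Suc i)))\<^esub> \<sigma> i (q (Suc i) x)"
  \<comment> \<open>Positions shift by one because \<open>q 0\<close> is an augmentation and not
    part of the complex; \<open>f0\<close> places \<open>g 0\<close> in the kernel of
    \<open>q 0\<close>, which is the image of \<open>q 1\<close>.\<close>
  proof (rule null_homotopy[where R = R and M = "\<lambda>j. V (c (Suc j))"
        and N = "\<lambda>j. V (c (Suc j))" and dM = "\<lambda>j. q (Suc j)" and dN = "\<lambda>j. q (Suc j)"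
        and f = g and J = j])
    show "g i \<in> lin (c (Suc i)) (c (Suc i))" for i
      unfolding g_def by (intro mod_hom_minus f mod_hom_id module_free_mod)
    show "q (Suc i) (g (Suc i) x) = g i (q (Suc i) x)"
      if "x \<in> vecs (c (Suc (Suc i)))" for i x
      unfolding g_def mod_hom_diff[OF q_hom module_free_mod module_free_mod fc[OF that] that]
      by (simp only: chain[OF that])
    fix x assume x: "x \<in> vecs (c (Suc 0))"
    have "q 0 (g 0 x) = q 0 x \<ominus>\<^bsub>V (c 0)\<^esub> q 0 x"
      unfolding g_def mod_hom_diff[OF q_hom module_free_mod module_free_mod fc[OF x] x]
      using f0 x by simp
    then have "q 0 (g 0 x) = \<zero>\<^bsub>V (c 0)\<^esub>"
      using q_closed[OF x] by (simp add: a_minus_def V.r_neg)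
    moreover have "g 0 x \<in> vecs (c (Suc 0))"
      using fc[OF x] x by (simp add: g_def)
    ultimately show "g 0 x \<in> q (Suc 0) ` vecs (c (Suc 1))"
      using q_kernel[of "g 0 x" 0] by simp
  qed (auto intro: fg_projective_free_mod module_free_mod q_hom q_q q_kernel)
  show ?thesis
  proof (cases j)
    case 0
    then show ?thesis
      using x \<sigma>(2)[of x] q_minimal_Suc[of "\<sigma> 0 x" 0] mod_hom_closed[OF \<sigma>(1)[of 0], of x]
      by (simp add: g_def)
  next
    case (Suc i)
    have "\<sigma> (Suc i) x \<in> vecs (c (Suc (Suc (Suc i))))"
      using x mod_hom_closed[OF \<sigma>(1)[of "Suc i"], of x] by (simp add: Suc)
    moreover have "\<sigma> i (q (Suc i) x) \<in> ideal_vecs R \<mm> (c (Suc (Suc i)))"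
      using x Suc by (intro hom_ideal_vecs[OF is_ideal \<sigma>(1)] q_minimal_Suc) auto
    ultimately have "g (Suc i) x \<in> ideal_vecs R \<mm> (c (Suc (Suc i)))"
      using x Suc \<sigma>(3)[of i x] by (simp add: ideal_vecs_add[OF is_ideal] q_minimal_Suc)
    then show ?thesis by (simp add: Suc g_def)
  qed
qed

text \<open>Comparison maps in both directions compose to the identity modulo \<mm> on the minimal
  resolution. Where \<open>P j\<close> is zero the composite is zero, so every vector of that rank
  lies in \<mm> R^m, and the rank must be 0.\<close>

lemma rank_zero_above_projective_resolution:
  assumes P: "\<And>j. fg_projective R (P j)" "\<And>i. p < i \<Longrightarrow> carrier (P i) = {\<zero>\<^bsub>P i\<^esub>}"
    and e: "e \<in> mod_hom R (P 0) (V (c 0))"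
      "e ` carrier (P 0) = q 0 ` vecs (c 1)"
      "dP 0 ` carrier (P 1) = a_kernel (P 0) (V (c 0)) e"
    and dP: "\<And>i. dP i \<in> mod_hom R (P (Suc i)) (P i)"
      "\<And>i. dP (Suc i) ` carrier (P (Suc (Suc i))) = a_kernel (P (Suc i)) (P i) (dP i)"
    and j: "p < j"
  shows "c (Suc j) = 0"
proof -
  note modP = fg_projective_module[OF P(1)]
  have dd: "dP i (dP (Suc i) x) = \<zero>\<^bsub>P i\<^esub>" if "x \<in> carrier (P (Suc (Suc i)))" for i x
    using dP(2)[of i] that by (auto simp: a_kernel_def')
  have dP_exact: "y \<in> dP (Suc i) ` carrier (P (Suc (Suc i)))"
    if "y \<in> carrier (P (Suc i))" "dP i y = \<zero>\<^bsub>P i\<^esub>" for i y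
    using that unfolding dP(2) by (auto simp: a_kernel_def')
  obtain f0 where f0: "f0 \<in> mod_hom R (V (c 1)) (P 0)"
      "\<And>x. x \<in> vecs (c 1) \<Longrightarrow> e (f0 x) = q 0 x"
    by (rule free_mod_lift[OF modP module_free_mod q_hom[of 0, folded One_nat_def] e(1)])
      (use e(2) in auto)
  obtain g0 where g0: "g0 \<in> mod_hom R (P 0) (V (c 1))"
      "\<And>x. x \<in> carrier (P 0) \<Longrightarrow> q 0 (g0 x) = e x"
    by (rule fg_projective_lift[OF P(1) module_free_mod module_free_mod e(1) q_hom[of 0, folded One_nat_def]])
      (use e(2) in auto)
  obtain f where f: "f 0 = f0" "\<And>j. f j \<in> mod_hom R (V (c (Suc j))) (P j)"
      "\<And>j x. x \<in> vecs (c (Suc (Suc j))) \<Longrightarrow> dP j (f (Suc j) x) = f j (q (Suc j) x)"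
  proof (rule comparison_map[where R = R and M = "\<lambda>j. V (c (Suc j))" and N = P
        and dM = "\<lambda>j. q (Suc j)" and dN = dP and ?f0.0 = f0])
    show "f0 \<in> mod_hom R (V (c (Suc 0))) (P 0)" using f0 by simp
    show "f0 (q (Suc 0) x) \<in> dP 0 ` carrier (P 1)" if "x \<in> vecs (c (Suc 1))" for x
      using that f0(2)[of "q (Suc 0) x"] q_q[of x 0] q_closed[of x 1] mod_hom_closed[OF f0(1), of "q (Suc 0) x"]
      unfolding e(3) by (simp add: a_kernel_def')
  qed (auto intro: fg_projective_free_mod modP q_hom q_q dP dP_exact)
  obtain g where g: "g 0 = g0" "\<And>j. g j \<in> mod_hom R (P j) (V (c (Suc j)))"
      "\<And>j x. x \<in> carrier (P (Suc j)) \<Longrightarrow> q (Suc j) (g (Suc j) x) = g j (dP j x)"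
  proof (rule comparison_map[where R = R and N = "\<lambda>j. V (c (Suc j))" and M = P
        and dN = "\<lambda>j. q (Suc j)" and dM = dP and ?f0.0 = g0])
    show "g0 \<in> mod_hom R (P 0) (V (c (Suc 0)))" using g0 by simp
    show "g0 (dP 0 x) \<in> q (Suc 0) ` vecs (c (Suc 1))" if x: "x \<in> carrier (P 1)" for x
    proof -
      have "dP 0 x \<in> carrier (P 0)" "e (dP 0 x) = \<zero>\<^bsub>V (c 0)\<^esub>"
        using e(3) x by (auto simp: a_kernel_def')
      then show ?thesis
        using q_kernel[of "g0 (dP 0 x)" 0] g0(2) mod_hom_closed[OF g0(1)] by simp
    qed
  qed (auto intro: module_free_mod P q_hom q_kernel dP dd)
  have fc: "f j x \<in> carrier (P j)" if "x \<in> vecs (c (Suc j))" for j x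
    using that by (rule mod_hom_closed[OF f(2)])
  have cong: "g j (f j x) \<ominus>\<^bsub>V (c (Suc j))\<^esub> x \<in> ideal_vecs R \<mm> (c (Suc j))"
    if x: "x \<in> vecs (c (Suc j))" for x
  proof (rule endomorphism_congruent_id[where f = "\<lambda>j x. g j (f j x)"])
    show "(\<lambda>x. g j (f j x)) \<in> lin (c (Suc j)) (c (Suc j))" for j
      by (rule mod_hom_comp[OF f(2) g(2)])
    show "q (Suc j) (g (Suc j) (f (Suc j) x)) = g j (f j (q (Suc j) x))"
      if "x \<in> vecs (c (Suc (Suc j)))" for j x
      using that by (simp add: g(3) fc f(3))
    show "q 0 (g 0 (f 0 x)) = q 0 x" if "x \<in> vecs (c 1)" for x
      using that fc[of x 0] by (simp add: f(1) g(1) g0(2) f0(2))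
  qed (rule x)
  show ?thesis
  proof (rule zero_rank_if_in_maximal)
    fix x assume x: "x \<in> vecs (c (Suc j))"
    have "f j x = \<zero>\<^bsub>P j\<^esub>" using fc[OF x] P(2)[OF j] by simp
    then have "g j (f j x) = \<zero>\<^bsub>V (c (Suc j))\<^esub>"
      using mod_hom_zero[OF g(2) modP module_free_mod] by simp
    then have "\<ominus>\<^bsub>V (c (Suc j))\<^esub> (g j (f j x) \<ominus>\<^bsub>V (c (Suc j))\<^esub> x) = x"
      using x by (simp add: a_minus_def)
    then show "x \<in> ideal_vecs R \<mm> (c (Suc j))"
      using ideal_vecs_neg[OF is_ideal cong[OF x]] by simp
  qed
qed

end

section \<open>The dual of the resolution of the residue field\<close>

text \<open>The situation of the theorem in coordinates: \<open>d\<close> is the beginning of a minimal resolution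
  of \<open>k\<close>, the map \<open>D\<close> below is its dual, so that \<open>\<lambda>\<Omega>\<^sup>n k\<close> is the image of \<open>D n\<close>.\<close>

locale residue_complex = noetherian_local_ring R \<mm> for R (structure) and \<mm> +
  fixes n :: nat and b :: "nat \<Rightarrow> nat" and d :: "nat \<Rightarrow> (nat \<Rightarrow> 'a) \<Rightarrow> (nat \<Rightarrow> 'a)"
  assumes d_hom: "d j \<in> lin (b (Suc j)) (b j)"
    and d_d: "v \<in> vecs (b (Suc (Suc j))) \<Longrightarrow> d j (d (Suc j) v) = \<zero>\<^bsub>V (b j)\<^esub>"
    and d_exact: "j < n \<Longrightarrow> v \<in> vecs (b (Suc j)) \<Longrightarrow> d j v = \<zero>\<^bsub>V (b j)\<^esub> \<Longrightarrow>
      v \<in> d (Suc j) ` vecs (b (Suc (Suc j)))"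
    and d_residue: "x \<in> \<mm> \<Longrightarrow> u \<in> vecs (b 0) \<Longrightarrow>
      x \<odot>\<^bsub>V (b 0)\<^esub> u \<in> d 0 ` vecs (b 1)"
    and d_minimal: "j \<le> n \<Longrightarrow> v \<in> vecs (b (Suc j)) \<Longrightarrow> d j v \<in> ideal_vecs R \<mm> (b j)"
begin

definition D :: "nat \<Rightarrow> (nat \<Rightarrow> 'a) \<Rightarrow> (nat \<Rightarrow> 'a)" where
  "D j = transpose_map R (b (Suc j)) (b j) (d j)"

lemma D_hom: "D j \<in> lin (b j) (b (Suc j))"
  unfolding D_def by (rule transpose_hom[OF d_hom])

lemma D_closed: "v \<in> vecs (b j) \<Longrightarrow> D j v \<in> vecs (b (Suc j))"
  by (rule mod_hom_closed[OF D_hom])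

lemma d_closed: "v \<in> vecs (b (Suc j)) \<Longrightarrow> d j v \<in> vecs (b j)"
  by (rule mod_hom_closed[OF d_hom])

lemma dot_D:
  "w \<in> vecs (b j) \<Longrightarrow> u \<in> vecs (b (Suc j)) \<Longrightarrow>
    dot R (b (Suc j)) (D j w) u = dot R (b j) w (d j u)"
  unfolding D_def by (rule dot_transpose[OF d_hom])

lemma D_D: "w \<in> vecs (b j) \<Longrightarrow> D (Suc j) (D j w) = \<zero>\<^bsub>V (b (Suc (Suc j)))\<^esub>"
  by (rule free_mod_eq_dotI[of _ "b (Suc (Suc j))"])
    (auto simp: D_closed dot_D d_closed d_d dot_zero dot_comm[of "\<zero>\<^bsub>V (b (Suc (Suc j)))\<^esub>"])

lemma D_minimal:
  assumes "j \<le> n" "w \<in> vecs (b j)"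
  shows "D j w \<in> ideal_vecs R \<mm> (b (Suc j))"
  using assms by (intro ideal_vecs_dotI) (auto simp: D_closed dot_D intro!: dot_in_ideal is_ideal d_minimal)

text \<open>Multiplication by \<open>x\<close> lifts the zero map of k, because
  \<open>d_residue\<close> puts its degree 0 part into the image of \<open>d 0\<close>.\<close>

lemma multiplication_homotopy:
  assumes "x \<in> \<mm>"
  obtains s where "\<And>j. j \<le> n \<Longrightarrow> s j \<in> lin (b j) (b (Suc j))"
    "\<And>u. u \<in> vecs (b 0) \<Longrightarrow> x \<odot>\<^bsub>V (b 0)\<^esub> u = d 0 (s 0 u)"
    "\<And>j u. j < n \<Longrightarrow> u \<in> vecs (b (Suc j)) \<Longrightarrow>
      x \<odot>\<^bsub>V (b (Suc j))\<^esub> u = d (Suc j) (s (Suc j) u) \<oplus>\<^bsub>V (b (Suc j))\<^esub> s j (d j u)"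
proof (rule null_homotopy[where R = R and M = "\<lambda>j. V (b j)" and N = "\<lambda>j. V (b j)"
      and dM = d and dN = d and J = n and f = "\<lambda>j u. x \<odot>\<^bsub>V (b j)\<^esub> u"])
  have x: "x \<in> carrier R" using assms by (rule Icarr)
  show "(\<lambda>u. x \<odot>\<^bsub>V (b j)\<^esub> u) \<in> lin (b j) (b j)" for j
    by (rule mod_hom_scale[OF mod_hom_id x module_free_mod])
  show "d j (x \<odot>\<^bsub>V (b (Suc j))\<^esub> u) = x \<odot>\<^bsub>V (b j)\<^esub> d j u"
    if "u \<in> vecs (b (Suc j))" for j u
    by (rule mod_hom_smult[OF d_hom x that])
  show "x \<odot>\<^bsub>V (b 0)\<^esub> u \<in> d 0 ` vecs (b 1)"
    if "u \<in> vecs (b 0)" for u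
    by (rule d_residue[OF assms that])
  fix s
  assume "\<And>j. j \<le> n \<Longrightarrow> s j \<in> lin (b j) (b (Suc j))"
    "\<And>u. u \<in> vecs (b 0) \<Longrightarrow> x \<odot>\<^bsub>V (b 0)\<^esub> u = d 0 (s 0 u)"
    "\<And>j u. j < n \<Longrightarrow> u \<in> vecs (b (Suc j)) \<Longrightarrow>
      x \<odot>\<^bsub>V (b (Suc j))\<^esub> u = d (Suc j) (s (Suc j) u) \<oplus>\<^bsub>V (b (Suc j))\<^esub> s j (d j u)"
  then show thesis by (rule that)
qed (assumption | rule fg_projective_free_mod module_free_mod d_hom d_d d_exact)+

end

text \<open>The hypothesis is a homotopy for multiplication by \<open>x\<close>; the proof transposes it.\<close>

lemma (in cring) smult_cocycle_coboundary:
  assumes \<alpha>: "\<alpha> \<in> lin l m" and \<beta>: "\<beta> \<in> lin m k"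
    and \<sigma>: "\<sigma> \<in> lin k m" and \<tau>: "\<tau> \<in> lin m l"
    and x: "x \<in> carrier R"
    and homotopy: "\<And>v. v \<in> vecs m \<Longrightarrow> x \<odot>\<^bsub>V m\<^esub> v = \<alpha> (\<tau> v) \<oplus>\<^bsub>V m\<^esub> \<sigma> (\<beta> v)"
    and I: "ideal I R" and \<psi>: "\<psi> \<in> vecs m" "transpose_map R l m \<alpha> \<psi> \<in> ideal_vecs R I l"
  shows "\<exists>\<theta>\<in>vecs k. \<exists>u\<in>ideal_vecs R I m.
    x \<odot>\<^bsub>V m\<^esub> \<psi> = transpose_map R m k \<beta> \<theta> \<oplus>\<^bsub>V m\<^esub> u"
proof (intro bexI)
  \<comment> \<open>Writing T for transposes, x = \<alpha>\<tau> + \<sigma>\<beta> becomes x =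
    \<tau>^T \<alpha>^T + \<beta>^T \<sigma>^T. On \<open>\<psi>\<close> the first summand has
    coordinates in \<open>I\<close>, the second is the coboundary of \<open>\<sigma>\<close>^T
    \<open>\<psi>\<close>.\<close>
  define \<theta> where "\<theta> = transpose_map R k m \<sigma> \<psi>"
  define u where "u = transpose_map R m l \<tau> (transpose_map R l m \<alpha> \<psi>)"
  show \<theta>: "\<theta> \<in> vecs k" using \<sigma> \<psi> by (simp add: \<theta>_def)
  show u: "u \<in> ideal_vecs R I m"
    unfolding u_def by (rule hom_ideal_vecs[OF I transpose_hom[OF \<tau>] \<psi>(2)])
  show "x \<odot>\<^bsub>V m\<^esub> \<psi> = transpose_map R m k \<beta> \<theta> \<oplus>\<^bsub>V m\<^esub> u"
  proof (rule free_mod_eq_dotI[of _ m])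
    fix v assume v: "v \<in> vecs m"
    note cl = mod_hom_closed[OF \<alpha>] mod_hom_closed[OF \<beta>] mod_hom_closed[OF \<sigma>] mod_hom_closed[OF \<tau>]
    have "dot R m (x \<odot>\<^bsub>V m\<^esub> \<psi>) v = dot R m \<psi> (x \<odot>\<^bsub>V m\<^esub> v)"
      using x v \<psi> by (simp add: dot_smult dot_smult_left)
    also have "\<dots> = dot R m \<psi> (\<sigma> (\<beta> v)) \<oplus> dot R m \<psi> (\<alpha> (\<tau> v))"
      using v \<psi> by (simp add: homotopy dot_add cl a_comm)
    also have "\<dots> = dot R m (transpose_map R m k \<beta> \<theta>) v \<oplus> dot R m u v"
      using v \<psi> \<theta> \<alpha> \<beta> \<sigma> \<tau> by (simp add: \<theta>_def u_def dot_transpose cl)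
    finally show "dot R m (x \<odot>\<^bsub>V m\<^esub> \<psi>) v
        = dot R m (transpose_map R m k \<beta> \<theta> \<oplus>\<^bsub>V m\<^esub> u) v"
      using v \<theta> \<beta> ideal_vecs_carrier[OF u] by (simp add: dot_add_left)
  qed (use x \<psi> \<theta> \<beta> ideal_vecs_carrier[OF u] in auto)
qed

context residue_complex
begin

text \<open>This is \<open>Ext\<^sup>j(k, R) = 0\<close> for \<open>j\<close> smaller than the length of a regular sequence.\<close>

lemma dual_exact:
  assumes xs: "regular_sequence R xs" "set xs \<subseteq> \<mm>" "n < length xs"
    and j: "j \<le> n" "\<psi> \<in> vecs (b j)" "D j \<psi> = \<zero>\<^bsub>V (b (Suc j))\<^esub>"
  shows "case j of 0 \<Rightarrow> \<psi> = \<zero>\<^bsub>V (b 0)\<^esub>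
    | Suc i \<Rightarrow> \<psi> \<in> D i ` vecs (b i)"
proof -
  interpret S: regular_seq R xs by unfold_locales (rule xs(1))
  \<comment> \<open>A zero module is put in front, so that injectivity of \<open>D 0\<close> becomes
    exactness at position 1 and serves as the base case.\<close>
  define a where "a = case_nat 0 b"
  define \<delta> where "\<delta> = case_nat (\<lambda>v. \<zero>\<^bsub>V (b 0)\<^esub>) D"
  have a: "a 0 = 0" "\<And>i. a (Suc i) = b i" and \<delta>: "\<delta> 0 = (\<lambda>v. \<zero>\<^bsub>V (b 0)\<^esub>)" "\<And>i. \<delta> (Suc i) = D i"
    by (simp_all add: a_def \<delta>_def)
  have \<delta>_hom: "\<delta> i \<in> lin (a i) (a (Suc i))" for i
    by (cases i) (simp_all add: a \<delta> D_hom mod_hom_const_zero module_free_mod)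
  have \<delta>_\<delta>: "\<delta> (Suc i) (\<delta> i v) = \<zero>\<^bsub>V (a (Suc (Suc i)))\<^esub>" if "v \<in> vecs (a i)" for i v
    using that by (cases i) (simp_all add: a \<delta> D_D mod_hom_zero[OF D_hom module_free_mod module_free_mod])
  have "\<exists>\<theta>\<in>vecs (a j). \<exists>u\<in>ideal_vecs R (S.seq_ideal 0) (a (Suc j)).
      \<psi> = \<delta> j \<theta> \<oplus>\<^bsub>V (a (Suc j))\<^esub> u"
  proof (rule S.coexact_mod_regular_sequence[where \<delta> = \<delta> and a = a and J = n and i = 0])
    show "0 + j < length xs" using xs(3) j(1) by simp
    show "\<psi> \<in> vecs (a (Suc j))" using j by (simp add: a)
    show "\<delta> (Suc j) \<psi> \<in> ideal_vecs R (S.seq_ideal 0) (a (Suc (Suc j)))"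
      using j by (simp add: a \<delta> S.seq_ideal_0 ideal_vecs_zero)
  next
    fix i \<psi> assume i: "i < length xs" and "\<psi> \<in> vecs (a 1)"
      and "\<delta> 1 \<psi> \<in> ideal_vecs R (S.seq_ideal i) (a 2)"
    then have \<psi>: "\<psi> \<in> vecs (b 0)" "D 0 \<psi> \<in> ideal_vecs R (S.seq_ideal i) (b 1)"
      using a(2)[of 1] by (simp_all add: a \<delta> numeral_2_eq_2)
    let ?x = "xs ! i"
    have x: "?x \<in> \<mm>" "?x \<in> carrier R" using i xs(2) S.seq_nth_carrier by auto
    \<comment> \<open>This is Hom(k, R/(x_1, ..., x_i)) = 0. Every multiple of \<open>?x\<close> in
      degree 0 is a boundary, so \<open>?x\<close> kills \<open>\<psi>\<close> modulo the ideal, and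
      \<open>?x\<close> is regular there.\<close>
    have "\<psi> \<in> ideal_vecs R (S.seq_ideal i) (b 0)"
    proof (rule ideal_vecs_cancel[OF S.seq_cancel[OF i] \<psi>(1)])
      show "?x \<odot>\<^bsub>V (b 0)\<^esub> \<psi> \<in> ideal_vecs R (S.seq_ideal i) (b 0)"
      proof (rule ideal_vecs_dotI)
        fix w assume w: "w \<in> vecs (b 0)"
        then obtain v where v: "v \<in> vecs (b 1)" "?x \<odot>\<^bsub>V (b 0)\<^esub> w = d 0 v"
          using d_residue[OF x(1)] by blast
        have "dot R (b 0) (?x \<odot>\<^bsub>V (b 0)\<^esub> \<psi>) w = dot R (b 0) \<psi> (d 0 v)"
          using w \<psi> x by (simp add: dot_smult_left v(2)[symmetric] dot_smult)
        also have "\<dots> = dot R (b 1) v (D 0 \<psi>)"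
          using v \<psi> D_closed[of \<psi> 0] by (simp add: dot_D[symmetric] dot_comm)
        finally show "dot R (b 0) (?x \<odot>\<^bsub>V (b 0)\<^esub> \<psi>) w \<in> S.seq_ideal i"
          using dot_in_ideal[OF S.seq_ideal_ideal \<psi>(2) v(1)] by simp
      qed (use x \<psi> in auto)
    qed
    then show "\<exists>\<theta>\<in>vecs (a 0). \<exists>u\<in>ideal_vecs R (S.seq_ideal i) (a 1).
        \<psi> = \<delta> 0 \<theta> \<oplus>\<^bsub>V (a 1)\<^esub> u"
      using \<psi> by (intro bexI[of _ "\<zero>\<^bsub>V (a 0)\<^esub>"] bexI[of _ \<psi>]) (auto simp: a \<delta>)
  next
    fix i j x \<psi> assume j: "j < n" and x: "x \<in> set xs" and \<psi>: "\<psi> \<in> vecs (a (Suc (Suc j)))"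
      "\<delta> (Suc (Suc j)) \<psi> \<in> ideal_vecs R (S.seq_ideal i) (a (Suc (Suc (Suc j))))"
    have xm: "x \<in> \<mm>" using x xs by auto
    obtain s where s: "\<And>j. j \<le> n \<Longrightarrow> s j \<in> lin (b j) (b (Suc j))"
      "\<And>j u. j < n \<Longrightarrow> u \<in> vecs (b (Suc j)) \<Longrightarrow>
        x \<odot>\<^bsub>V (b (Suc j))\<^esub> u = d (Suc j) (s (Suc j) u) \<oplus>\<^bsub>V (b (Suc j))\<^esub> s j (d j u)"
      by (rule multiplication_homotopy[OF xm]) blast
    show "\<exists>\<theta>\<in>vecs (a (Suc j)). \<exists>u\<in>ideal_vecs R (S.seq_ideal i) (a (Suc (Suc j))).
        x \<odot>\<^bsub>V (a (Suc (Suc j)))\<^esub> \<psi> = \<delta> (Suc j) \<theta> \<oplus>\<^bsub>V (a (Suc (Suc j)))\<^esub> u"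
      unfolding a \<delta> D_def using \<psi> j
      by (intro smult_cocycle_coboundary[OF d_hom d_hom s(1) s(1)])
        (auto simp: a \<delta> D_def s(2) Icarr[OF xm] S.seq_ideal_ideal)
  qed (use j \<delta>_hom \<delta>_\<delta> in auto)
  then obtain \<theta> where \<theta>: "\<theta> \<in> vecs (a j)" "\<psi> = \<delta> j \<theta>"
    using mod_hom_closed[OF \<delta>_hom] by (auto simp: S.seq_ideal_0 ideal_vecs_zero)
  then show ?thesis by (cases j) (simp_all add: a \<delta>)
qed

end

text \<open>X enters through its copy in the free module of rank \<open>b (Suc n)\<close>, the image
  of \<open>q 0\<close>. The map \<open>r\<close> is \<open>D n\<close> followed by the projection
  onto that copy. It is defined on a free module, so maps out of submodules are avoided;
  \<open>r_zero\<close> says that it factors through the image of \<open>D n\<close>.\<close>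

locale lambda_summand = residue_complex R \<mm> n b d + minimal_resolution R \<mm> c q
  for R (structure) and \<mm> and n and b and d and c and q +
  fixes r :: "(nat \<Rightarrow> 'a) \<Rightarrow> (nat \<Rightarrow> 'a)"
  assumes c_0: "c 0 = b (Suc n)"
    and r_hom: "r \<in> lin (b n) (b (Suc n))"
    and r_image: "r ` vecs (b n) = q 0 ` vecs (c 1)"
    and image_subset: "q 0 ` vecs (c 1) \<subseteq> D n ` vecs (b n)"
    and r_zero: "u \<in> vecs (b n) \<Longrightarrow> D n u = \<zero>\<^bsub>V (b (Suc n))\<^esub> \<Longrightarrow>
      r u = \<zero>\<^bsub>V (b (Suc n))\<^esub>"
    and r_id: "u \<in> vecs (b n) \<Longrightarrow> D n u \<in> q 0 ` vecs (c 1) \<Longrightarrow> r u = D n u"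
    and nonzero: "c 1 \<noteq> 0"
begin

text \<open>The copy of X lies in the image of \<open>D n\<close>, hence in \<mm> times the free
  module. Thus \<open>q 0\<close> is minimal too, and appending the ambient free module keeps the
  resolution minimal.\<close>

lemma q_minimal: "v \<in> vecs (c (Suc j)) \<Longrightarrow> q j v \<in> ideal_vecs R \<mm> (c j)"
proof (cases j)
  case 0
  assume "v \<in> vecs (c (Suc j))"
  then obtain w where "w \<in> vecs (b n)" "q 0 v = D n w"
    using image_subset by (auto simp: 0)
  then show ?thesis using D_minimal[of n w] by (simp add: 0 c_0)
qed (use q_minimal_Suc in auto)

lemma r_lift:
  obtains r' where "r' \<in> lin (b n) (c 1)"
    "\<And>u. u \<in> vecs (b n) \<Longrightarrow> q 0 (r' u) = r u"
  using r_image r_hom q_hom[of 0]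
  by (elim free_mod_lift[OF module_free_mod module_free_mod, rotated -1]) (auto simp: c_0)

lemma zero_rank_0: "c j = 0 \<Longrightarrow> v \<in> vecs (c j) \<Longrightarrow> v = \<zero>\<^bsub>V (c j)\<^esub>"
  using carrier_free_mod_0[of v] by simp

subsection \<open>Large depth\<close>

text \<open>\<open>g\<close> lifts the inclusion of X and \<open>h\<close> the projection onto it,
  between \<open>q\<close> and the reversed dual complex, and \<open>h\<close> after
  \<open>g\<close> is the identity modulo \<mm>. The first claim holds because the dual complex
  stops at n. For the second, \<open>step\<close> shows that a vanishing rank forces the preceding
  one to vanish, down to the nonzero rank \<open>c 1\<close>.\<close>

lemma zero_ranks_iff_large_depth:
  assumes xs: "regular_sequence R xs" "set xs \<subseteq> \<mm>" "n < length xs"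
  shows "n < j \<Longrightarrow> c (Suc j) = 0" and "j \<le> n \<Longrightarrow> c (Suc j) \<noteq> 0"
proof -
  \<comment> \<open>The dual complex read backwards, with \<open>D n\<close> as its augmentation,
    continued by zero after degree n.\<close>
  define t where "t j = (if j \<le> n then b (n - j) else 0)" for j
  define \<tau> where "\<tau> j = (if j < n then D (n - Suc j) else (\<lambda>v. \<zero>\<^bsub>V (t j)\<^esub>))" for j
  have t0: "t 0 = b n" by (simp add: t_def)
  have \<tau>_hom: "\<tau> j \<in> lin (t (Suc j)) (t j)" for j
  proof (cases "j < n")
    case True
    then have "Suc (n - Suc j) = n - j" by simp
    then show ?thesis using True D_hom[of "n - Suc j"] by (simp add: t_def \<tau>_def)
  qed (simp add: \<tau>_def mod_hom_const_zero module_free_mod)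
  have \<tau>_\<tau>: "\<tau> j (\<tau> (Suc j) v) = \<zero>\<^bsub>V (t j)\<^esub>" if v: "v \<in> vecs (t (Suc (Suc j)))" for j v
  proof (cases "Suc j < n")
    case True
    then obtain k where k: "n = Suc (Suc j) + k" using less_iff_Suc_add by auto
    then show ?thesis using v D_D[of v k] by (simp add: t_def \<tau>_def)
  next
    case False
    then show ?thesis
      using mod_hom_zero[OF \<tau>_hom module_free_mod module_free_mod, of j] by (simp add: \<tau>_def[of "Suc j"])
  qed
  have \<tau>_exact: "y \<in> \<tau> (Suc j) ` vecs (t (Suc (Suc j)))"
    if y: "y \<in> vecs (t (Suc j))" "\<tau> j y = \<zero>\<^bsub>V (t j)\<^esub>" for j y
  proof (cases "Suc j < n")
    case True
    then obtain k where k: "n = Suc (Suc j) + k" using less_iff_Suc_add by auto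
    then show ?thesis using y dual_exact[OF xs, of "Suc k" y] by (simp add: t_def \<tau>_def)
  next
    case False
    have "y = \<zero>\<^bsub>V (t (Suc j))\<^esub>"
    proof (cases "Suc j = n")
      case True
      then show ?thesis using y dual_exact[OF xs, of 0 y] by (auto simp: t_def \<tau>_def)
    next
      case F: False
      then show ?thesis using False y(1) carrier_free_mod_0 by (simp add: t_def)
    qed
    then show ?thesis using False by (auto simp: \<tau>_def)
  qed
  obtain r' where r': "r' \<in> lin (b n) (c 1)"
    "\<And>u. u \<in> vecs (b n) \<Longrightarrow> q 0 (r' u) = r u"
    by (rule r_lift) blast
  have q0: "q 0 \<in> lin (c 1) (b (Suc n))"
    using q_hom[of 0] by (simp add: c_0)
  obtain g0 where g0: "g0 \<in> lin (c 1) (b n)"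
    "\<And>v. v \<in> vecs (c 1) \<Longrightarrow> D n (g0 v) = q 0 v"
    by (rule free_mod_lift[OF module_free_mod module_free_mod q0 D_hom])
      (use image_subset in auto)
  have \<tau>0: "\<exists>w. \<tau> 0 v = w \<and> w \<in> vecs (b n) \<and> D n w = \<zero>\<^bsub>V (b (Suc n))\<^esub>"
    if v: "v \<in> vecs (t 1)" for v
  proof (cases n)
    case 0
    then show ?thesis
      using mod_hom_zero[OF D_hom module_free_mod module_free_mod, of n] by (simp add: \<tau>_def t_def)
  next
    case (Suc k)
    then show ?thesis using v D_D[of v k] D_closed[of v k] by (simp add: \<tau>_def t_def)
  qed
  obtain h where h: "h 0 = r'" "\<And>j. h j \<in> lin (t j) (c (Suc j))"
    "\<And>j x. x \<in> vecs (t (Suc j)) \<Longrightarrow> q (Suc j) (h (Suc j) x) = h j (\<tau> j x)"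
  proof (rule comparison_map[where R = R and M = "\<lambda>j. V (t j)" and N = "\<lambda>j. V (c (Suc j))"
        and dM = \<tau> and dN = "\<lambda>j. q (Suc j)" and ?f0.0 = r'])
    show "r' \<in> lin (t 0) (c (Suc 0))" using r' by (simp add: t0)
    fix x assume "x \<in> vecs (t 1)"
    then have w: "\<tau> 0 x \<in> vecs (b n)" "D n (\<tau> 0 x) = \<zero>\<^bsub>V (b (Suc n))\<^esub>"
      using \<tau>0 by auto
    then have "q 0 (r' (\<tau> 0 x)) = \<zero>\<^bsub>V (c 0)\<^esub>"
      by (simp add: r' r_zero c_0)
    then show "r' (\<tau> 0 x) \<in> q (Suc 0) ` vecs (c (Suc 1))"
      using q_kernel[of "r' (\<tau> 0 x)" 0] mod_hom_closed[OF r'(1) w(1)] by simp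
  qed (auto intro: fg_projective_free_mod module_free_mod \<tau>_hom \<tau>_\<tau> q_hom q_kernel)
  obtain g where g: "g 0 = g0" "\<And>j. g j \<in> lin (c (Suc j)) (t j)"
    "\<And>j x. x \<in> vecs (c (Suc (Suc j))) \<Longrightarrow> \<tau> j (g (Suc j) x) = g j (q (Suc j) x)"
  proof (rule comparison_map[where R = R and N = "\<lambda>j. V (t j)" and M = "\<lambda>j. V (c (Suc j))"
        and dN = \<tau> and dM = "\<lambda>j. q (Suc j)" and ?f0.0 = g0])
    show "g0 \<in> lin (c (Suc 0)) (t 0)" using g0 by (simp add: t0)
    fix x assume x: "x \<in> vecs (c (Suc 1))"
    define w where "w = g0 (q 1 x)"
    have "q 1 x \<in> vecs (c 1)" using x q_closed[of x 1] by simp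
    then have w: "w \<in> vecs (b n)" "D n w = \<zero>\<^bsub>V (b (Suc n))\<^esub>"
      using g0(2) mod_hom_closed[OF g0(1)] q_q[of x 0] x by (auto simp: w_def c_0)
    show "g0 (q (Suc 0) x) \<in> \<tau> 0 ` vecs (t 1)"
    proof (cases n)
      case 0
      then have "w = \<zero>\<^bsub>V (b 0)\<^esub>" using dual_exact[OF xs, of 0 w] w by simp
      then show ?thesis using 0 by (auto simp: w_def \<tau>_def t_def)
    next
      case (Suc k)
      then show ?thesis using dual_exact[OF xs, of n w] w by (simp add: w_def \<tau>_def t_def)
    qed
  qed (auto intro: fg_projective_free_mod module_free_mod \<tau>_hom \<tau>_exact q_hom q_q)
  have gc: "g j x \<in> vecs (t j)" if "x \<in> vecs (c (Suc j))" for j x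
    using that by (rule mod_hom_closed[OF g(2)])
  have hc: "h j x \<in> vecs (c (Suc j))" if "x \<in> vecs (t j)" for j x
    using that by (rule mod_hom_closed[OF h(2)])
  have cong: "h j (g j x) \<ominus>\<^bsub>V (c (Suc j))\<^esub> x \<in> ideal_vecs R \<mm> (c (Suc j))"
    if x: "x \<in> vecs (c (Suc j))" for j x
  proof (rule endomorphism_congruent_id[where f = "\<lambda>j x. h j (g j x)"])
    show "(\<lambda>x. h j (g j x)) \<in> lin (c (Suc j)) (c (Suc j))" for j
      by (rule mod_hom_comp[OF g(2) h(2)])
    show "q (Suc j) (h (Suc j) (g (Suc j) x)) = h j (g j (q (Suc j) x))"
      if "x \<in> vecs (c (Suc (Suc j)))" for j x
      using that by (simp add: h(3) gc g(3))
    show "q 0 (h 0 (g 0 x)) = q 0 x" if x: "x \<in> vecs (c 1)" for x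
    proof -
      have "g0 x \<in> vecs (b n)" by (rule mod_hom_closed[OF g0(1) x])
      then show ?thesis using x g0(2)[OF x] r_id[of "g0 x"] by (simp add: h(1) g(1) r'(2))
    qed
  qed (rule x)
  have zero_if: "c (Suc j) = 0"
    if m: "\<And>x. x \<in> vecs (c (Suc j)) \<Longrightarrow> h j (g j x) \<in> ideal_vecs R \<mm> (c (Suc j))" for j
  proof (rule zero_rank_if_in_maximal)
    fix x assume x: "x \<in> vecs (c (Suc j))"
    have "h j (g j x) \<oplus>\<^bsub>V (c (Suc j))\<^esub>
        \<ominus>\<^bsub>V (c (Suc j))\<^esub> (h j (g j x) \<ominus>\<^bsub>V (c (Suc j))\<^esub> x) = x"
      using x gc hc by (simp add: a_minus_def V.M.minus_add V.M.r_neg1 V.M.r_neg2 V.a_assoc[symmetric] V.r_neg)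
    then show "x \<in> ideal_vecs R \<mm> (c (Suc j))"
      using ideal_vecs_add[OF is_ideal m[OF x] ideal_vecs_neg[OF is_ideal cong[OF x]]] by simp
  qed
  show "c (Suc j) = 0" if "n < j" for j
  proof (rule zero_if)
    fix x assume "x \<in> vecs (c (Suc j))"
    then have "g j x = \<zero>\<^bsub>V (t j)\<^esub>"
      using gc[of x j] carrier_free_mod_0[of "g j x"] that by (simp add: t_def)
    then have "h j (g j x) = \<zero>\<^bsub>V (c (Suc j))\<^esub>"
      using mod_hom_zero[OF h(2) module_free_mod module_free_mod] by simp
    then show "h j (g j x) \<in> ideal_vecs R \<mm> (c (Suc j))"
      using submodule_zero[OF submodule_ideal_vecs[OF is_ideal]] by simp
  qed
  \<comment> \<open>If the next rank is zero, \<open>h j\<close> vanishes on boundaries of the dual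
    complex. Its rows are then cycles of \<open>d\<close>, therefore boundaries, therefore vectors
    over \<mm>. So the identity is congruent to zero modulo \<mm>.\<close>
  have step: "c (Suc j) = 0" if j: "j < n" and z: "c (Suc (Suc j)) = 0" for j
  proof (rule zero_if)
    obtain k where k: "n = Suc j + k" using j less_iff_Suc_add by auto
    then have tj: "t j = b (Suc k)" "t (Suc j) = b k" and \<tau>j: "\<tau> j = D k"
      by (simp_all add: t_def \<tau>_def)
    have hj: "h j \<in> lin (b (Suc k)) (c (Suc j))"
      using h(2)[of j] by (simp add: tj)
    fix x assume x: "x \<in> vecs (c (Suc j))"
    have gx: "g j x \<in> vecs (b (Suc k))" using gc[OF x] by (simp add: tj)
    show "h j (g j x) \<in> ideal_vecs R \<mm> (c (Suc j))"
    proof (rule ideal_vecs_dotI)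
      show "h j (g j x) \<in> vecs (c (Suc j))" using x gc hc by blast
      fix e assume e: "e \<in> vecs (c (Suc j))"
      define w where "w = transpose_map R (b (Suc k)) (c (Suc j)) (h j) e"
      have w: "w \<in> vecs (b (Suc k))" unfolding w_def using hj e by simp
      \<comment> \<open>\<open>w\<close> is the functional \<open>e\<close> pulled back along
        \<open>h j\<close>; its pairing with every \<open>D k u\<close> is zero, which by adjunction
        says that \<open>d k w\<close> pairs to zero with every \<open>u\<close>.\<close>
      have "d k w = \<zero>\<^bsub>V (b k)\<^esub>"
      proof (rule free_mod_eq_dotI[of _ "b k"])
        fix u assume u: "u \<in> vecs (b k)"
        have "h (Suc j) u = \<zero>\<^bsub>V (c (Suc (Suc j)))\<^esub>"
          using zero_rank_0[OF z] hc[of u "Suc j"] u by (simp add: tj)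
        then have "h j (D k u) = \<zero>\<^bsub>V (c (Suc j))\<^esub>"
          using h(3)[of u j] u mod_hom_zero[OF q_hom module_free_mod module_free_mod] by (simp add: tj \<tau>j)
        then have "dot R (b (Suc k)) w (D k u) = \<zero>"
          using hj e u by (simp add: w_def dot_transpose D_closed dot_zero)
        moreover have "dot R (b k) (d k w) u = dot R (b (Suc k)) w (D k u)"
          using w u by (simp add: dot_comm[of _ "b k" u] dot_comm[of w] d_closed D_closed dot_D)
        ultimately show "dot R (b k) (d k w) u = dot R (b k) \<zero>\<^bsub>V (b k)\<^esub> u"
          using u by (simp add: dot_comm[of _ "b k" u] dot_zero)
      qed (use w d_closed in auto)
      then obtain v where v: "v \<in> vecs (b (Suc (Suc k)))" "w = d (Suc k) v"
        using d_exact[of k w] k w by auto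
      then have "w \<in> ideal_vecs R \<mm> (b (Suc k))" using d_minimal[of "Suc k" v] k by simp
      then have "dot R (b (Suc k)) (g j x) w \<in> \<mm>" using gx by (intro dot_in_ideal is_ideal)
      moreover have "dot R (c (Suc j)) (h j (g j x)) e = dot R (b (Suc k)) (g j x) w"
        using hj e gx w mod_hom_closed[OF hj gx]
        by (simp add: dot_comm[of "g j x"] dot_comm[of _ _ e] w_def dot_transpose)
      ultimately show "dot R (c (Suc j)) (h j (g j x)) e \<in> \<mm>" by simp
    qed
  qed
  show "c (Suc j) \<noteq> 0" if "j \<le> n" for j
    using that
  proof (induction j)
    case 0
    then show ?case using nonzero by simp
  next
    case (Suc j)
    then show ?case using step[of j] by auto
  qed
qed

end

subsection \<open>Small depth\<close>

context lambda_summand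
begin

text \<open>Multiplication by \<open>x\<close> on X factors through the free module of rank
  \<open>b n\<close>. Correcting it in degree 0 by a lift of this factorization leaves a chain map
  over the zero map of X, hence a null-homotopic one. The correction is why the homotopy represents
  multiplication only in positive degrees. The case n = 0 is excluded because the transposed
  homotopy uses degree n - 1.\<close>

lemma resolution_multiplication_homotopy:
  assumes n: "n = Suc n'" and x: "x \<in> \<mm>"
  obtains \<sigma> where "\<And>j. j \<le> J \<Longrightarrow> \<sigma> j \<in> lin (c (Suc j)) (c (Suc (Suc j)))"
    "\<And>j v. j < J \<Longrightarrow> v \<in> vecs (c (Suc (Suc j))) \<Longrightarrow> x \<odot>\<^bsub>V (c (Suc (Suc j)))\<^esub> v
      = q (Suc (Suc j)) (\<sigma> (Suc j) v) \<oplus>\<^bsub>V (c (Suc (Suc j)))\<^esub> \<sigma> j (q (Suc j) v)"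
proof -
  have xR: "x \<in> carrier R" using x by (rule Icarr)
  have q0: "q 0 \<in> lin (c 1) (b (Suc n))"
    using q_hom[of 0] by (simp add: c_0)
  obtain s where s: "\<And>j. j \<le> n \<Longrightarrow> s j \<in> lin (b j) (b (Suc j))"
    "\<And>j u. j < n \<Longrightarrow> u \<in> vecs (b (Suc j)) \<Longrightarrow>
      x \<odot>\<^bsub>V (b (Suc j))\<^esub> u = d (Suc j) (s (Suc j) u) \<oplus>\<^bsub>V (b (Suc j))\<^esub> s j (d j u)"
    by (rule multiplication_homotopy[OF x]) blast
  have sn: "s n \<in> lin (b n) (b (Suc n))"
    and sn': "s n' \<in> lin (b n') (b n)"
    using s(1)[of n] s(1)[of n'] n by auto
  define \<beta> where "\<beta> = transpose_map R (b n) (b (Suc n)) (s n)"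
  define \<gamma> where "\<gamma> = transpose_map R (b n') (b n) (s n')"
  have \<beta>: "\<beta> \<in> lin (b (Suc n)) (b n)"
    unfolding \<beta>_def by (rule transpose_hom[OF sn])
  have \<gamma>: "\<gamma> \<in> lin (b n) (b n')"
    unfolding \<gamma>_def by (rule transpose_hom[OF sn'])
  note cl = mod_hom_closed[OF \<beta>] mod_hom_closed[OF \<gamma>] mod_hom_closed[OF sn] mod_hom_closed[OF sn']
    D_closed d_closed
  have Dn': "D n' u \<in> vecs (b n)" if "u \<in> vecs (b n')" for u
    using D_closed[OF that] n by simp
  have dn': "d n' u \<in> vecs (b n')" if "u \<in> vecs (b n)" for u
    using d_closed[of u n'] that n by simp
  \<comment> \<open>The transposed homotopy in degree n. Under \<open>r\<close> the second summand
    dies, as it lies in the kernel of \<open>D n\<close>, and the first depends on \<open>z\<close>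
    only through \<open>D n z\<close>.\<close>
  have dual: "x \<odot>\<^bsub>V (b n)\<^esub> z = \<beta> (D n z) \<oplus>\<^bsub>V (b n)\<^esub> D n' (\<gamma> z)"
    if z: "z \<in> vecs (b n)" for z
  proof (rule free_mod_eq_dotI[of _ "b n"])
    fix u assume u: "u \<in> vecs (b n)"
    have "dot R (b n) (x \<odot>\<^bsub>V (b n)\<^esub> z) u = dot R (b n) z (x \<odot>\<^bsub>V (b n)\<^esub> u)"
      using xR z u by (simp add: dot_smult dot_smult_left)
    also have "\<dots> = dot R (b n) z (d n (s n u)) \<oplus> dot R (b n) z (s n' (d n' u))"
      using s(2)[of n' u] n z u cl dn' by (simp add: dot_add)
    also have "dot R (b n) z (d n (s n u)) = dot R (b n) (\<beta> (D n z)) u"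
      using z u cl by (simp add: \<beta>_def dot_transpose[OF sn] dot_D)
    also have "dot R (b n) z (s n' (d n' u)) = dot R (b n') (\<gamma> z) (d n' u)"
      unfolding \<gamma>_def by (rule dot_transpose[OF sn' z dn'[OF u], symmetric])
    also have "\<dots> = dot R (b n) (D n' (\<gamma> z)) u"
      using dot_D[of "\<gamma> z" n' u] cl(2)[OF z] u n by simp
    finally show "dot R (b n) (x \<odot>\<^bsub>V (b n)\<^esub> z) u
        = dot R (b n) (\<beta> (D n z) \<oplus>\<^bsub>V (b n)\<^esub> D n' (\<gamma> z)) u"
      using z u cl Dn' by (simp add: dot_add_left)
  qed (use z xR cl Dn' in auto)
  obtain r' where r': "r' \<in> lin (b n) (c 1)"
    "\<And>u. u \<in> vecs (b n) \<Longrightarrow> q 0 (r' u) = r u"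
    by (rule r_lift) blast
  define \<alpha> where "\<alpha> v = r' (\<beta> (q 0 v))" for v
  have \<alpha>: "\<alpha> \<in> lin (c 1) (c 1)"
    unfolding \<alpha>_def by (intro mod_hom_comp[OF mod_hom_comp[OF q0 \<beta>] r'(1)])
  have q\<alpha>: "q 0 (\<alpha> v) = x \<odot>\<^bsub>V (b (Suc n))\<^esub> q 0 v" if v: "v \<in> vecs (c 1)" for v
  proof -
    obtain z where z: "z \<in> vecs (b n)" "q 0 v = D n z"
      using image_subset v by blast
    have rz: "r z = q 0 v" using r_id[OF z(1)] v by (simp add: z(2)[symmetric])
    have bz: "\<beta> (D n z) \<in> vecs (b n)" using z cl by simp
    have "x \<odot>\<^bsub>V (b (Suc n))\<^esub> q 0 v = r (x \<odot>\<^bsub>V (b n)\<^esub> z)"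
      using mod_hom_smult[OF r_hom xR z(1)] rz by simp
    also have "\<dots> = r (\<beta> (D n z)) \<oplus>\<^bsub>V (b (Suc n))\<^esub> r (D n' (\<gamma> z))"
      unfolding dual[OF z(1)] using z cl Dn' by (intro mod_hom_add[OF r_hom]) auto
    also have "r (D n' (\<gamma> z)) = \<zero>\<^bsub>V (b (Suc n))\<^esub>"
      using z cl Dn' D_D[of "\<gamma> z" n'] n by (intro r_zero) auto
    also have "r (\<beta> (D n z)) = q 0 (\<alpha> v)"
      unfolding \<alpha>_def using r'(2) z cl by simp
    finally show ?thesis
      using mod_hom_closed[OF q0 mod_hom_closed[OF \<alpha> v]] by simp
  qed
  \<comment> \<open>Only degree 0 needs the correction by \<open>\<alpha>\<close>: since
    \<open>\<alpha>\<close> starts with \<open>q 0\<close>, it vanishes on the image of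
    \<open>q 1\<close>, and the chain condition survives.\<close>
  define f where "f = case_nat (\<lambda>v. x \<odot>\<^bsub>V (c 1)\<^esub> v \<ominus>\<^bsub>V (c 1)\<^esub> \<alpha> v)
    (\<lambda>j v. x \<odot>\<^bsub>V (c (Suc (Suc j)))\<^esub> v)"
  have f: "f 0 = (\<lambda>v. x \<odot>\<^bsub>V (c 1)\<^esub> v \<ominus>\<^bsub>V (c 1)\<^esub> \<alpha> v)"
      "\<And>j. f (Suc j) = (\<lambda>v. x \<odot>\<^bsub>V (c (Suc (Suc j)))\<^esub> v)"
    by (simp_all add: f_def)
  have scale: "(\<lambda>v. x \<odot>\<^bsub>V m\<^esub> v) \<in> lin m m" for m
    by (rule mod_hom_scale[OF mod_hom_id xR module_free_mod])
  have f_hom: "f j \<in> lin (c (Suc j)) (c (Suc j))" for j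
    by (cases j) (use mod_hom_minus[OF scale \<alpha> module_free_mod] scale in \<open>simp_all add: f\<close>)
  have chain: "q (Suc j) (f (Suc j) v) = f j (q (Suc j) v)"
    if v: "v \<in> vecs (c (Suc (Suc j)))" for j v
  proof (cases j)
    case 0
    have v': "v \<in> vecs (c (Suc 1))" using v 0 by simp
    have "\<alpha> (q 1 v) = \<zero>\<^bsub>V (c 1)\<^esub>"
      using q_q[of v 0] v' mod_hom_zero[OF \<beta> module_free_mod module_free_mod]
        mod_hom_zero[OF r'(1) module_free_mod module_free_mod]
      by (simp add: \<alpha>_def c_0)
    then show ?thesis
      using 0 v' xR q_closed[of v 1] mod_hom_smult[OF q_hom[of 1] xR] by (simp add: f a_minus_def)
  next
    case (Suc i)
    then show ?thesis using mod_hom_smult[OF q_hom xR v] by (simp add: f)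
  qed
  have f0: "f 0 v \<in> q (Suc 0) ` vecs (c (Suc 1))" if v: "v \<in> vecs (c (Suc 0))" for v
  proof -
    have v': "v \<in> vecs (c 1)" using v by simp
    have xv: "x \<odot>\<^bsub>V (c 1)\<^esub> v \<in> vecs (c 1)" using v' xR by simp
    have "q 0 (f 0 v) = x \<odot>\<^bsub>V (b (Suc n))\<^esub> q 0 v \<ominus>\<^bsub>V (b (Suc n))\<^esub> x \<odot>\<^bsub>V (b (Suc n))\<^esub> q 0 v"
      unfolding f mod_hom_diff[OF q0 module_free_mod module_free_mod xv mod_hom_closed[OF \<alpha> v']]
        q\<alpha>[OF v'] mod_hom_smult[OF q0 xR v'] ..
    also have "\<dots> = \<zero>\<^bsub>V (c 0)\<^esub>"
      using mod_hom_closed[OF q0 v'] xR by (simp add: a_minus_def V.r_neg c_0)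
    finally show ?thesis
      using q_kernel[of "f 0 v" 0] mod_hom_closed[OF f_hom v] by simp
  qed
  obtain \<sigma> where \<sigma>: "\<And>j. j \<le> J \<Longrightarrow> \<sigma> j \<in> lin (c (Suc j)) (c (Suc (Suc j)))"
    "\<And>j v. j < J \<Longrightarrow> v \<in> vecs (c (Suc (Suc j))) \<Longrightarrow> f (Suc j) v
      = q (Suc (Suc j)) (\<sigma> (Suc j) v) \<oplus>\<^bsub>V (c (Suc (Suc j)))\<^esub> \<sigma> j (q (Suc j) v)"
    by (rule null_homotopy[where R = R and M = "\<lambda>j. V (c (Suc j))" and J = J
        and N = "\<lambda>j. V (c (Suc j))" and dM = "\<lambda>j. q (Suc j)" and dN = "\<lambda>j. q (Suc j)" and f = f])
      (blast intro: fg_projective_free_mod module_free_mod q_hom q_q q_kernel f_hom chain f0)+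
  show ?thesis
    by (rule that[OF \<sigma>(1)]) (simp_all add: \<sigma>(2)[unfolded f(2)])
qed

text \<open>This is \<open>Ext\<^sup>1(F / X, R / (x\<^sub>1, \<dots>, x\<^sub>i)) = 0\<close>, where \<open>F\<close> is the free module containing \<open>\<lambda>\<Omega>\<^sup>n k\<close>.\<close>

lemma extension_mod_regular_sequence:
  assumes n: "n = Suc n'" and xs: "regular_sequence R xs" and i: "i \<le> n'" "i \<le> length xs"
    and I: "I = Idl (set (take i xs))"
    and \<psi>: "\<psi> \<in> vecs (c 1)" "transpose_map R (c 2) (c 1) (q 1) \<psi> \<in> ideal_vecs R I (c 2)"
  shows "\<exists>\<theta>\<in>vecs (c 0). \<exists>u\<in>ideal_vecs R I (c 1).
    \<psi> = transpose_map R (c 1) (c 0) (q 0) \<theta> \<oplus>\<^bsub>V (c 1)\<^esub> u"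
proof -
  interpret S: regular_seq R xs by unfold_locales (rule xs)
  have I_eq: "I = S.seq_ideal i" by (simp add: I S.seq_ideal_def)
  have id: "ideal I R" unfolding I_eq by (rule S.seq_ideal_ideal)
  have q0: "q 0 \<in> lin (c 1) (c 0)"
    and q1: "q 1 \<in> lin (c 2) (c 1)"
    using q_hom[of 0] q_hom[of 1] by (simp_all add: numeral_2_eq_2)
  obtain r' where r': "r' \<in> lin (b n) (c 1)"
    "\<And>u. u \<in> vecs (b n) \<Longrightarrow> q 0 (r' u) = r u"
    by (rule r_lift) blast
  \<comment> \<open>Hence \<open>\<psi>\<close> induces a homomorphism from X to R/I.\<close>
  have cocycle: "dot R (c 1) \<psi> v \<in> I"
    if v: "v \<in> vecs (c 1)" "q 0 v = \<zero>\<^bsub>V (c 0)\<^esub>" for v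
  proof -
    obtain z where z: "z \<in> vecs (c 2)" "v = q 1 z"
      using q_kernel[of v 0] v by (auto simp: numeral_2_eq_2)
    then have "dot R (c 1) \<psi> v = dot R (c 2) z (transpose_map R (c 2) (c 1) (q 1) \<psi>)"
      using \<psi> q1 by (simp add: dot_transpose[symmetric] dot_comm[of _ "c 2" z])
    then show ?thesis using dot_in_ideal[OF id \<psi>(2) z(1)] by simp
  qed
  \<comment> \<open>The induced homomorphism composed with the projection onto X, as a functional on
    the dual of F_n, that is, as a vector of F_n. It kills the image of \<open>D n'\<close> modulo
    \<open>I\<close>, so it is a cycle of F modulo \<open>I\<close>.\<close>
  define w where "w = transpose_map R (b n) (c 1) r' \<psi>"
  have w: "w \<in> vecs (b n)" using r'(1) \<psi>(1) by (simp add: w_def)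
  have r'c: "r' u \<in> vecs (c 1)" if "u \<in> vecs (b n)" for u
    using that by (rule mod_hom_closed[OF r'(1)])
  have "d n' w \<in> ideal_vecs R I (b n')"
  proof (rule ideal_vecs_dotI)
    show "d n' w \<in> vecs (b n')" using w n by (simp add: d_closed)
    fix u assume u: "u \<in> vecs (b n')"
    have Du: "D n' u \<in> vecs (b n)" using D_closed[OF u] n by simp
    have "dot R (b n') (d n' w) u = dot R (b n) w (D n' u)"
      using u w n by (simp add: dot_comm[of _ "b n'" u] dot_comm[of w] d_closed D_closed dot_D)
    also have "\<dots> = dot R (c 1) \<psi> (r' (D n' u))"
      unfolding w_def by (rule dot_transpose[OF r'(1) \<psi>(1) Du])
    also have "\<dots> \<in> I"
      using Du D_D[OF u] n by (intro cocycle r'c) (simp_all add: r'(2) r_zero c_0)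
    finally show "dot R (b n') (d n' w) u \<in> I" .
  qed
  \<comment> \<open>This is Tor_n(k, R/(x_1, ..., x_i)) = 0, valid because \<open>i\<close> < n. The
    vector \<open>v\<close> is a functional on the ambient free module that extends the homomorphism
    from X to R/I.\<close>
  then obtain v u0 where v: "v \<in> vecs (c 0)" and u0: "u0 \<in> ideal_vecs R I (b n)"
    and w_eq: "w = d n v \<oplus>\<^bsub>V (b n)\<^esub> u0"
    using S.exact_mod_regular_sequence[where a = b and q = d and J = n and i = i and j = n' and v = w]
      d_hom d_d d_exact i w n unfolding I_eq c_0 by auto
  define \<theta> where "\<theta> = transpose_map R (c 1) (c 0) (q 0) v"
  have \<theta>: "\<theta> \<in> vecs (c 1)" using v q0 by (simp add: \<theta>_def)
  have "\<psi> \<ominus>\<^bsub>V (c 1)\<^esub> \<theta> \<in> ideal_vecs R I (c 1)"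
  proof (rule ideal_vecs_dotI)
    fix x assume x: "x \<in> vecs (c 1)"
    obtain z where z: "z \<in> vecs (b n)" "q 0 x = D n z"
      using image_subset x by blast
    have rz: "r z = q 0 x" using r_id[OF z(1)] x by (simp add: z(2)[symmetric])
    have q0x: "q 0 x \<in> vecs (c 0)" by (rule mod_hom_closed[OF q0 x])
    \<comment> \<open>\<open>x\<close> is split into \<open>r' z\<close>, where
      \<open>\<psi>\<close> is computed through \<open>w\<close>, and a vector \<open>y\<close> in
      the kernel of \<open>q 0\<close>, where \<open>\<psi>\<close> takes values in
      \<open>I\<close>.\<close>
    define y where "y = x \<ominus>\<^bsub>V (c 1)\<^esub> r' z"
    have y: "y \<in> vecs (c 1)" using x r'c[OF z(1)] by (simp add: y_def)
    have "q 0 y = q 0 x \<ominus>\<^bsub>V (c 0)\<^esub> q 0 x"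
      unfolding y_def mod_hom_diff[OF q0 module_free_mod module_free_mod x r'c[OF z(1)]]
      by (simp add: r'(2)[OF z(1)] rz)
    then have "q 0 y = \<zero>\<^bsub>V (c 0)\<^esub>" using q0x by (simp add: a_minus_def V.r_neg)
    then have yI: "dot R (c 1) \<psi> y \<in> I" using y by (intro cocycle)
    have u0z: "dot R (b n) u0 z \<in> I"
      using dot_in_ideal[OF id u0 z(1)] ideal_vecs_carrier[OF u0] z(1) by (simp add: dot_comm)
    have "x = y \<oplus>\<^bsub>V (c 1)\<^esub> r' z"
      using x r'c[OF z(1)] by (simp add: y_def a_minus_def V.a_assoc V.l_neg)
    then have "dot R (c 1) \<psi> x = dot R (c 1) \<psi> y \<oplus> dot R (c 1) \<psi> (r' z)"
      using dot_add[OF \<psi>(1) y r'c[OF z(1)]] by simp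
    also have "dot R (c 1) \<psi> (r' z) = dot R (b n) w z"
      unfolding w_def using dot_transpose[OF r'(1) \<psi>(1) z(1)] by simp
    also have "\<dots> = dot R (b n) (d n v) z \<oplus> dot R (b n) u0 z"
      unfolding w_eq using v z ideal_vecs_carrier[OF u0] by (simp add: dot_add_left d_closed c_0)
    also have "dot R (b n) (d n v) z = dot R (c 0) (D n z) v"
      using v z by (simp add: c_0 dot_D d_closed dot_comm[of _ "b n" z])
    also have "\<dots> = dot R (c 1) \<theta> x"
      unfolding \<theta>_def z(2)[symmetric] using v q0x dot_transpose[OF q0 v x] by (simp add: dot_comm)
    finally have e: "dot R (c 1) \<psi> x = dot R (c 1) \<psi> y \<oplus> (dot R (c 1) \<theta> x \<oplus> dot R (b n) u0 z)" .
    have "dot R (c 1) (\<psi> \<ominus>\<^bsub>V (c 1)\<^esub> \<theta>) x = dot R (c 1) x \<psi> \<ominus> dot R (c 1) x \<theta>"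
      using x \<psi>(1) \<theta> by (simp only: dot_comm[OF V.M.minus_closed[OF \<psi>(1) \<theta>] x] dot_diff)
    also have "\<dots> = dot R (c 1) \<psi> x \<ominus> dot R (c 1) \<theta> x"
      using x \<psi>(1) \<theta> by (simp add: dot_comm[of x])
    also have "\<dots> = dot R (c 1) \<psi> y \<oplus> dot R (b n) u0 z"
    proof -
      have "dot R (c 1) \<psi> y \<in> carrier R" "dot R (c 1) \<theta> x \<in> carrier R" "dot R (b n) u0 z \<in> carrier R"
        using \<psi>(1) y \<theta> x z ideal_vecs_carrier[OF u0] by auto
      then show ?thesis unfolding e a_minus_def by (simp add: a_ac r_neg1 r_neg)
    qed
    also have "\<dots> \<in> I" using yI u0z additive_subgroup.a_closed[OF ideal.axioms(1)[OF id]] by blast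
    finally show "dot R (c 1) (\<psi> \<ominus>\<^bsub>V (c 1)\<^esub> \<theta>) x \<in> I" .
  qed (use \<psi> \<theta> in auto)
  moreover have "\<psi> = \<theta> \<oplus>\<^bsub>V (c 1)\<^esub> (\<psi> \<ominus>\<^bsub>V (c 1)\<^esub> \<theta>)"
    using \<psi>(1) \<theta> by (simp add: a_minus_def V.M.a_ac V.r_neg V.M.r_neg1 V.M.r_neg2)
  ultimately show ?thesis using v unfolding \<theta>_def by blast
qed

text \<open>Let E be the cokernel of \<open>q 0\<close>. With \<open>c (Suc p)\<close> the last
  nonzero rank, \<open>q\<close> is a minimal resolution of E of length p + 1. The socle element
  bounds p + 1 by the length of the sequence, and up to that length Ext^j(E, R) vanishes for j >= 1.
  In degree p + 1 this contradicts minimality.\<close>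

lemma no_finite_resolution_if_small_depth:
  assumes xs: "regular_sequence R xs" "set xs \<subseteq> \<mm>" "length xs \<le> n"
    and y: "y \<in> carrier R" "y \<notin> Idl (set xs)" "\<And>x. x \<in> \<mm> \<Longrightarrow> x \<otimes> y \<in> Idl (set xs)"
    and fin: "\<And>j. p0 < j \<Longrightarrow> c (Suc j) = 0"
  shows False
proof -
  interpret S: regular_seq R xs by unfold_locales (rule xs)
  have "j \<le> p0" if "c (Suc j) \<noteq> 0" for j
    using that fin[of j] by (cases "p0 < j") auto
  then have "\<exists>p. c (Suc p) \<noteq> 0 \<and> (\<forall>j. c (Suc j) \<noteq> 0 \<longrightarrow> j \<le> p)"
    using nonzero
    by (intro ex_has_greatest_nat[of "\<lambda>p. c (Suc p) \<noteq> 0" 0 "\<lambda>p. p" "Suc p0"]) (auto simp: less_Suc_eq_le)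
  then obtain p where p1: "c (Suc p) \<noteq> 0" "\<And>j. c (Suc j) \<noteq> 0 \<Longrightarrow> j \<le> p"
    by auto
  have p: "c (Suc p) \<noteq> 0" "\<And>j. p < j \<Longrightarrow> c (Suc j) = 0"
    using p1(1) p1(2) leD by blast+
  let ?e = "unit_vec R (c (Suc p)) 0"
  have top: "v = \<zero>\<^bsub>V (c (Suc (Suc p)))\<^esub>" if "v \<in> vecs (c (Suc (Suc p)))" for v
    using zero_rank_0[OF p(2)[of "Suc p"] that] by simp
  \<comment> \<open>Otherwise Tor_(p+1)(E, R/(xs)) = 0. But \<open>y\<close> times a unit vector is
    a cycle modulo the sequence, as \<open>q p\<close> has entries in \<mm> and \<open>y\<close>
    multiplies \<mm> into the ideal. There are no boundaries in the top degree, so \<open>y\<close>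
    would lie in the ideal.\<close>
  have "p < length xs"
  proof (rule ccontr)
    assume "\<not> p < length xs"
    define t where "t = length xs"
    define v where "v = y \<odot>\<^bsub>V (c (Suc p))\<^esub> ?e"
    have v: "v \<in> vecs (c (Suc p))" using y by (simp add: v_def)
    have I: "S.seq_ideal t = Idl (set xs)" by (simp add: S.seq_ideal_def t_def)
    have ym: "y \<otimes> x \<in> Idl (set xs)" if "x \<in> \<mm>" for x
      using y(3)[OF that] by (simp only: m_comm[OF y(1) Icarr[OF that]])
    have qe: "q p ?e \<in> ideal_vecs R \<mm> (c p)" by (rule q_minimal) simp
    have "q p v = y \<odot>\<^bsub>V (c p)\<^esub> q p ?e"
      unfolding v_def by (rule mod_hom_smult[OF q_hom y(1)]) simp
    also have "\<dots> \<in> ideal_vecs R (S.seq_ideal t) (c p)"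
      using qe y(1) ym by (auto simp: ideal_vecs_def I)
    finally have "\<exists>w\<in>vecs (c (Suc (Suc p))). \<exists>u\<in>ideal_vecs R (S.seq_ideal t) (c (Suc p)).
        v = q (Suc p) w \<oplus>\<^bsub>V (c (Suc p))\<^esub> u"
      using v \<open>\<not> p < length xs\<close>
      by (intro S.exact_mod_regular_sequence[where J = "Suc p" and q = q and a = c])
        (auto simp: t_def q_hom q_q q_kernel)
    then have "v \<in> ideal_vecs R (S.seq_ideal t) (c (Suc p))"
      using top mod_hom_zero[OF q_hom module_free_mod module_free_mod] ideal_vecs_carrier by force
    then have "v 0 \<in> Idl (set xs)" using p(1) by (simp add: ideal_vecs_def I)
    then show False using p(1) y(1,2) by (simp add: v_def unit_vec_coord)
  qed
  \<comment> \<open>A nonempty sequence of length at most n makes n positive, which both the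
    homotopy on X and the vanishing of Ext^1 require.\<close>
  then obtain n' where n': "n = Suc n'" using xs(3) by (cases n) auto
  define \<delta> where "\<delta> j = transpose_map R (c (Suc j)) (c j) (q j)" for j
  have \<delta>_hom: "\<delta> j \<in> lin (c j) (c (Suc j))" for j
    unfolding \<delta>_def by (rule transpose_hom[OF q_hom])
  \<comment> \<open>The top unit vector is a cocycle because the next module is zero. Vanishing in
    degree p + 1 over R itself, the case \<open>i\<close> = 0, makes it a coboundary.\<close>
  have "\<exists>\<theta>\<in>vecs (c p). \<exists>u\<in>ideal_vecs R (S.seq_ideal 0) (c (Suc p)).
      ?e = \<delta> p \<theta> \<oplus>\<^bsub>V (c (Suc p))\<^esub> u"
  proof (rule S.coexact_mod_regular_sequence[where \<delta> = \<delta> and a = c and J = p and i = 0])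
    show "\<delta> (Suc j) (\<delta> j v) = \<zero>\<^bsub>V (c (Suc (Suc j)))\<^esub>" if v: "v \<in> vecs (c j)" for j v
    proof (rule free_mod_eq_dotI[of _ "c (Suc (Suc j))"])
      fix u assume u: "u \<in> vecs (c (Suc (Suc j)))"
      then show "dot R (c (Suc (Suc j))) (\<delta> (Suc j) (\<delta> j v)) u
          = dot R (c (Suc (Suc j))) \<zero>\<^bsub>V (c (Suc (Suc j)))\<^esub> u"
        using v mod_hom_closed[OF \<delta>_hom]
        by (simp add: \<delta>_def dot_transpose[OF q_hom] q_closed q_q dot_zero
            dot_comm[of "\<zero>\<^bsub>V (c (Suc (Suc j)))\<^esub>"])
    qed (use v mod_hom_closed[OF \<delta>_hom] in auto)
    fix i \<psi> assume "i < length xs" "\<psi> \<in> vecs (c 1)" "\<delta> 1 \<psi> \<in> ideal_vecs R (S.seq_ideal i) (c 2)"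
    then show "\<exists>\<theta>\<in>vecs (c 0). \<exists>u\<in>ideal_vecs R (S.seq_ideal i) (c 1).
        \<psi> = \<delta> 0 \<theta> \<oplus>\<^bsub>V (c 1)\<^esub> u"
      using extension_mod_regular_sequence[OF n' xs(1), of i "S.seq_ideal i" \<psi>] xs(3) n'
      by (simp add: \<delta>_def S.seq_ideal_def numeral_2_eq_2)
  next
    fix i j x \<psi> assume x: "x \<in> set xs" and \<psi>: "\<psi> \<in> vecs (c (Suc (Suc j)))"
      "\<delta> (Suc (Suc j)) \<psi> \<in> ideal_vecs R (S.seq_ideal i) (c (Suc (Suc (Suc j))))"
    have xm: "x \<in> \<mm>" using x xs by auto
    obtain \<sigma> where \<sigma>: "\<And>i. i \<le> Suc j \<Longrightarrow> \<sigma> i \<in> lin (c (Suc i)) (c (Suc (Suc i)))"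
      "\<And>i v. i < Suc j \<Longrightarrow> v \<in> vecs (c (Suc (Suc i))) \<Longrightarrow> x \<odot>\<^bsub>V (c (Suc (Suc i)))\<^esub> v
        = q (Suc (Suc i)) (\<sigma> (Suc i) v) \<oplus>\<^bsub>V (c (Suc (Suc i)))\<^esub> \<sigma> i (q (Suc i) v)"
      by (rule resolution_multiplication_homotopy[OF n' xm]) blast
    show "\<exists>\<theta>\<in>vecs (c (Suc j)). \<exists>u\<in>ideal_vecs R (S.seq_ideal i) (c (Suc (Suc j))).
        x \<odot>\<^bsub>V (c (Suc (Suc j)))\<^esub> \<psi> = \<delta> (Suc j) \<theta> \<oplus>\<^bsub>V (c (Suc (Suc j)))\<^esub> u"
      unfolding \<delta>_def using \<psi>
      by (intro smult_cocycle_coboundary[OF q_hom q_hom \<sigma>(1) \<sigma>(1)])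
        (auto simp: \<delta>_def \<sigma>(2)[of j] Icarr[OF xm] S.seq_ideal_ideal)
    next
    show "\<delta> (Suc p) ?e \<in> ideal_vecs R (S.seq_ideal 0) (c (Suc (Suc p)))"
      using top[OF mod_hom_closed[OF \<delta>_hom unit_vec_closed]] submodule_zero[OF submodule_ideal_vecs[OF S.seq_ideal_ideal]]
      by simp
  qed (use \<open>p < length xs\<close> \<delta>_hom in auto)
  then obtain \<theta> where \<theta>: "\<theta> \<in> vecs (c p)" "?e = \<delta> p \<theta>"
    using mod_hom_closed[OF \<delta>_hom] by (auto simp: S.seq_ideal_0 ideal_vecs_zero)
  \<comment> \<open>The pairing of the unit vector with itself is 1, while adjunction rewrites it as
    a pairing with \<open>q p ?e\<close>, which has coordinates in \<mm>.\<close>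
  have "dot R (c (Suc p)) (\<delta> p \<theta>) ?e = dot R (c p) \<theta> (q p ?e)"
    unfolding \<delta>_def by (rule dot_transpose[OF q_hom \<theta>(1) unit_vec_closed])
  also have "\<dots> \<in> \<mm>"
    by (rule dot_in_ideal[OF is_ideal q_minimal[OF unit_vec_closed] \<theta>(1)])
  finally have "dot R (c (Suc p)) ?e ?e \<in> \<mm>" using \<theta>(2) by simp
  then show False
    using p(1) one_notin_maximal by (simp add: unit_vec_coord)
qed

end

section \<open>Uniqueness of minimal covers\<close>

context noetherian_local_ring
begin

text \<open>Nakayama's lemma by elimination: the error terms in \<open>ideal_vecs R \<mm> a\<close>
  are cleared one coordinate at a time. \<open>W k\<close> holds the errors supported on the first
  \<open>k\<close> coordinates.\<close>

lemma nakayama_free_mod: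
  assumes N: "submodule N R (V a)"
    and cover: "\<And>x. x \<in> vecs a \<Longrightarrow>
      \<exists>y\<in>N. \<exists>w\<in>ideal_vecs R \<mm> a. x = y \<oplus>\<^bsub>V a\<^esub> w"
  shows "N = vecs a"
proof -
  let ?V = "V a"
  note NE = V.submoduleE[OF N]
  define W where "W k = {v \<in> ideal_vecs R \<mm> a. \<forall>i<a. k \<le> i \<longrightarrow> v i = \<zero>}" for k
  have W_add: "u \<oplus>\<^bsub>?V\<^esub> v \<in> W k" if "u \<in> W k" "v \<in> W k" for u v k
    using that by (auto simp: W_def ideal_vecs_add[OF is_ideal])
  have W_smult: "s \<odot>\<^bsub>?V\<^esub> v \<in> W k" if "s \<in> carrier R" "v \<in> W k" for s v k
    using that V.submoduleE(4)[OF submodule_ideal_vecs[OF is_ideal]] by (auto simp: W_def)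
  have W_carrier: "w \<in> carrier ?V" if "w \<in> W k" for w k
    using that by (auto simp: W_def intro: ideal_vecs_carrier)
  have split: "\<exists>w'\<in>W k. w = w k \<odot>\<^bsub>?V\<^esub> unit_vec R a k \<oplus>\<^bsub>?V\<^esub> w'"
    if k: "k < a" and w: "w \<in> W (Suc k)" for w k
  proof -
    define w' where "w' = (\<lambda>i\<in>{..<a}. if i = k then \<zero> else w i)"
    have wc: "w \<in> carrier ?V" using w by (rule W_carrier)
    have w': "w' \<in> W k"
      using w wc by (auto simp: W_def w'_def ideal_vecs_def carrier_free_mod PiE_iff)
    have "w = w k \<odot>\<^bsub>?V\<^esub> unit_vec R a k \<oplus>\<^bsub>?V\<^esub> w'"
    proof (rule free_mod_eqI[of _ R a])
      show "w k \<odot>\<^bsub>?V\<^esub> unit_vec R a k \<oplus>\<^bsub>?V\<^esub> w' \<in> carrier ?V"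
        using W_carrier[OF w'] wc k by simp
      show "w i = (w k \<odot>\<^bsub>?V\<^esub> unit_vec R a k \<oplus>\<^bsub>?V\<^esub> w') i" if "i < a" for i
        using that wc k by (simp add: unit_vec_coord w'_def)
    qed (rule wc)
    with w' show ?thesis by blast
  qed
  \<comment> \<open>The induction lowers the support of the errors from \<open>a\<close> to 0, where
    they vanish.\<close>
  have "\<forall>x\<in>carrier ?V. \<exists>y\<in>N. \<exists>w\<in>W (a - k). x = y \<oplus>\<^bsub>?V\<^esub> w" for k
  proof (induction k)
    case 0
    have "W (a - 0) = ideal_vecs R \<mm> a" by (auto simp: W_def)
    then show ?case using cover by auto
  next
    case (Suc k)
    show ?case
    proof (cases "k < a")
      case False
      then show ?thesis using Suc.IH by simp
    next
      case True
      define l where "l = a - Suc k"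
      have l: "l < a" "a - k = Suc l" using True by (auto simp: l_def)
      let ?e = "unit_vec R a l"
      obtain y w where y: "y \<in> N" "w \<in> W (Suc l)" and e: "?e = y \<oplus>\<^bsub>?V\<^esub> w"
        using Suc.IH l(2) unit_vec_closed by metis
      obtain w' where w': "w' \<in> W l" and w_eq: "w = w l \<odot>\<^bsub>?V\<^esub> ?e \<oplus>\<^bsub>?V\<^esub> w'"
        using split[OF l(1) y(2)] by blast
      have yc: "y \<in> carrier ?V" "w \<in> carrier ?V" "w' \<in> carrier ?V"
        using y w' NE(1) W_carrier by auto
      have wl: "w l \<in> \<mm>" "w l \<in> carrier R" using y(2) l yc by (auto simp: W_def ideal_vecs_def)
      \<comment> \<open>The error of the unit vector \<open>?e\<close> contains \<open>?e\<close>
        itself with a coefficient in \<mm>. Moving that term to the left leaves the unit 1 -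
        \<open>w l\<close>, so \<open>?e\<close> has an error in \<open>W l\<close>; substituting
        this clears coordinate \<open>l\<close> from every other error.\<close>
      have "\<one> \<ominus> w l \<notin> \<mm>"
      proof
        assume "\<one> \<ominus> w l \<in> \<mm>"
        then have "(\<one> \<ominus> w l) \<oplus> w l \<in> \<mm>" using wl by simp
        then show False using wl one_notin_maximal by (simp add: a_minus_def a_assoc l_neg)
      qed
      then obtain u where u: "u \<in> carrier R" "u \<otimes> (\<one> \<ominus> w l) = \<one>"
        using unit_if_notin_maximal[of "\<one> \<ominus> w l"] wl by auto
      have "(\<one> \<ominus> w l) \<odot>\<^bsub>?V\<^esub> ?e = y \<oplus>\<^bsub>?V\<^esub> w'"
      proof -
        define E where "E = w l \<odot>\<^bsub>?V\<^esub> ?e"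
        have E: "E \<in> carrier ?V" using wl by (simp add: E_def)
        have "?e = y \<oplus>\<^bsub>?V\<^esub> (E \<oplus>\<^bsub>?V\<^esub> w')"
          unfolding E_def w_eq[symmetric] by (rule e)
        also have "\<dots> = y \<oplus>\<^bsub>?V\<^esub> w' \<oplus>\<^bsub>?V\<^esub> E"
          using E yc by (simp add: V.M.a_ac)
        finally have e': "?e = y \<oplus>\<^bsub>?V\<^esub> w' \<oplus>\<^bsub>?V\<^esub> E" .
        have "(\<one> \<ominus> w l) \<odot>\<^bsub>?V\<^esub> ?e = ?e \<oplus>\<^bsub>?V\<^esub> \<ominus>\<^bsub>?V\<^esub> E"
          using wl by (simp add: E_def a_minus_def V.smult_l_distr V.smult_l_minus)
        also have "?e \<oplus>\<^bsub>?V\<^esub> \<ominus>\<^bsub>?V\<^esub> E = y \<oplus>\<^bsub>?V\<^esub> w'"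
          unfolding e' using E yc by (simp add: V.M.a_assoc V.r_neg)
        finally show ?thesis .
      qed
      then have "u \<odot>\<^bsub>?V\<^esub> ((\<one> \<ominus> w l) \<odot>\<^bsub>?V\<^esub> ?e) = u \<odot>\<^bsub>?V\<^esub> y \<oplus>\<^bsub>?V\<^esub> u \<odot>\<^bsub>?V\<^esub> w'"
        using u yc by (simp add: V.smult_r_distr)
      then have e_eq: "?e = u \<odot>\<^bsub>?V\<^esub> y \<oplus>\<^bsub>?V\<^esub> u \<odot>\<^bsub>?V\<^esub> w'"
        using u wl by (simp add: V.smult_assoc1[symmetric])
      show ?thesis
      proof
        fix x assume "x \<in> carrier ?V"
        then obtain y1 w1 where y1: "y1 \<in> N" "w1 \<in> W (Suc l)" "x = y1 \<oplus>\<^bsub>?V\<^esub> w1"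
          using Suc.IH l(2) by auto
        obtain w1' where w1': "w1' \<in> W l" "w1 = w1 l \<odot>\<^bsub>?V\<^esub> ?e \<oplus>\<^bsub>?V\<^esub> w1'"
          using split[OF l(1) y1(2)] by blast
        define s where "s = w1 l"
        have s: "s \<in> carrier R" using W_carrier[OF y1(2)] l by (simp add: s_def)
        have cc: "y1 \<in> carrier ?V" "w1' \<in> carrier ?V" using y1 w1' NE(1) W_carrier by auto
        have "x = y1 \<oplus>\<^bsub>?V\<^esub> (s \<odot>\<^bsub>?V\<^esub> ?e \<oplus>\<^bsub>?V\<^esub> w1')"
          unfolding y1(3) s_def using w1'(2) by simp
        also have "s \<odot>\<^bsub>?V\<^esub> ?e = s \<odot>\<^bsub>?V\<^esub> (u \<odot>\<^bsub>?V\<^esub> y) \<oplus>\<^bsub>?V\<^esub> s \<odot>\<^bsub>?V\<^esub> (u \<odot>\<^bsub>?V\<^esub> w')"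
          by (subst e_eq) (use s u yc in \<open>simp add: V.smult_r_distr\<close>)
        finally have "x = (y1 \<oplus>\<^bsub>?V\<^esub> s \<odot>\<^bsub>?V\<^esub> (u \<odot>\<^bsub>?V\<^esub> y)) \<oplus>\<^bsub>?V\<^esub> (s \<odot>\<^bsub>?V\<^esub> (u \<odot>\<^bsub>?V\<^esub> w') \<oplus>\<^bsub>?V\<^esub> w1')"
          using s u yc cc by (simp add: V.M.a_assoc)
        moreover have "y1 \<oplus>\<^bsub>?V\<^esub> s \<odot>\<^bsub>?V\<^esub> (u \<odot>\<^bsub>?V\<^esub> y) \<in> N"
          using y1 y s u NE(4,5) by blast
        moreover have "s \<odot>\<^bsub>?V\<^esub> (u \<odot>\<^bsub>?V\<^esub> w') \<oplus>\<^bsub>?V\<^esub> w1' \<in> W l"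
          using s u w' w1' by (intro W_add W_smult)
        ultimately show "\<exists>y\<in>N. \<exists>w\<in>W (a - Suc k). x = y \<oplus>\<^bsub>?V\<^esub> w"
          unfolding l_def[symmetric] by blast
      qed
    qed
  qed
  from this[of a] have "\<forall>x\<in>carrier ?V. \<exists>y\<in>N. \<exists>w\<in>W 0. x = y \<oplus>\<^bsub>?V\<^esub> w" by simp
  moreover have "w = \<zero>\<^bsub>?V\<^esub>" if "w \<in> W 0" for w
    using that W_carrier[OF that] by (intro free_mod_eqI[of _ R a]) (auto simp: W_def)
  ultimately have "carrier ?V \<subseteq> N" using NE(1) by force
  then show ?thesis using NE(1) by blast
qed

text \<open>Nakayama gives surjectivity. A linear section \<open>s\<close> of \<open>f\<close> is
  again the identity modulo \<mm>, so it is surjective as well, which makes \<open>f\<close>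
  injective.\<close>

lemma bij_if_congruent_id:
  assumes f: "f \<in> lin a a"
    and cong: "\<And>x. x \<in> vecs a \<Longrightarrow> f x \<ominus>\<^bsub>V a\<^esub> x \<in> ideal_vecs R \<mm> a"
  shows "bij_betw f (vecs a) (vecs a)"
proof -
  let ?V = "V a"
  have surj: "g ` carrier ?V = carrier ?V"
    if g: "g \<in> mod_hom R ?V ?V" and cong: "\<And>x. x \<in> carrier ?V \<Longrightarrow> g x \<ominus>\<^bsub>?V\<^esub> x \<in> ideal_vecs R \<mm> a" for g
  proof (rule nakayama_free_mod)
    show "submodule (g ` carrier ?V) R ?V"
      by (rule mod_hom_image_submodule[OF g module_free_mod module_free_mod V.carrier_is_submodule])
    fix x assume x: "x \<in> carrier ?V"
    have "x = g x \<oplus>\<^bsub>?V\<^esub> \<ominus>\<^bsub>?V\<^esub> (g x \<ominus>\<^bsub>?V\<^esub> x)"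
      using x mod_hom_closed[OF g x] by (intro free_mod_eqI[of _ R a]) (simp_all add: a_minus_def minus_add r_neg2 r_neg1)
    then show "\<exists>y\<in>g ` carrier ?V. \<exists>w\<in>ideal_vecs R \<mm> a. x = y \<oplus>\<^bsub>?V\<^esub> w"
      using x ideal_vecs_neg[OF is_ideal cong[OF x]] by blast
  qed
  obtain s where s: "s \<in> mod_hom R ?V ?V" "\<And>x. x \<in> carrier ?V \<Longrightarrow> f (s x) = x"
    by (rule free_mod_lift[OF module_free_mod module_free_mod mod_hom_id f])
      (use surj[OF f cong] in auto)
  have sc: "s x \<in> carrier ?V" if "x \<in> carrier ?V" for x using that by (rule mod_hom_closed[OF s(1)])
  have "s ` carrier ?V = carrier ?V"
  proof (rule surj[OF s(1)])
    fix x assume x: "x \<in> carrier ?V"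
    have "\<ominus>\<^bsub>?V\<^esub> (x \<ominus>\<^bsub>?V\<^esub> s x) \<in> ideal_vecs R \<mm> a"
      using cong[OF sc[OF x]] s(2)[OF x] by (intro ideal_vecs_neg is_ideal) simp
    moreover have "\<ominus>\<^bsub>?V\<^esub> (x \<ominus>\<^bsub>?V\<^esub> s x) = s x \<ominus>\<^bsub>?V\<^esub> x"
      using x sc[OF x] by (simp add: a_minus_def V.M.minus_add V.M.a_comm)
    ultimately show "s x \<ominus>\<^bsub>?V\<^esub> x \<in> ideal_vecs R \<mm> a" by simp
  qed
  then have "inj_on f (carrier ?V)"
    using s(2) by (metis (no_types, lifting) imageE inj_onI)
  then show ?thesis using surj[OF f cong] by (simp add: bij_betw_def)
qed

text \<open>Lift each cover through the other. Both composites move a vector only by a kernel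
  element, so they are the identity modulo \<mm> and bijective. Thus the first syzygy does not
  depend on the minimal cover.\<close>

lemma minimal_cover_unique:
  assumes M: "module R M"
    and e: "e \<in> mod_hom R (V a) M" "e ` vecs a = carrier M"
      "a_kernel (V a) M e \<subseteq> ideal_vecs R \<mm> a"
    and e': "e' \<in> mod_hom R (V a') M" "e' ` vecs a' = carrier M"
      "a_kernel (V a') M e' \<subseteq> ideal_vecs R \<mm> a'"
  obtains h where "h \<in> lin a a'"
    "inj_on h (vecs a)"
    "h ` a_kernel (V a) M e = a_kernel (V a') M e'"
proof -
  interpret M: module R M by fact
  obtain h where h: "h \<in> lin a a'"
      "\<And>x. x \<in> vecs a \<Longrightarrow> e' (h x) = e x"
    by (rule free_mod_lift[OF module_free_mod M e(1) e'(1)]) (use mod_hom_closed[OF e(1)] e'(2) in auto)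
  obtain g where g: "g \<in> lin a' a"
      "\<And>x. x \<in> vecs a' \<Longrightarrow> e (g x) = e' x"
    by (rule free_mod_lift[OF module_free_mod M e'(1) e(1)]) (use mod_hom_closed[OF e'(1)] e(2) in auto)
  have bij: "bij_betw k (vecs m) (vecs m)"
    if k: "k \<in> lin m m"
      and \<epsilon>: "\<epsilon> \<in> mod_hom R (V m) M" "a_kernel (V m) M \<epsilon> \<subseteq> ideal_vecs R \<mm> m"
      and k\<epsilon>: "\<And>x. x \<in> vecs m \<Longrightarrow> \<epsilon> (k x) = \<epsilon> x" for k m \<epsilon>
  proof (rule bij_if_congruent_id[OF k])
    fix x assume x: "x \<in> vecs m"
    have kx: "k x \<in> vecs m" by (rule mod_hom_closed[OF k x])
    have "\<epsilon> (k x \<ominus>\<^bsub>V m\<^esub> x) = \<zero>\<^bsub>M\<^esub>"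
      using mod_hom_diff[OF \<epsilon>(1) module_free_mod M kx x] k\<epsilon>[OF x] mod_hom_closed[OF \<epsilon>(1) x]
      by (simp add: a_minus_def M.M.r_neg)
    then show "k x \<ominus>\<^bsub>V m\<^esub> x \<in> ideal_vecs R \<mm> m"
      using \<epsilon>(2) kx x by (auto simp: a_kernel_def')
  qed
  have gh: "bij_betw (\<lambda>x. g (h x)) (vecs a) (vecs a)"
    using mod_hom_closed[OF h(1)]
    by (intro bij[OF mod_hom_comp[OF h(1) g(1)] e(1,3)]) (simp add: g(2) h(2))
  have hg: "bij_betw (\<lambda>x. h (g x)) (vecs a') (vecs a')"
    using mod_hom_closed[OF g(1)]
    by (intro bij[OF mod_hom_comp[OF g(1) h(1)] e'(1,3)]) (simp add: g(2) h(2))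
  have "inj_on h (vecs a)"
    using gh by (auto simp: bij_betw_def inj_on_def)
  moreover have "h ` a_kernel (V a) M e = a_kernel (V a') M e'"
  proof
    show "h ` a_kernel (V a) M e \<subseteq> a_kernel (V a') M e'"
      using h(2) mod_hom_closed[OF h(1)] by (auto simp: a_kernel_def')
    show "a_kernel (V a') M e' \<subseteq> h ` a_kernel (V a) M e"
    proof
      fix y assume y: "y \<in> a_kernel (V a') M e'"
      then obtain z where z: "z \<in> vecs a'" "y = h (g z)"
        using hg by (auto simp: a_kernel_def' bij_betw_def image_iff)
      have gz: "g z \<in> vecs a" by (rule mod_hom_closed[OF g(1) z(1)])
      have "e (g z) = \<zero>\<^bsub>M\<^esub>" using y z(2) h(2)[OF gz] by (simp add: a_kernel_def')
      then show "y \<in> h ` a_kernel (V a) M e"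
        using z gz by (auto simp: a_kernel_def')
    qed
  qed
  ultimately show ?thesis using that h(1) by blast
qed

end

section \<open>Quotient modules and duals\<close>

lemma quot_mod_projection:
  assumes M: "module R M" and N: "submodule N R M"
  shows "(\<lambda>x. N +>\<^bsub>M\<^esub> x) \<in> mod_hom R M (quot_mod M N)"
    and "(\<lambda>x. N +>\<^bsub>M\<^esub> x) ` carrier M = carrier (quot_mod M N)"
    and "a_kernel M (quot_mod M N) (\<lambda>x. N +>\<^bsub>M\<^esub> x) = N"
proof -
  interpret M: module R M by fact
  note NE = M.submoduleE[OF N]
  interpret N: abelian_subgroup N M
    using submodule.axioms(1)[OF N] by (intro abelian_subgroupI3 additive_subgroup.intro M.M.abelian_group_axioms)
  \<comment> \<open>Scalar multiplication in \<open>quot_mod\<close> is a union of cosets over all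
    representatives; these cosets coincide, and there is at least one.\<close>
  have sm: "a \<odot>\<^bsub>quot_mod M N\<^esub> (N +>\<^bsub>M\<^esub> x) = N +>\<^bsub>M\<^esub> (a \<odot>\<^bsub>M\<^esub> x)"
    if a: "a \<in> carrier R" and x: "x \<in> carrier M" for a x
  proof -
    have "N +>\<^bsub>M\<^esub> (a \<odot>\<^bsub>M\<^esub> y) = N +>\<^bsub>M\<^esub> (a \<odot>\<^bsub>M\<^esub> x)" if y: "y \<in> N +>\<^bsub>M\<^esub> x" for y
    proof -
      obtain h where h: "h \<in> N" "y = h \<oplus>\<^bsub>M\<^esub> x" using y by (auto simp: a_r_coset_def')
      then have "a \<odot>\<^bsub>M\<^esub> y = a \<odot>\<^bsub>M\<^esub> h \<oplus>\<^bsub>M\<^esub> a \<odot>\<^bsub>M\<^esub> x"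
        using a x NE(1) by (auto simp: M.smult_r_distr)
      then have "a \<odot>\<^bsub>M\<^esub> y \<in> N +>\<^bsub>M\<^esub> (a \<odot>\<^bsub>M\<^esub> x)"
        using NE(4)[OF a h(1)] by (auto simp: a_r_coset_def')
      then show ?thesis using a x by (intro N.a_repr_independence'[symmetric]) auto
    qed
    then have "(\<Union>y\<in>N +>\<^bsub>M\<^esub> x. N +>\<^bsub>M\<^esub> (a \<odot>\<^bsub>M\<^esub> y)) = (\<Union>y\<in>N +>\<^bsub>M\<^esub> x. N +>\<^bsub>M\<^esub> (a \<odot>\<^bsub>M\<^esub> x))"
      by (rule SUP_cong[OF refl])
    moreover have "N +>\<^bsub>M\<^esub> x \<noteq> {}" using N.a_rcos_self[OF x] by blast
    ultimately show ?thesis by (simp add: quot_mod_def UN_constant)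
  qed
  show "(\<lambda>x. N +>\<^bsub>M\<^esub> x) \<in> mod_hom R M (quot_mod M N)"
  proof (rule mod_homI)
    show "N +>\<^bsub>M\<^esub> x \<in> carrier (quot_mod M N)" if "x \<in> carrier M" for x
      using that by (auto simp: quot_mod_def A_RCOSETS_def')
    show "N +>\<^bsub>M\<^esub> (x \<oplus>\<^bsub>M\<^esub> y) = (N +>\<^bsub>M\<^esub> x) \<oplus>\<^bsub>quot_mod M N\<^esub> (N +>\<^bsub>M\<^esub> y)"
      if "x \<in> carrier M" "y \<in> carrier M" for x y
      using that N.a_rcos_sum by (simp add: quot_mod_def)
  qed (simp add: sm)
  show "(\<lambda>x. N +>\<^bsub>M\<^esub> x) ` carrier M = carrier (quot_mod M N)"
    by (auto simp: quot_mod_def A_RCOSETS_def')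
  have "N +>\<^bsub>M\<^esub> x = N \<longleftrightarrow> x \<in> N" if "x \<in> carrier M" for x
    using N.a_rcos_const N.a_rcos_self[OF that] by auto
  then show "a_kernel M (quot_mod M N) (\<lambda>x. N +>\<^bsub>M\<^esub> x) = N"
    using NE(1) by (auto simp: a_kernel_def' quot_mod_def)
qed

section \<open>Self-duality of free modules and the cokernel of a dual map\<close>

context cring
begin

text \<open>The isomorphism of R^n with its dual; the restriction makes its values extensional, as
  \<open>hom_mod\<close> demands.\<close>

definition functional :: "nat \<Rightarrow> (nat \<Rightarrow> 'a) \<Rightarrow> ((nat \<Rightarrow> 'a) \<Rightarrow> 'a)" where
  "functional n w = restrict (dot R n w) (vecs n)"

lemma functional_surj: "functional n ` vecs n = carrier (dual_mod R (V n))"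
proof
  show "functional n ` vecs n \<subseteq> carrier (dual_mod R (V n))"
  proof
    fix \<phi> assume "\<phi> \<in> functional n ` vecs n"
    then obtain w where w: "w \<in> vecs n" "\<phi> = functional n w" by blast
    have "functional n w \<in> mod_hom R (V n) (regular_module R)"
      using w(1) by (intro mod_homI) (auto simp: functional_def dot_add dot_smult)
    then show "\<phi> \<in> carrier (dual_mod R (V n))"
      by (simp add: w(2) dual_mod_def hom_mod_def functional_def)
  qed
  show "carrier (dual_mod R (V n)) \<subseteq> functional n ` vecs n"
  proof
    fix \<phi> assume "\<phi> \<in> carrier (dual_mod R (V n))"
    then have \<phi>: "\<phi> \<in> mod_hom R (V n) (regular_module R)" "\<phi> \<in> extensional (vecs n)"
      by (auto simp: dual_mod_def hom_mod_def)
    define w where "w = (\<lambda>i\<in>{..<n}. \<phi> (unit_vec R n i))"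
    have w: "w \<in> vecs n"
      using mod_hom_closed[OF \<phi>(1) unit_vec_closed] by (auto simp: w_def carrier_free_mod[of R n])
    have "dot R n w v = \<phi> v" if "v \<in> vecs n" for v
      using hom_free_eqI[OF module_regular[OF is_cring] dot_hom[OF w] \<phi>(1) _ that] w
      by (simp add: w_def)
    then have "\<phi> = functional n w"
      using \<phi>(2) by (auto simp: functional_def extensional_def)
    with w show "\<phi> \<in> functional n ` vecs n" by blast
  qed
qed

lemma functional_closed: "v \<in> vecs n \<Longrightarrow> functional n v \<in> carrier (dual_mod R (V n))"
  using functional_surj by blast

lemma functional_inj: "inj_on (functional n) (vecs n)"
proof (rule inj_onI)
  fix u v assume uv: "u \<in> vecs n" "v \<in> vecs n" "functional n u = functional n v"
  show "u = v"
    using uv(1,2)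
  proof (rule free_mod_eq_dotI)
    fix w assume "w \<in> vecs n"
    then show "dot R n u w = dot R n v w"
      using fun_cong[OF uv(3), of w] by (simp add: functional_def)
  qed
qed

lemma functional_add:
  "u \<in> vecs n \<Longrightarrow> v \<in> vecs n \<Longrightarrow>
    functional n (u \<oplus>\<^bsub>V n\<^esub> v) = functional n u \<oplus>\<^bsub>dual_mod R (V n)\<^esub> functional n v"
  by (auto simp: functional_def dual_mod_def hom_mod_def dot_add_left)

lemma functional_smult:
  "a \<in> carrier R \<Longrightarrow> v \<in> vecs n \<Longrightarrow>
    functional n (a \<odot>\<^bsub>V n\<^esub> v) = a \<odot>\<^bsub>dual_mod R (V n)\<^esub> functional n v"
  by (auto simp: functional_def dual_mod_def hom_mod_def dot_smult_left)

lemma functional_zero: "functional n \<zero>\<^bsub>V n\<^esub> = \<zero>\<^bsub>dual_mod R (V n)\<^esub>"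
proof -
  have "dot R n \<zero>\<^bsub>V n\<^esub> v = \<zero>" if "v \<in> vecs n" for v
    using dot_smult_left[OF that zero_closed, of "\<zero>\<^bsub>V n\<^esub>"] that by simp
  then show ?thesis by (auto simp: functional_def dual_mod_def hom_mod_def)
qed

lemma functional_hom: "functional n \<in> mod_hom R (V n) (dual_mod R (V n))"
  by (intro mod_homI functional_closed functional_add functional_smult)

lemma module_dual_free_mod: "module R (dual_mod R (V n))"
proof -
  let ?M = "dual_mod R (V n)"
  have rep: "\<exists>v\<in>vecs n. x = functional n v" if "x \<in> carrier ?M" for x
    using that functional_surj by blast
  note cl = functional_closed
  note simps = functional_add[symmetric] functional_smult[symmetric] functional_zero[symmetric]
  show ?thesis
  proof (rule moduleI)
    show "abelian_group ?M"
    proof (rule abelian_groupI)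
      fix x y z assume xyz: "x \<in> carrier ?M" "y \<in> carrier ?M" "z \<in> carrier ?M"
      obtain u where "u \<in> vecs n" "x = functional n u" using rep[OF xyz(1)] by blast
      moreover obtain v where "v \<in> vecs n" "y = functional n v" using rep[OF xyz(2)] by blast
      moreover obtain w where "w \<in> vecs n" "z = functional n w" using rep[OF xyz(3)] by blast
      ultimately show "x \<oplus>\<^bsub>?M\<^esub> y \<oplus>\<^bsub>?M\<^esub> z = x \<oplus>\<^bsub>?M\<^esub> (y \<oplus>\<^bsub>?M\<^esub> z)"
        by (simp add: simps V.a_assoc)
    next
      fix x y assume xy: "x \<in> carrier ?M" "y \<in> carrier ?M"
      obtain u where "u \<in> vecs n" "x = functional n u" using rep[OF xy(1)] by blast
      moreover obtain v where "v \<in> vecs n" "y = functional n v" using rep[OF xy(2)] by blast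
      ultimately show "x \<oplus>\<^bsub>?M\<^esub> y \<in> carrier ?M" "x \<oplus>\<^bsub>?M\<^esub> y = y \<oplus>\<^bsub>?M\<^esub> x"
        by (simp_all add: simps cl V.a_comm)
    next
      show "\<zero>\<^bsub>?M\<^esub> \<in> carrier ?M" by (simp add: simps cl)
      fix x assume "x \<in> carrier ?M"
      then obtain u where u: "u \<in> vecs n" "x = functional n u" using rep by blast
      then show "\<zero>\<^bsub>?M\<^esub> \<oplus>\<^bsub>?M\<^esub> x = x" by (simp add: simps)
      show "\<exists>y\<in>carrier ?M. y \<oplus>\<^bsub>?M\<^esub> x = \<zero>\<^bsub>?M\<^esub>"
        using u cl by (intro bexI[of _ "functional n (\<ominus>\<^bsub>V n\<^esub> u)"]) (simp_all add: simps V.l_neg)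
    qed
  next
    fix a x assume a: "a \<in> carrier R" and "x \<in> carrier ?M"
    then obtain u where u: "u \<in> vecs n" "x = functional n u" using rep by blast
    with a show "a \<odot>\<^bsub>?M\<^esub> x \<in> carrier ?M" by (simp add: simps cl)
    fix b assume b: "b \<in> carrier R"
    then show "(a \<oplus> b) \<odot>\<^bsub>?M\<^esub> x = a \<odot>\<^bsub>?M\<^esub> x \<oplus>\<^bsub>?M\<^esub> b \<odot>\<^bsub>?M\<^esub> x"
      and "(a \<otimes> b) \<odot>\<^bsub>?M\<^esub> x = a \<odot>\<^bsub>?M\<^esub> (b \<odot>\<^bsub>?M\<^esub> x)"
      using a u by (simp_all add: simps V.smult_l_distr V.smult_assoc1)
  next
    fix a x y assume a: "a \<in> carrier R" and xy: "x \<in> carrier ?M" "y \<in> carrier ?M"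
    obtain u where "u \<in> vecs n" "x = functional n u" using rep[OF xy(1)] by blast
    moreover obtain v where "v \<in> vecs n" "y = functional n v" using rep[OF xy(2)] by blast
    ultimately show "a \<odot>\<^bsub>?M\<^esub> (x \<oplus>\<^bsub>?M\<^esub> y) = a \<odot>\<^bsub>?M\<^esub> x \<oplus>\<^bsub>?M\<^esub> a \<odot>\<^bsub>?M\<^esub> y"
      using a by (simp add: simps V.smult_r_distr)
  next
    fix x assume "x \<in> carrier ?M"
    then obtain u where "u \<in> vecs n" "x = functional n u" using rep by blast
    then show "\<one> \<odot>\<^bsub>?M\<^esub> x = x" by (simp add: simps)
  qed (rule is_cring)
qed

lemma dual_map_functional:
  assumes "f \<in> lin m n" "w \<in> vecs n"
  shows "dual_map (V m) f (functional n w) = functional m (transpose_map R m n f w)"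
  using assms by (auto simp: dual_map_def functional_def compose_def dot_transpose mod_hom_closed)

text \<open>The cokernel in the definition of the transpose becomes a quotient of R^m by the image
  of a transposed map, so that uniqueness of minimal covers can be applied to it.\<close>

lemma transpose_cokernel_cover:
  assumes f: "f \<in> lin m n"
  defines "C \<equiv> quot_mod (dual_mod R (V m)) (dual_map (V m) f ` carrier (dual_mod R (V n)))"
  obtains \<gamma> where "\<gamma> \<in> mod_hom R (V m) C" "\<gamma> ` vecs m = carrier C"
    "a_kernel (V m) C \<gamma> = transpose_map R m n f ` vecs n"
proof -
  let ?M = "dual_mod R (V m)"
  let ?I = "transpose_map R m n f ` vecs n"
  define N where "N = dual_map (V m) f ` carrier (dual_mod R (V n))"
  have N: "N = functional m ` ?I"
    unfolding N_def functional_surj[symmetric] image_image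
    by (intro image_cong refl dual_map_functional[OF f])
  have "submodule ?I R (V m)"
    by (rule mod_hom_image_submodule[OF transpose_hom[OF f] module_free_mod module_free_mod V.carrier_is_submodule])
  then have sub: "submodule N R ?M"
    unfolding N by (rule mod_hom_image_submodule[OF functional_hom module_free_mod module_dual_free_mod])
  note proj = quot_mod_projection[OF module_dual_free_mod sub]
  have C: "C = quot_mod ?M N" by (simp add: C_def N_def)
  show ?thesis
  proof (rule that)
    show "(\<lambda>v. N +>\<^bsub>?M\<^esub> functional m v) \<in> mod_hom R (V m) C"
      unfolding C by (rule mod_hom_comp[OF functional_hom proj(1)])
    show "(\<lambda>v. N +>\<^bsub>?M\<^esub> functional m v) ` vecs m = carrier C"
      unfolding C proj(2)[symmetric] functional_surj[symmetric] image_image ..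
    have "?I \<subseteq> vecs m" using f by auto
    then have "{v \<in> vecs m. functional m v \<in> N} = ?I"
      unfolding N using functional_inj[of m] by (auto simp: inj_on_def)
    moreover have "N +>\<^bsub>?M\<^esub> functional m v = \<zero>\<^bsub>C\<^esub> \<longleftrightarrow> functional m v \<in> N" if "v \<in> vecs m" for v
      using proj(3) functional_closed[OF that] unfolding C a_kernel_def' by blast
    ultimately show "a_kernel (V m) C (\<lambda>v. N +>\<^bsub>?M\<^esub> functional m v) = ?I"
      by (auto simp: a_kernel_def')
  qed
qed

end

section \<open>The theorem\<close>

context lambda_summand
begin

text \<open>\<open>c (Suc j)\<close> is the rank in degree \<open>j\<close>. Comparison forces the
  ranks beyond any projective resolution to vanish; conversely \<open>q\<close> resolves X once its
  augmentation is carried back along \<open>\<xi>\<close>.\<close>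

lemma projective_resolution_of_summand:
  assumes X: "module R X" and \<xi>: "\<xi> \<in> mod_hom R X (V (b (Suc n)))" "inj_on \<xi> (carrier X)"
      "\<xi> ` carrier X = q 0 ` vecs (c 1)"
  shows "(\<exists>P dP e. projective_resolution R X p P dP e) \<longleftrightarrow> (\<forall>j>p. c (Suc j) = 0)"
proof
  interpret X: module R X by fact
  have \<xi>0: "\<xi> \<zero>\<^bsub>X\<^esub> = \<zero>\<^bsub>V (c 0)\<^esub>"
    using mod_hom_zero[OF \<xi>(1) X module_free_mod] by (simp add: c_0)
  have \<xi>_zero: "\<xi> x = \<zero>\<^bsub>V (c 0)\<^esub> \<longleftrightarrow> x = \<zero>\<^bsub>X\<^esub>" if "x \<in> carrier X" for x
    unfolding \<xi>0[symmetric] using that \<xi>(2) by (simp add: inj_on_eq_iff)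
  have \<xi>': "\<xi> \<in> mod_hom R X (V (c 0))" using \<xi>(1) by (simp add: c_0)
  show "\<forall>j>p. c (Suc j) = 0" if ex: "\<exists>P dP e. projective_resolution R X p P dP e"
  proof (intro allI impI)
    obtain P dP e where P: "projective_resolution R X p P dP e" using ex by blast
    have Ps: "\<And>i. fg_projective R (P i)" "\<And>i. p < i \<Longrightarrow> carrier (P i) = {\<zero>\<^bsub>P i\<^esub>}"
        "\<And>i. dP i \<in> mod_hom R (P (Suc i)) (P i)"
        "\<And>i. dP (Suc i) ` carrier (P (Suc (Suc i))) = a_kernel (P (Suc i)) (P i) (dP i)"
      and e: "e \<in> mod_hom R (P 0) X" "e ` carrier (P 0) = carrier X" "dP 0 ` carrier (P 1) = a_kernel (P 0) X e"
      using P by (simp_all add: projective_resolution_def)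
    fix j assume "p < j"
    then show "c (Suc j) = 0"
    proof (rule rank_zero_above_projective_resolution[where P = P and dP = dP and e = "\<lambda>x. \<xi> (e x)", rotated -1])
      show "(\<lambda>x. \<xi> (e x)) \<in> mod_hom R (P 0) (V (c 0))"
        by (rule mod_hom_comp[OF e(1) \<xi>'])
      show "(\<lambda>x. \<xi> (e x)) ` carrier (P 0) = q 0 ` vecs (c 1)"
        unfolding \<xi>(3)[symmetric] e(2)[symmetric] image_image ..
      have "a_kernel (P 0) (V (c 0)) (\<lambda>x. \<xi> (e x)) = a_kernel (P 0) X e"
        using \<xi>_zero mod_hom_closed[OF e(1)] by (auto simp: a_kernel_def')
      then show "dP 0 ` carrier (P 1) = a_kernel (P 0) (V (c 0)) (\<lambda>x. \<xi> (e x))"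
        using e(3) by simp
    qed (rule Ps | assumption)+
  qed
  assume z: "\<forall>j>p. c (Suc j) = 0"
  obtain k where k: "k \<in> mod_hom R (V (c 0)\<lparr>carrier := \<xi> ` carrier X\<rparr>) X"
    "\<And>x. x \<in> carrier X \<Longrightarrow> k (\<xi> x) = x"
    by (rule mod_hom_inverse[OF X \<xi>' \<xi>(2)]) blast
  define e where "e v = k (q 0 v)" for v
  have rep: "\<exists>x\<in>carrier X. q 0 v = \<xi> x" if "v \<in> vecs (c 1)" for v
    using that \<xi>(3) by blast
  have e_eq: "e v \<in> carrier X \<and> \<xi> (e v) = q 0 v" if v: "v \<in> vecs (c 1)" for v
    using rep[OF v] k(2) by (auto simp: e_def)
  have q0: "q 0 \<in> mod_hom R (V (c 1)) (V (c 0)\<lparr>carrier := \<xi> ` carrier X\<rparr>)"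
    using q_hom[of 0] \<xi>(3) by (intro mod_homI) (auto simp: mod_hom_add mod_hom_smult)
  have "projective_resolution R X p (\<lambda>j. V (c (Suc j))) (\<lambda>j. q (Suc j)) e"
    unfolding projective_resolution_def
  proof (intro conjI allI impI)
    show "e \<in> mod_hom R (V (c (Suc 0))) X"
      using mod_hom_comp[OF q0 k(1)] by (simp add: e_def[abs_def])
    show "vecs (c (Suc i)) = {\<zero>\<^bsub>V (c (Suc i))\<^esub>}" if "p < i" for i
      using that z zero_rank_0 by auto
    have "x \<in> e ` vecs (c 1)" if x: "x \<in> carrier X" for x
    proof -
      have "\<xi> x \<in> q 0 ` vecs (c 1)" using x \<xi>(3) by blast
      then obtain v where v: "v \<in> vecs (c 1)" "\<xi> x = q 0 v" by blast
      then have "e v = x" using k(2)[OF x] by (simp add: e_def)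
      with v show ?thesis by blast
    qed
    then show "e ` vecs (c (Suc 0)) = carrier X"
      using e_eq by auto
    have "e v = \<zero>\<^bsub>X\<^esub> \<longleftrightarrow> q 0 v = \<zero>\<^bsub>V (c 0)\<^esub>" if v: "v \<in> vecs (c 1)" for v
      using \<xi>_zero[of "e v"] e_eq[OF v] by simp
    then show "q (Suc 0) ` vecs (c (Suc 1)) = a_kernel (V (c (Suc 0))) X e"
      using q_exact[of 0] by (auto simp: a_kernel_def')
  qed (auto simp: X fg_projective_free_mod q_hom q_exact)
  then show "\<exists>P dP e. projective_resolution R X p P dP e" by blast
qed

text \<open>The set of possible lengths is \<open>{n..}\<close> for depth above n and empty
  otherwise, so the projective dimension is n or infinite.\<close>

lemma projdim_summand:
  assumes X: "module R X" and \<xi>: "\<xi> \<in> mod_hom R X (V (b (Suc n)))" "inj_on \<xi> (carrier X)"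
      "\<xi> ` carrier X = q 0 ` vecs (c 1)"
  shows "(projdim R X < \<infinity> \<longleftrightarrow> projdim R X = enat n) \<and>
         (projdim R X = enat n \<longleftrightarrow> local_depth R \<mm> > enat n)"
proof -
  have pd: "projdim R X = Inf (enat ` {p. \<forall>j>p. c (Suc j) = 0})"
    unfolding projdim_def projective_resolution_of_summand[OF assms] ..
  show ?thesis
  proof (cases "enat n < local_depth R \<mm>")
    case True
    then obtain xs where xs: "regular_sequence R xs" "set xs \<subseteq> \<mm>" "n < length xs"
      by (rule local_depth_greaterE)
    have "{p. \<forall>j>p. c (Suc j) = 0} = {n..}"
    proof (rule equalityI; rule subsetI)
      show "p \<in> {n..}" if "p \<in> {p. \<forall>j>p. c (Suc j) = 0}" for p
        using that zero_ranks_iff_large_depth(2)[OF xs order.refl] by (auto intro: leI)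
    qed (use zero_ranks_iff_large_depth(1)[OF xs] in auto)
    then have "projdim R X = Inf (enat ` {n..})" by (simp add: pd)
    also have "\<dots> = enat n"
      by (intro antisym Inf_lower Inf_greatest) auto
    finally show ?thesis using True by simp
  next
    case False
    then obtain xs y where "regular_sequence R xs" "set xs \<subseteq> \<mm>" "length xs \<le> n"
      "y \<in> carrier R" "y \<notin> Idl (set xs)" "\<And>x. x \<in> \<mm> \<Longrightarrow> x \<otimes> y \<in> Idl (set xs)"
      by (rule local_depth_leE) blast
    then have none: "\<not> (\<forall>j>p. c (Suc j) = 0)" for p
      using no_finite_resolution_if_small_depth[of xs y p] by blast
    have "projdim R X = Inf {}" unfolding pd by (simp add: none)
    then have "projdim R X = \<infinity>" by (simp add: top_enat_def)
    then show ?thesis using False by simp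
  qed
qed

end

section \<open>From syzygies, transposes and summands up to isomorphism to coordinates\<close>

lemma (in noetherian_local_ring) maximal_kills_residue_field:
  assumes "x \<in> \<mm>" "v \<in> carrier (residue_field_mod R \<mm>)"
  shows "x \<odot>\<^bsub>residue_field_mod R \<mm>\<^esub> v = \<zero>\<^bsub>residue_field_mod R \<mm>\<^esub>"
proof -
  have sub: "submodule \<mm> R (regular_module R)"
  proof -
    interpret M: module R "regular_module R" by (rule module_regular[OF is_cring])
    have neg: "\<ominus>\<^bsub>regular_module R\<^esub> y \<in> \<mm>" if "y \<in> \<mm>" for y
    proof -
      have "\<ominus>\<^bsub>regular_module R\<^esub> y = \<ominus> y"
        using that Icarr by (intro M.minus_equality) (auto simp: l_neg)
      then show ?thesis using that by simp
    qed
    show ?thesis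
    proof (rule M.submoduleI)
      show "\<mm> \<subseteq> carrier (regular_module R)" using Icarr by (simp add: subset_iff)
    qed (simp_all add: neg I_l_closed)
  qed
  note proj = quot_mod_projection[OF module_regular[OF is_cring] sub]
  obtain u where u: "u \<in> carrier R" "v = \<mm> +>\<^bsub>regular_module R\<^esub> u"
    using assms(2) proj(2) unfolding residue_field_mod_def by auto
  have xR: "x \<in> carrier R" using assms(1) by (rule Icarr)
  have "x \<odot>\<^bsub>residue_field_mod R \<mm>\<^esub> v = \<mm> +>\<^bsub>regular_module R\<^esub> (x \<otimes> u)"
    using mod_hom_smult[OF proj(1) xR, of u] u by (simp add: residue_field_mod_def)
  moreover have "x \<otimes> u \<in> a_kernel (regular_module R) (quot_mod (regular_module R) \<mm>) (\<lambda>x. \<mm> +>\<^bsub>regular_module R\<^esub> x)"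
    unfolding proj(3) using assms(1) u(1) by (rule I_r_closed)
  ultimately show ?thesis by (simp add: a_kernel_def' residue_field_mod_def)
qed

text \<open>Splices the presentation of \<open>\<Omega>\<^sup>n k\<close> used for the transpose into the resolution of \<open>k\<close>.\<close>

lemma (in noetherian_local_ring) residue_complex_of_syzygy:
  assumes syz: "is_syzygy R \<mm> n (residue_field_mod R \<mm>) S"
    and pres: "min_free_presentation R \<mm> S m l f e"
  obtains b d where "residue_complex R \<mm> n b d" "b n = l" "b (Suc n) = m" "d n = f"
proof -
  from pres have S: "module R S" and f: "f \<in> lin m l"
    and e: "e \<in> mod_hom R (V l) S" "e ` vecs l = carrier S"
    and fe: "f ` vecs m = a_kernel (V l) S e"
    and min: "a_kernel (V l) S e \<subseteq> ideal_mult R \<mm> (V l)"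
    by (auto simp: min_free_presentation_def Let_def)
  have ef: "e (f v) = \<zero>\<^bsub>S\<^esub>" if "v \<in> vecs m" for v
    using fe that by (auto simp: a_kernel_def')
  have f_kernel: "v \<in> f ` vecs m" if "v \<in> vecs l" "e v = \<zero>\<^bsub>S\<^esub>" for v
    using that by (simp add: fe a_kernel_def')
  have f_min: "f v \<in> ideal_vecs R \<mm> l" if "v \<in> vecs m" for v
    using that min fe ideal_mult_free_mod_subset[OF is_ideal] by blast
  have zero_hom: "(\<lambda>v. \<zero>\<^bsub>V i\<^esub>) \<in> mod_hom R M (V i)" for i and M :: "('a, nat \<Rightarrow> 'a) module"
    by (rule mod_hom_const_zero[OF module_free_mod])
  consider (zero) "n = 0" "mod_iso R S (residue_field_mod R \<mm>)"
    | (Suc) i b0 d0 e0 where "n = Suc i" "min_free_resolution R \<mm> (residue_field_mod R \<mm>) b0 d0 e0"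
      "mod_iso R S ((V (b0 i))\<lparr>carrier := d0 i ` vecs (b0 (Suc i))\<rparr>)"
    using syz unfolding is_syzygy_def by blast
  then show ?thesis
  proof cases
    case zero
    let ?k = "residue_field_mod R \<mm>"
    obtain g where k: "module R ?k" and g: "g \<in> mod_hom R S ?k" "bij_betw g (carrier S) (carrier ?k)"
      using zero(2) unfolding mod_iso_def by blast
    interpret S: module R S by fact
    \<comment> \<open>For n = 0 the presentation of k alone suffices: exactness is required only
      below n, so the complex may be continued by zero.\<close>
    define b where "b j = (if j = 0 then l else if j = 1 then m else 0)" for j :: nat
    define d where "d j = (if j = 0 then f else (\<lambda>v. \<zero>\<^bsub>V (b j)\<^esub>))" for j :: nat
    have "residue_complex R \<mm> n b d"
    proof unfold_locales
      show "d j \<in> lin (b (Suc j)) (b j)" for j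
        using f zero_hom by (simp add: b_def d_def)
      show "d j (d (Suc j) v) = \<zero>\<^bsub>V (b j)\<^esub>" for j v
        using mod_hom_zero[OF f module_free_mod module_free_mod] by (simp add: b_def d_def)
      show "d j v \<in> ideal_vecs R \<mm> (b j)" if "j \<le> n" "v \<in> vecs (b (Suc j))" for j v
        using that zero(1) f_min by (simp add: b_def d_def)
      show "x \<odot>\<^bsub>V (b 0)\<^esub> u \<in> d 0 ` vecs (b 1)"
        if x: "x \<in> \<mm>" and "u \<in> vecs (b 0)" for x u
      proof -
        have u: "u \<in> vecs l" using that by (simp add: b_def)
        have xR: "x \<in> carrier R" using x by (rule Icarr)
        have eu: "e u \<in> carrier S" by (rule mod_hom_closed[OF e(1) u])
        have "g (x \<odot>\<^bsub>S\<^esub> e u) = g \<zero>\<^bsub>S\<^esub>"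
          using mod_hom_smult[OF g(1) xR eu] maximal_kills_residue_field[OF x mod_hom_closed[OF g(1) eu]]
            mod_hom_zero[OF g(1) S k] by simp
        then have "x \<odot>\<^bsub>S\<^esub> e u = \<zero>\<^bsub>S\<^esub>"
          using inj_onD[OF bij_betw_imp_inj_on[OF g(2)]] eu xR by blast
        then have "e (x \<odot>\<^bsub>V l\<^esub> u) = \<zero>\<^bsub>S\<^esub>"
          using mod_hom_smult[OF e(1) xR u] by simp
        then show ?thesis
          using f_kernel[of "x \<odot>\<^bsub>V l\<^esub> u"] xR u by (simp add: b_def d_def)
      qed
    qed (use zero in simp)
    then show ?thesis using that[of b d] zero(1) by (simp add: b_def d_def)
  next
    case Suc
    have d0: "d0 j \<in> lin (b0 (Suc j)) (b0 j)"
      and d0_exact: "d0 (Suc j) ` vecs (b0 (Suc (Suc j)))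
        = a_kernel (V (b0 (Suc j))) (V (b0 j)) (d0 j)"
      and d0_min': "d0 j ` vecs (b0 (Suc j)) \<subseteq> ideal_mult R \<mm> (V (b0 j))" for j
      using Suc(2) by (simp_all add: min_free_resolution_def Let_def)
    note d0_min = order_trans[OF d0_min' ideal_mult_free_mod_subset[OF is_ideal]]
    have e0: "e0 \<in> mod_hom R (V (b0 0)) (residue_field_mod R \<mm>)"
      and d0e0: "d0 0 ` vecs (b0 1) = a_kernel (V (b0 0)) (residue_field_mod R \<mm>) e0"
      using Suc(2) by (simp_all add: min_free_resolution_def Let_def)
    obtain g where g: "g \<in> mod_hom R S ((V (b0 i))\<lparr>carrier := d0 i ` vecs (b0 (Suc i))\<rparr>)"
      "bij_betw g (carrier S) (d0 i ` vecs (b0 (Suc i)))"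
      using Suc(3) unfolding mod_iso_def by auto
    have g': "g \<in> mod_hom R S (V (b0 i))"
    proof (rule mod_homI)
      fix x assume "x \<in> carrier S"
      then have "g x \<in> d0 i ` vecs (b0 (Suc i))" using bij_betwE[OF g(2)] by blast
      then obtain w where "w \<in> vecs (b0 (Suc i))" "g x = d0 i w" by blast
      then show "g x \<in> vecs (b0 i)" using mod_hom_closed[OF d0] by simp
    qed (use mod_hom_add[OF g(1)] mod_hom_smult[OF g(1)] in auto)
    have g_zero: "x = \<zero>\<^bsub>S\<^esub>" if "x \<in> carrier S" "g x = \<zero>\<^bsub>V (b0 i)\<^esub>" for x
    proof -
      interpret S: module R S by fact
      have "g x = g \<zero>\<^bsub>S\<^esub>" using that(2) mod_hom_zero[OF g' S module_free_mod] by simp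
      then show ?thesis using inj_onD[OF bij_betw_imp_inj_on[OF g(2)]] that(1) by blast
    qed
    \<comment> \<open>The given presentation of the syzygy need not be part of the resolution
      \<open>d0\<close>. From degree \<open>i\<close> on it replaces \<open>d0\<close>; the joining
      map sends R^l onto the syzygy and then through \<open>g\<close> into degree \<open>i\<close>,
      with the same image as \<open>d0 i\<close>.\<close>
    define b where "b j = (if j \<le> i then b0 j else if j = Suc i then l else if j = Suc (Suc i) then m else 0)" for j
    define d where "d j = (if j < i then d0 j else if j = i then (\<lambda>v. g (e v)) else if j = Suc i then f
        else (\<lambda>v. \<zero>\<^bsub>V (b j)\<^esub>))" for j
    have image: "d j ` vecs (b (Suc j)) = d0 j ` vecs (b0 (Suc j))" if "j \<le> i" for j
    proof (cases "j = i")
      case True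
      have "(\<lambda>v. g (e v)) ` vecs l = g ` carrier S"
        unfolding e(2)[symmetric] image_image ..
      then show ?thesis using True g(2) by (simp add: b_def d_def bij_betw_def)
    qed (use that in \<open>simp add: b_def d_def\<close>)
    have ge: "(\<lambda>v. g (e v)) \<in> lin l (b0 i)"
      by (rule mod_hom_comp[OF e(1) g'])
    have d_hom: "d j \<in> lin (b (Suc j)) (b j)" for j
      using d0[of j] ge f zero_hom by (auto simp: b_def d_def)
    have "residue_complex R \<mm> n b d"
    proof unfold_locales
      show "d j \<in> lin (b (Suc j)) (b j)" for j by (rule d_hom)
      show "d j (d (Suc j) v) = \<zero>\<^bsub>V (b j)\<^esub>" if v: "v \<in> vecs (b (Suc (Suc j)))" for j v
      proof -
        consider "j < i" | "j = i" | "j > i" by linarith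
        then show ?thesis
        proof cases
          case 1
          then have "d (Suc j) v \<in> d0 (Suc j) ` vecs (b0 (Suc (Suc j)))"
            using imageI[OF v, of "d (Suc j)"] image[of "Suc j"] by simp
          then show ?thesis using 1 by (auto simp: d0_exact a_kernel_def' d_def b_def)
        next
          case 2
          then show ?thesis
            using v ef[of v] mod_hom_zero[OF g' S module_free_mod] by (simp add: b_def d_def)
        next
          case 3
          then have "d (Suc j) v = \<zero>\<^bsub>V (b (Suc j))\<^esub>" by (simp add: d_def)
          then show ?thesis using mod_hom_zero[OF d_hom module_free_mod module_free_mod] by simp
        qed
      qed
      show "v \<in> d (Suc j) ` vecs (b (Suc (Suc j)))"
        if j: "j < n" and v: "v \<in> vecs (b (Suc j))" "d j v = \<zero>\<^bsub>V (b j)\<^esub>" for j v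
      proof (cases "j < i")
        case True
        then have "v \<in> a_kernel (V (b0 (Suc j))) (V (b0 j)) (d0 j)"
          using v by (simp add: a_kernel_def' b_def d_def)
        then show ?thesis using image[of "Suc j"] True d0_exact by simp
      next
        case False
        then have ji: "j = i" using j Suc(1) by simp
        then have v': "v \<in> vecs l" "g (e v) = \<zero>\<^bsub>V (b0 i)\<^esub>"
          using v by (simp_all add: b_def d_def)
        then have "e v = \<zero>\<^bsub>S\<^esub>" using g_zero mod_hom_closed[OF e(1)] by blast
        then show ?thesis using f_kernel[OF v'(1)] ji by (simp add: b_def d_def)
      qed
      show "x \<odot>\<^bsub>V (b 0)\<^esub> u \<in> d 0 ` vecs (b 1)"
        if x: "x \<in> \<mm>" and "u \<in> vecs (b 0)" for x u
      proof -
        have u: "u \<in> vecs (b0 0)" using that by (simp add: b_def)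
        have xR: "x \<in> carrier R" using x by (rule Icarr)
        have "e0 (x \<odot>\<^bsub>V (b0 0)\<^esub> u) = \<zero>\<^bsub>residue_field_mod R \<mm>\<^esub>"
          using mod_hom_smult[OF e0 xR u] maximal_kills_residue_field[OF x mod_hom_closed[OF e0 u]] by simp
        then have "x \<odot>\<^bsub>V (b0 0)\<^esub> u \<in> d0 0 ` vecs (b0 1)"
          unfolding d0e0 using u xR by (simp add: a_kernel_def')
        then show ?thesis using image[of 0] by (simp add: b_def)
      qed
      show "d j v \<in> ideal_vecs R \<mm> (b j)" if j: "j \<le> n" and v: "v \<in> vecs (b (Suc j))" for j v
      proof (cases "j \<le> i")
        case True
        then have "d j v \<in> d0 j ` vecs (b0 (Suc j))"
            using imageI[OF v, of "d j"] image[OF True] by simp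
        then show ?thesis using d0_min True by (auto simp: b_def)
      next
        case False
        then have "j = Suc i" using j Suc(1) by simp
        then show ?thesis using v f_min by (simp add: b_def d_def)
      qed
    qed
    then show ?thesis using that[of b d] Suc(1) by (simp add: b_def d_def)
  qed
qed

text \<open>The dual of a minimal presentation of \<open>M\<close> is a minimal presentation of the transpose, and
  minimal covers are unique.\<close>

lemma (in noetherian_local_ring) lambda_embedding:
  assumes "is_lambda R \<mm> M L"
  obtains m l f e \<kappa> where "min_free_presentation R \<mm> M m l f e" "module R L"
    "\<kappa> \<in> mod_hom R L (V m)" "inj_on \<kappa> (carrier L)"
    "\<kappa> ` carrier L = transpose_map R m l f ` vecs l"
proof -
  obtain T :: "('a, ((nat \<Rightarrow> 'a) \<Rightarrow> 'a) set) module"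
    where T: "is_transpose R \<mm> M T" "is_syzygy R \<mm> 1 T L"
    using assms unfolding is_lambda_def by blast
  obtain m l f e where pres: "min_free_presentation R \<mm> M m l f e"
    and iso: "mod_iso R T (quot_mod (dual_mod R (V m))
      (dual_map (V m) f ` carrier (dual_mod R (V l))))"
    using T(1) unfolding is_transpose_def Let_def by blast
  define C where "C = quot_mod (dual_mod R (V m))
      (dual_map (V m) f ` carrier (dual_mod R (V l)))"
  have f: "f \<in> lin m l"
    and f_min': "f ` vecs m \<subseteq> ideal_mult R \<mm> (V l)"
    using pres by (simp_all add: min_free_presentation_def Let_def)
  have f_min: "f v \<in> ideal_vecs R \<mm> l" if "v \<in> vecs m" for v
    using subsetD[OF order_trans[OF f_min' ideal_mult_free_mod_subset[OF is_ideal]] imageI[OF that]] .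
  obtain t where T': "module R T" and C: "module R C" and t: "t \<in> mod_hom R T C" "bij_betw t (carrier T) (carrier C)"
    using iso unfolding mod_iso_def C_def by blast
  interpret T: module R T by fact
  obtain b d e' where res: "min_free_resolution R \<mm> T b d e'"
    and isoL: "mod_iso R L ((V (b 0))\<lparr>carrier := d 0 ` vecs (b (Suc 0))\<rparr>)"
    using T(2) unfolding is_syzygy_def by auto
  have e': "e' \<in> mod_hom R (V (b 0)) T" "e' ` vecs (b 0) = carrier T"
    and de': "d 0 ` vecs (b 1) = a_kernel (V (b 0)) T e'"
    and d_min': "\<forall>i. d i ` vecs (b (Suc i)) \<subseteq> ideal_mult R \<mm> (V (b i))"
    using res by (simp_all add: min_free_resolution_def Let_def)
  obtain s where L: "module R L" and s: "s \<in> mod_hom R L ((V (b 0))\<lparr>carrier := d 0 ` vecs (b 1)\<rparr>)"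
    "bij_betw s (carrier L) (d 0 ` vecs (b 1))"
    using isoL unfolding mod_iso_def by auto
  have kernel: "a_kernel (V (b 0)) C (\<lambda>v. t (e' v)) = d 0 ` vecs (b 1)"
  proof -
    have "t x = \<zero>\<^bsub>C\<^esub> \<longleftrightarrow> x = \<zero>\<^bsub>T\<^esub>" if "x \<in> carrier T" for x
      using mod_hom_zero[OF t(1) T' C] inj_on_eq_iff[OF bij_betw_imp_inj_on[OF t(2)] that T.M.zero_closed] by simp
    then show ?thesis unfolding de' using mod_hom_closed[OF e'(1)] by (auto simp: a_kernel_def')
  qed
  obtain \<gamma> where \<gamma>: "\<gamma> \<in> mod_hom R (V m) C" "\<gamma> ` vecs m = carrier C"
    "a_kernel (V m) C \<gamma> = transpose_map R m l f ` vecs l"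
    unfolding C_def by (rule transpose_cokernel_cover[OF f]) blast
  have "transpose_map R m l f w \<in> ideal_vecs R \<mm> m" if w: "w \<in> vecs l" for w
    using w f by (intro ideal_vecs_dotI) (auto simp: dot_transpose intro!: dot_in_ideal is_ideal f_min)
  then have \<gamma>_min: "a_kernel (V m) C \<gamma> \<subseteq> ideal_vecs R \<mm> m" unfolding \<gamma>(3) by blast
  \<comment> \<open>Two minimal covers of \<open>C\<close> are compared: the one from the resolution
    of \<open>T\<close>, and the one by the dual free module, whose kernel has coordinates in \<mm>
    because \<open>f\<close> does.\<close>
  obtain h where h: "h \<in> lin (b 0) m" "inj_on h (vecs (b 0))"
    "h ` a_kernel (V (b 0)) C (\<lambda>v. t (e' v)) = a_kernel (V m) C \<gamma>"
  proof (rule minimal_cover_unique[OF C mod_hom_comp[OF e'(1) t(1)] _ _ \<gamma>(1,2) \<gamma>_min])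
    show "(\<lambda>v. t (e' v)) ` vecs (b 0) = carrier C"
      using e'(2) t(2) by (metis bij_betw_imp_surj_on image_image)
    show "a_kernel (V (b 0)) C (\<lambda>v. t (e' v)) \<subseteq> ideal_vecs R \<mm> (b 0)"
      unfolding kernel using order_trans[OF spec[OF d_min', of 0] ideal_mult_free_mod_subset[OF is_ideal]] by simp
  qed blast
  have sub: "d 0 ` vecs (b 1) \<subseteq> vecs (b 0)"
    unfolding de' by (auto simp: a_kernel_def')
  have sL: "s ` carrier L = d 0 ` vecs (b 1)" using s(2) by (simp add: bij_betw_def)
  have s': "s \<in> mod_hom R L (V (b 0))"
    using s(1) sL sub by (intro mod_homI) (auto simp: mod_hom_add mod_hom_smult)
  show ?thesis
  proof (rule that[OF pres L mod_hom_comp[OF s' h(1)]])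
    show "inj_on (\<lambda>x. h (s x)) (carrier L)"
      using comp_inj_on[OF bij_betw_imp_inj_on[OF s(2)], of h] inj_on_subset[OF h(2) sub]
      by (simp add: sL comp_def)
    show "(\<lambda>x. h (s x)) ` carrier L = transpose_map R m l f ` vecs l"
      using h(3) unfolding kernel \<gamma>(3) sL[symmetric] image_image .
  qed
qed

theorem theorem1p3:
  fixes R :: "('a, 'r) ring_scheme"
    and \<mm> :: "'a set"
    and n :: nat
    and S :: "('a, 's, 's1) module_scheme"
    and L :: "('a, 'l, 'l1) module_scheme"
    and X :: "('a, 'x, 'x1) module_scheme"
  assumes "noetherian_local_ring R \<mm>"
    and "is_syzygy R \<mm> n (residue_field_mod R \<mm>) S"
    and "is_lambda R \<mm> S L"
    and "direct_summand R X L"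
    and "carrier X \<noteq> {\<zero>\<^bsub>X\<^esub>}"
  shows "(projdim R X < \<infinity> \<longleftrightarrow> projdim R X = enat n) \<and>
         (projdim R X = enat n \<longleftrightarrow> local_depth R \<mm> > enat n)"
proof -
  interpret noetherian_local_ring R \<mm> by fact
  obtain m l f e \<kappa> where pres: "min_free_presentation R \<mm> S m l f e" and L: "module R L"
    and \<kappa>: "\<kappa> \<in> mod_hom R L (free_mod R m)" "inj_on \<kappa> (carrier L)"
      "\<kappa> ` carrier L = transpose_map R m l f ` carrier (free_mod R l)"
    by (rule lambda_embedding[OF assms(3)]) blast
  obtain b d where res: "residue_complex R \<mm> n b d" and b: "b n = l" "b (Suc n) = m" and d: "d n = f"
    by (rule residue_complex_of_syzygy[OF assms(2) pres]) blast
  interpret residue_complex R \<mm> n b d by (rule res)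
  have D: "D n = transpose_map R m l f" by (simp add: D_def b d)
  have Dn: "D n \<in> mod_hom R (free_mod R l) (free_mod R m)" using D_hom[of n] by (simp add: b)
  obtain i \<rho> where X: "module R X" and i: "i \<in> mod_hom R X L" and \<rho>: "\<rho> \<in> mod_hom R L X"
    and \<rho>i: "\<And>x. x \<in> carrier X \<Longrightarrow> \<rho> (i x) = x"
    by (rule direct_summand_retract[OF assms(4)]) blast
  interpret X: module R X by (rule X)
  obtain k where k: "k \<in> mod_hom R (free_mod R m\<lparr>carrier := \<kappa> ` carrier L\<rparr>) L"
    "\<And>x. x \<in> carrier L \<Longrightarrow> k (\<kappa> x) = x"
    by (rule mod_hom_inverse[OF L \<kappa>(1,2)]) blast
  define \<xi> where "\<xi> x = \<kappa> (i x)" for x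
  have \<xi>: "\<xi> \<in> mod_hom R X (free_mod R m)"
    unfolding \<xi>_def using mod_hom_comp[OF i \<kappa>(1)] .
  have k\<xi>: "\<rho> (k (\<xi> x)) = x" if "x \<in> carrier X" for x
    using that mod_hom_closed[OF i that] by (simp add: \<xi>_def k(2) \<rho>i)
  have \<xi>_inj: "inj_on \<xi> (carrier X)"
    using k\<xi> by (metis (no_types, lifting) inj_onI)
  have \<xi>_image: "\<xi> x \<in> D n ` carrier (free_mod R l)" if "x \<in> carrier X" for x
    unfolding D \<kappa>(3)[symmetric] \<xi>_def using mod_hom_closed[OF i that] by blast
  have "submodule (\<xi> ` carrier X) R (free_mod R m)"
    by (rule mod_hom_image_submodule[OF \<xi> X module_free_mod X.carrier_is_submodule])
  then obtain c q where c: "c 0 = m"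
    and q: "\<And>j. q j \<in> mod_hom R (free_mod R (c (Suc j))) (free_mod R (c j))"
      "q 0 ` carrier (free_mod R (c 1)) = \<xi> ` carrier X"
      "\<And>j. q (Suc j) ` carrier (free_mod R (c (Suc (Suc j))))
        = a_kernel (free_mod R (c (Suc j))) (free_mod R (c j)) (q j)"
      "\<And>j. q (Suc j) ` carrier (free_mod R (c (Suc (Suc j)))) \<subseteq> ideal_vecs R \<mm> (c (Suc j))"
    by (rule exists_minimal_resolution) blast
  \<comment> \<open>\<open>k\<close> undoes the embedding of L on the image of \<open>D n\<close>,
    \<open>\<rho>\<close> projects to X, and \<open>\<xi>\<close> embeds X again.\<close>
  define r where "r u = \<xi> (\<rho> (k (D n u)))" for u
  have D': "D n \<in> mod_hom R (free_mod R l) (free_mod R m\<lparr>carrier := \<kappa> ` carrier L\<rparr>)"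
    using Dn unfolding \<kappa>(3) D by (intro mod_homI) (auto simp: mod_hom_add mod_hom_smult)
  have \<rho>kD: "(\<lambda>u. \<rho> (k (D n u))) \<in> mod_hom R (free_mod R l) X"
    by (rule mod_hom_comp[OF mod_hom_comp[OF D' k(1)] \<rho>])
  have r: "r \<in> mod_hom R (free_mod R l) (free_mod R m)"
    unfolding r_def by (rule mod_hom_comp[OF \<rho>kD \<xi>])
  have r_id: "r u = D n u" if "D n u \<in> \<xi> ` carrier X" for u
    using that k\<xi> by (auto simp: r_def)
  have r_image: "r ` carrier (free_mod R l) = \<xi> ` carrier X"
  proof
    show "r ` carrier (free_mod R l) \<subseteq> \<xi> ` carrier X"
      using mod_hom_closed[OF \<rho>kD] by (auto simp: r_def)
    show "\<xi> ` carrier X \<subseteq> r ` carrier (free_mod R l)"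
    proof
      fix y assume y: "y \<in> \<xi> ` carrier X"
      then obtain u where u: "u \<in> carrier (free_mod R l)" "y = D n u" using \<xi>_image by blast
      then have "y = r u" using r_id[of u] y by simp
      then show "y \<in> r ` carrier (free_mod R l)" using u(1) by (rule image_eqI)
    qed
  qed
  interpret lambda_summand R \<mm> n b d c q r
  proof unfold_locales
    show "c 1 \<noteq> 0"
    proof
      assume "c 1 = 0"
      then have "q 0 ` carrier (free_mod R (c 1)) \<subseteq> {\<zero>\<^bsub>free_mod R m\<^esub>}"
        using carrier_free_mod_0 mod_hom_zero[OF q(1)[of 0] module_free_mod module_free_mod] c by auto
      then have "\<xi> x = \<xi> \<zero>\<^bsub>X\<^esub>" if "x \<in> carrier X" for x
        using that mod_hom_zero[OF \<xi> X module_free_mod] unfolding q(2) by auto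
      then have "carrier X \<subseteq> {\<zero>\<^bsub>X\<^esub>}"
        using inj_onD[OF \<xi>_inj] X.M.zero_closed by blast
      then show False using assms(5) X.M.zero_closed by blast
    qed
    show "r u = \<zero>\<^bsub>free_mod R (b (Suc n))\<^esub>"
      if "u \<in> carrier (free_mod R (b n))" "D n u = \<zero>\<^bsub>free_mod R (b (Suc n))\<^esub>" for u
    proof -
      have "D n u = \<xi> \<zero>\<^bsub>X\<^esub>" using that(2) mod_hom_zero[OF \<xi> X module_free_mod] b by simp
      then show ?thesis using r_id[of u] that(2) by simp
    qed
    show "q (Suc j) v \<in> ideal_vecs R \<mm> (c (Suc j))" if "v \<in> carrier (free_mod R (c (Suc (Suc j))))" for j v
      using q(4) that by blast
    show "q 0 ` carrier (free_mod R (c 1)) \<subseteq> D n ` carrier (free_mod R (b n))"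
      unfolding q(2) b using \<xi>_image by blast
    show "r u = D n u" if "D n u \<in> q 0 ` carrier (free_mod R (c 1))" for u
      using that unfolding q(2) by (rule r_id)
    show "r ` carrier (free_mod R (b n)) = q 0 ` carrier (free_mod R (c 1))"
      unfolding q(2) b by (rule r_image)
  qed (simp_all add: q(1,3) c b r)
  have "\<xi> \<in> mod_hom R X (free_mod R (b (Suc n)))" using \<xi> by (simp add: b)
  then show ?thesis
    by (rule projdim_summand[OF X _ \<xi>_inj q(2)[symmetric]])
qed

end
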